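(* Let $g\neq 0$ be a continuous real-valued function on $(0,\infty)$. (i) If $g\in\mathbf{SOC}(0,\infty)$, then the function $t\mapsto g(t^{p})$ belongs to $\mathbf{Kwong}(0,\infty)$ for every $-1\leq p\leq 1$. (ii) If $g\in\mathbf{Kwong}(0,\infty)$, then the function $t\mapsto \frac{g(t^{p})}{t^{p}}$ belongs to $\mathbf{SOC}(0,\infty)$ for every $0\leq p\leq \frac12$.
   Context: Operators are bounded linear operators on a complex Hilbert space $\mathcal{H}$; for self-adjoint $A,B$, $A\le B$ means $\langle (B-A)x,x\rangle\ge 0$ for all $x$; $g(A)$ denotes the continuous functional calculus. A continuous real-valued function $g$ on an interval $J$ is strongly operator convex on $J$, written $g\in\mathbf{SOC}(J)$, if $P g(PAP)P\le g(A)$ for every self-adjoint operator $A$ (on any complex Hilbert space) with spectrum in $J$ and every orthogonal projection $P$; here $g(PAP)$ is computed for the compression of $A$ to the range of $P$, so $Pg(PAP)P$ equals $g(PAP|_{P\mathcal{H}})$ on $P\mathcal{H}$ and $0$ on $(P\mathcal{H})^\perp$. A real-valued continuous function $f$ on $(0,\infty)$ is a Kwong function, written $f\in\mathbf{Kwong}(0,\infty)$, if for every $n$ and all distinct $t_1,\dots,t_n\in(0,\infty)$ the $n\times n$ matrix $\left[\frac{f(t_i)+f(t_j)}{t_i+t_j}\right]_{i,j=1}^{n}$ is positive semidefinite. *)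

theory Defs
  imports "HOL-Analysis.Analysis" "HOL-Computational_Algebra.Polynomial"
begin

section \<open>Complex Hilbert spaces\<close>

text \<open>The inherited real inner product is required to be the real part of the complex one, so that
  norm, topology and completeness are those of the complex inner product. \<open>cinner\<close> is linear in its
  first argument.\<close>

class complex_inner = real_inner +
  fixes scaleC :: "complex \<Rightarrow> 'a \<Rightarrow> 'a"  (infixr "*\<^sub>C" 75)
    and cinner :: "'a \<Rightarrow> 'a \<Rightarrow> complex"
  assumes scaleC_add_right: "c *\<^sub>C (x + y) = c *\<^sub>C x + c *\<^sub>C y"
    and scaleC_add_left: "(c + d) *\<^sub>C x = c *\<^sub>C x + d *\<^sub>C x"
    and scaleC_scaleC: "c *\<^sub>C d *\<^sub>C x = (c * d) *\<^sub>C x"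
    and scaleC_of_real: "complex_of_real r *\<^sub>C x = r *\<^sub>R x"
    and cinner_commute: "cinner x y = cnj (cinner y x)"
    and cinner_add_left: "cinner (x + y) z = cinner x z + cinner y z"
    and cinner_scaleC_left: "cinner (c *\<^sub>C x) y = c * cinner x y"
    and inner_eq_Re_cinner: "inner x y = Re (cinner x y)"

class complex_hilbert = complex_inner + complete_space

global_interpretation complex_vector: vector_space "scaleC :: complex \<Rightarrow> 'a \<Rightarrow> 'a::complex_inner"
proof
  show "1 *\<^sub>C x = x" for x :: 'a
    using scaleC_of_real [of 1 x] by simp
qed (simp_all add: scaleC_add_right scaleC_add_left scaleC_scaleC)

definition infinite_dimensional :: "'h::complex_inner itself \<Rightarrow> bool" where
  "infinite_dimensional _ \<longleftrightarrow> \<not> (\<exists>B :: 'h set. finite B \<and> complex_vector.span B = UNIV)"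

section \<open>Bounded operators\<close>

text \<open>The library type of bounded linear maps is only real-linear; complex linearity is imposed
  separately.\<close>

definition clinear_op :: "('h::complex_hilbert \<Rightarrow>\<^sub>L 'h) \<Rightarrow> bool" where
  "clinear_op A \<longleftrightarrow> (\<forall>c x. A (c *\<^sub>C x) = c *\<^sub>C A x)"

definition selfadjoint :: "('h::complex_hilbert \<Rightarrow>\<^sub>L 'h) \<Rightarrow> bool" where
  "selfadjoint A \<longleftrightarrow> clinear_op A \<and> (\<forall>x y. cinner (A x) y = cinner x (A y))"

definition orth_projection :: "('h::complex_hilbert \<Rightarrow>\<^sub>L 'h) \<Rightarrow> bool" where
  "orth_projection P \<longleftrightarrow> selfadjoint P \<and> P o\<^sub>L P = P"

text \<open>The order on self-adjoint operators, for which the inner product below is real.\<close>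

definition op_le :: "('h::complex_hilbert \<Rightarrow>\<^sub>L 'h) \<Rightarrow> ('h \<Rightarrow>\<^sub>L 'h) \<Rightarrow> bool" where
  "op_le A B \<longleftrightarrow> (\<forall>x. 0 \<le> Re (cinner ((B - A) x) x))"

section \<open>Operators on a closed subspace\<close>

text \<open>
  A closed subspace of \<open>'h\<close> is the range \<open>E\<H>\<close> of an orthogonal projection \<open>E\<close>, and is itself a
  complex Hilbert space. A bounded operator on \<open>E\<H>\<close> is identified with its extension by \<open>0\<close> on the
  orthogonal complement of \<open>E\<H>\<close>, that is, with an operator \<open>A\<close> satisfying \<open>E A E = A\<close>. The identity
  of \<open>E\<H>\<close> then corresponds to \<open>E\<close>, so powers, invertibility, spectrum and functional calculus are
  all taken relative to the unit \<open>E\<close>; for \<open>E = id_blinfun\<close> they are the usual notions on \<open>'h\<close>.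
\<close>

definition operator_on :: "('h::complex_hilbert \<Rightarrow>\<^sub>L 'h) \<Rightarrow> ('h \<Rightarrow>\<^sub>L 'h) \<Rightarrow> bool" where
  "operator_on E A \<longleftrightarrow> clinear_op A \<and> E o\<^sub>L A o\<^sub>L E = A"

text \<open>\<open>R\<close> is the inverse of \<open>A - z\<close> on \<open>E\<H>\<close>.\<close>

definition spectrum_on :: "('h::complex_hilbert \<Rightarrow>\<^sub>L 'h) \<Rightarrow> ('h \<Rightarrow>\<^sub>L 'h) \<Rightarrow> complex set" where
  "spectrum_on E A = {z. \<not> (\<exists>R. operator_on E R \<and>
     (\<forall>x. R (A x - z *\<^sub>C E x) = E x) \<and> (\<forall>x. A (R x) - z *\<^sub>C R x = E x))}"

definition op_poly_on :: "('h::complex_hilbert \<Rightarrow>\<^sub>L 'h) \<Rightarrow> real poly \<Rightarrow> ('h \<Rightarrow>\<^sub>L 'h) \<Rightarrow> ('h \<Rightarrow>\<^sub>L 'h)" where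
  "op_poly_on E p A = (\<Sum>i\<le>degree p. coeff p i *\<^sub>R (((o\<^sub>L) A ^^ i) E))"

text \<open>
  Continuous functional calculus of a self-adjoint operator \<open>A\<close> on \<open>E\<H>\<close>, for real-valued \<open>g\<close>
  continuous on the spectrum: the limit in operator norm of \<open>p\<^sub>n(A)\<close>, for any real polynomials
  \<open>p\<^sub>n\<close> converging to \<open>g\<close> uniformly on the spectrum of \<open>A\<close>. The result is again extended by \<open>0\<close>.
\<close>

definition cfc_on :: "('h::complex_hilbert \<Rightarrow>\<^sub>L 'h) \<Rightarrow> (real \<Rightarrow> real) \<Rightarrow> ('h \<Rightarrow>\<^sub>L 'h) \<Rightarrow> ('h \<Rightarrow>\<^sub>L 'h)" where
  "cfc_on E g A = (THE B. \<exists>p :: nat \<Rightarrow> real poly.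
     uniform_limit {t. complex_of_real t \<in> spectrum_on E A} (\<lambda>n. poly (p n)) g sequentially \<and>
     (\<lambda>n. op_poly_on E (p n) A) \<longlonglongrightarrow> B)"

section \<open>Strongly operator convex functions and Kwong functions\<close>

text \<open>
  A definition cannot quantify over all types, so the Hilbert spaces range over all closed subspaces
  \<open>E\<H>\<close> of the Hilbert space \<open>'h\<close>, i.e. over all Hilbert spaces of dimension at most that of \<open>'h\<close>,
  up to unitary equivalence. To assert strong operator convexity in full, leave the type \<open>'h\<close>
  arbitrary. To assume it, take \<open>'h\<close> infinite-dimensional: over a finite-dimensional \<open>'h\<close> the
  property is strictly weaker (on \<open>\<complex>\<close> it only says that \<open>g\<close> is nonnegative), whereas every
  infinite-dimensional \<open>'h\<close> contains copies of all separable Hilbert spaces.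
  The condition \<open>E o\<^sub>L P = P\<close> says that \<open>P\<close> is a projection of \<open>E\<H>\<close>.
\<close>

definition SOC :: "'h::complex_hilbert itself \<Rightarrow> real set \<Rightarrow> (real \<Rightarrow> real) \<Rightarrow> bool" where
  "SOC _ J g \<longleftrightarrow> continuous_on J g \<and>
     (\<forall>E A P :: 'h \<Rightarrow>\<^sub>L 'h.
        orth_projection E \<and>
        operator_on E A \<and> selfadjoint A \<and> spectrum_on E A \<subseteq> complex_of_real ` J \<and>
        orth_projection P \<and> E o\<^sub>L P = P \<longrightarrow>
        op_le (P o\<^sub>L cfc_on P g (P o\<^sub>L A o\<^sub>L P) o\<^sub>L P) (cfc_on E g A))"

definition pos_semidef :: "nat \<Rightarrow> (nat \<Rightarrow> nat \<Rightarrow> real) \<Rightarrow> bool" where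
  "pos_semidef n M \<longleftrightarrow> (\<forall>i<n. \<forall>j<n. M i j = M j i) \<and>
     (\<forall>x :: nat \<Rightarrow> real. 0 \<le> (\<Sum>i<n. \<Sum>j<n. x i * M i j * x j))"

definition Kwong :: "(real \<Rightarrow> real) \<Rightarrow> bool" where
  "Kwong f \<longleftrightarrow> continuous_on {0<..} f \<and>
     (\<forall>n (t :: nat \<Rightarrow> real). inj_on t {..<n} \<and> (\<forall>i<n. 0 < t i) \<longrightarrow>
        pos_semidef n (\<lambda>i j. (f (t i) + f (t j)) / (t i + t j)))"

end

theory Submission
  imports Defs "HOL-Computational_Algebra.Fundamental_Theorem_Algebra"
begin

text \<open>
  (i) Applying the defining inequality of \<open>SOC\<close> to a diagonal matrix and a projection of corank one
  whose compression has prescribed eigenvalues shows that the Loewner matrices of \<open>- g\<close> and of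
  \<open>t \<mapsto> t * g t\<close> are positive semidefinite. Since
  \<open>(g a + g b) / (a + b) = - (g a - g b) / (a - b) + 2 / (a + b) * (a * g a - b * g b) / (a - b)\<close>,
  the Schur product theorem with the Cauchy matrix shows that \<open>g\<close> is a Kwong function; a Schur product
  with the Kwong matrix of \<open>t powr p\<close> then gives \<open>g (t powr p)\<close>.

  (ii) If \<open>g\<close> is Kwong then so is \<open>h t = t powr (1 - 2 * p) * g (t powr (2 * p))\<close>, and the function
  in question is \<open>u \<mapsto> h (sqrt u) / sqrt u\<close>. A spectral factorization of polynomials shows that a finitely
  supported functional that is nonnegative on all \<open>u \<mapsto> 1 / (u + s)\<close>, \<open>s \<ge> 0\<close>, is nonnegative on this
  function. The functional
  \<open>f \<mapsto> \<langle>f(A) x, x\<rangle> - \<langle>f(P A P) P x, P x\<rangle>\<close> is nonnegative on these resolvent functions, and Bernstein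
  operators discretize it with an error that a small extra point mass absorbs.
\<close>

section \<open>Polynomials and the dual cone of Kwong functions\<close>

text \<open>Classically (ii) would use an integral representation of Kwong functions, obtained from
  Loewner's theory. Here a duality replaces it: nonnegativity on the functions
  \<open>t / (t^2 + s)\<close> implies nonnegativity on all Kwong functions. The argument is
  algebraic and is carried out for functionals supported on finitely many distinct points, which is
  why the operator inequality has to be discretized. The error must be controlled uniformly in
  \<open>s \<ge> 0\<close>; it is bounded by a multiple of \<open>1 / (M + s)\<close>, the resolvent
  function at the right end \<open>M\<close> of the interval, so a mass at \<open>M\<close> is the
  right correction. The substitution \<open>u = t^2\<close> doubles the exponent, and
  \<open>2 * p \<le> 1\<close> is what the power lemma for Kwong functions allows. In (i) the
  obstacle is that the operator inequality provides no derivatives, hence no diagonal entries of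
  Loewner matrices. The corank-one projection leaves one eigenvalue \<open>s\<close> free, the
  resulting inequality is affine in \<open>s\<close>, and \<open>s\<close> near 0 and near infinity
  separate the two Loewner inequalities. Nodes \<open>a\<close> are paired with shifted nodes
  \<open>a + \<epsilon>\<close>, and \<epsilon> is removed only after both inequalities have been
  combined.\<close>

lemma lagrange_interpolation:
  fixes f :: "real poly" and c :: "'i \<Rightarrow> real"
  assumes fin: "finite I" and inj: "inj_on c I" and deg: "degree f < card I"
  shows "poly f x = (\<Sum>k\<in>I. poly f (c k) * (\<Prod>l\<in>I-{k}. (x - c l) / (c k - c l)))"
proof -
  define L where "L = (\<Sum>k\<in>I. smult (poly f (c k)) (\<Prod>l\<in>I-{k}. smult (1 / (c k - c l)) [:- c l, 1:]))"
  have L: "poly L x = (\<Sum>k\<in>I. poly f (c k) * (\<Prod>l\<in>I-{k}. (x - c l) / (c k - c l)))" for x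
    unfolding L_def by (simp add: poly_sum poly_prod diff_divide_distrib)
  have "degree L \<le> card I - 1"
    unfolding L_def
  proof (intro degree_sum_le fin)
    fix k assume k: "k \<in> I"
    have "degree (\<Prod>l\<in>I-{k}. smult (1 / (c k - c l)) [:- c l, 1:]) \<le> (\<Sum>l\<in>I-{k}. 1)"
      using fin by (intro order.trans[OF degree_prod_sum_le] sum_mono) auto
    then show "degree (smult (poly f (c k)) (\<Prod>l\<in>I-{k}. smult (1 / (c k - c l)) [:- c l, 1:])) \<le> card I - 1"
      using fin k by (intro order.trans[OF degree_smult_le]) simp
  qed
  then have degL: "degree L < card I" using deg by linarith
  have "poly L (c j) = poly f (c j)" if j: "j \<in> I" for j
  proof -
    have "(\<Prod>l\<in>I-{k}. (c j - c l) / (c k - c l)) = (if k = j then 1 else 0)" if "k \<in> I" for k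
    proof (cases "k = j")
      case True
      have "c j \<noteq> c l" if "l \<in> I - {j}" for l using that inj j by (auto simp: inj_on_def)
      then show ?thesis using True by (intro trans[OF prod.neutral]) auto
    next
      case False
      then show ?thesis using fin j by (auto intro!: prod_zero)
    qed
    then have "poly L (c j) = (\<Sum>k\<in>I. if k = j then poly f (c k) else 0)"
      unfolding L by (intro sum.cong) auto
    then show ?thesis using fin j by simp
  qed
  then have "L = f"
    using degL deg card_image[OF inj] by (intro poly_eqI_degree[of "c ` I"]) auto
  then show ?thesis using L[of x] by simp
qed

text \<open>The interpolation formula divided by the nodal polynomial. It evaluates sums with
  denominators \<open>x - c k\<close> whose numerators are residues of a rational function, which is
  how the explicit Cauchy-type sums below are computed.\<close>

lemma lagrange_partial_fractions:
  fixes f :: "real poly" and c :: "'i \<Rightarrow> real"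
  assumes fin: "finite I" and inj: "inj_on c I" and deg: "degree f < card I"
    and x: "\<And>k. k \<in> I \<Longrightarrow> x \<noteq> c k"
  shows "(\<Sum>k\<in>I. poly f (c k) / ((x - c k) * (\<Prod>l\<in>I-{k}. c k - c l))) = poly f x / (\<Prod>l\<in>I. x - c l)"
proof -
  have nz: "(\<Prod>l\<in>I. x - c l) \<noteq> 0" using fin x by simp
  have "poly f x = (\<Sum>k\<in>I. (\<Prod>l\<in>I. x - c l) * (poly f (c k) / ((x - c k) * (\<Prod>l\<in>I-{k}. c k - c l))))"
    unfolding lagrange_interpolation[OF fin inj deg, of x]
  proof (intro sum.cong refl)
    fix k assume k: "k \<in> I"
    have "(\<Prod>l\<in>I. x - c l) = (x - c k) * (\<Prod>l\<in>I-{k}. x - c l)"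
      using fin k by (rule prod.remove)
    then show "poly f (c k) * (\<Prod>l\<in>I-{k}. (x - c l) / (c k - c l)) =
       (\<Prod>l\<in>I. x - c l) * (poly f (c k) / ((x - c k) * (\<Prod>l\<in>I-{k}. c k - c l)))"
      using x[OF k] by (simp add: prod_dividef)
  qed
  then show ?thesis
    unfolding sum_distrib_left[symmetric] by (simp only: nonzero_mult_div_cancel_left[OF nz])
qed

lemma poly_interpolation_exists:
  fixes g :: "real \<Rightarrow> real"
  assumes "finite S"
  shows "\<exists>p. \<forall>x\<in>S. poly p x = g x"
  using assms
proof (induction S rule: finite_induct)
  case (insert a S)
  then obtain p where p: "\<And>x. x \<in> S \<Longrightarrow> poly p x = g x" by blast
  define q where "q = (\<Prod>s\<in>S. [:- s, 1:])"
  have q: "poly q x = (\<Prod>s\<in>S. x - s)" for x unfolding q_def by (simp add: poly_prod)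
  have "poly q a \<noteq> 0" "\<And>x. x \<in> S \<Longrightarrow> poly q x = 0" unfolding q using insert by auto
  then show ?case using p by (intro exI[of _ "p + smult ((g a - poly p a) / poly q a) q"]) auto
qed simp

text \<open>A complex root is either real or pairs with its conjugate into a quadratic that is
  positive on the real line.\<close>

lemma real_poly_factor:
  fixes q :: "real poly"
  assumes "degree q > 0"
  obtains (linear) a q' where "q = [:- a, 1:] * q'"
  | (quadratic) \<alpha> \<beta> q' where "\<beta> \<noteq> 0" "q = [:\<alpha>\<^sup>2 + \<beta>\<^sup>2, - 2 * \<alpha>, 1:] * q'"
proof -
  let ?Q = "map_poly complex_of_real"
  have "\<not> constant (poly (?Q q))"
    using assms by (simp add: constant_degree degree_map_poly)
  then obtain z where z: "poly (?Q q) z = 0"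
    using fundamental_theorem_of_algebra by blast
  show ?thesis
  proof (cases "Im z = 0")
    case True
    have "poly (?Q p) (of_real x) = of_real (poly p x)" for p x
      by (induction p) (auto simp: map_poly_pCons)
    moreover have "z = of_real (Re z)" using True by (simp add: complex_eq_iff)
    ultimately have "poly q (Re z) = 0" using z by (metis of_real_eq_0_iff)
    then show ?thesis using that(1) by (auto simp: poly_eq_0_iff_dvd elim!: dvdE)
  next
    case False
    \<comment> \<open>The real quadratic with roots \<open>z\<close> and its conjugate.\<close>
    let ?d = "[:(Re z)\<^sup>2 + (Im z)\<^sup>2, - 2 * Re z, 1:]"
    define r where "r = q mod ?d"
    have q: "q = ?d * (q div ?d) + r" unfolding r_def by (rule mult_div_mod_eq[symmetric])
    have "r = 0 \<or> degree r < degree ?d" unfolding r_def by (intro degree_mod_less) simp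
    then have "degree r < 2" by auto
    then have r: "r = [:coeff r 0, coeff r 1:]"
      by (intro poly_eqI) (auto simp: coeff_pCons coeff_eq_0 split: nat.splits)
    have d0: "poly (?Q ?d) z = 0"
      by (simp add: map_poly_pCons complex_eq_iff power2_eq_square algebra_simps)
    have mp: "?Q (a * b + c) = ?Q a * ?Q b + ?Q c" for a b c
      by (intro poly_eqI) (simp add: coeff_map_poly coeff_mult)
    have "?Q q = ?Q ?d * ?Q (q div ?d) + ?Q r"
      using mp[of ?d "q div ?d" r] unfolding q[symmetric] .
    then have "poly (?Q r) z = 0" using z d0 by (simp only: poly_add poly_mult mult_zero_left add_0)
    then have "of_real (coeff r 0) + z * of_real (coeff r 1) = 0"
      by (subst (asm) r) (simp add: map_poly_pCons)
    \<comment> \<open>A real polynomial of degree at most one with a nonreal root is zero: the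
      imaginary part kills the slope, the real part then the constant.\<close>
    then have "coeff r 1 = 0" "coeff r 0 = 0" using False by (auto simp: complex_eq_iff)
    then have "r = 0" using r by simp
    then show ?thesis using that(2)[of "Im z" "Re z" "q div ?d"] False q by simp
  qed
qed

text \<open>Continuity from the right. Cancelling a factor that vanishes at \<open>a\<close> leaves
  the sign of the cofactor undetermined at that one point; this restores it.\<close>

lemma poly_nonneg_off_point:
  fixes p :: "real poly"
  assumes "\<And>s. s \<ge> c \<Longrightarrow> s \<noteq> a \<Longrightarrow> poly p s \<ge> 0" and "s \<ge> c"
  shows "poly p s \<ge> 0"
proof (cases "s = a")
  case True
  have "((\<lambda>x. poly p x) \<longlongrightarrow> poly p a) (at_right a)"
    by (intro tendsto_intros)
  moreover have "\<forall>\<^sub>F x in at_right a. poly p x \<ge> 0"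
    using assms True by (auto simp: eventually_at_right_field intro!: exI[of _ "a + 1"])
  ultimately show ?thesis
    using True by (metis tendsto_lowerbound trivial_limit_at_right_real)
qed (use assms in auto)

text \<open>A factorization of Fejer-Riesz type: the hypothesis says that \<open>q(- x^2)\<close> is
  nonnegative on the imaginary axis. The conclusion is multiplicative, so the factors of
  \<open>q\<close> can be split one at a time.\<close>

lemma spectral_factorization:
  fixes q :: "real poly"
  assumes "\<And>s. s \<ge> 0 \<Longrightarrow> poly q s \<ge> 0"
  shows "\<exists>r. degree r \<le> degree q \<and> (\<forall>x. poly q (- x\<^sup>2) = poly r x * poly r (- x))"
  using assms
proof (induction "degree q" arbitrary: q rule: less_induct)
  case less
  note nonneg = less.prems
  \<comment> \<open>Peels off a factor \<open>d\<close> with known splitting \<open>e\<close>; the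
    sign of the cofactor may be unknown at the single point \<open>a\<close>.\<close>
  have reduce: ?case
    if q: "q = d * q'" and d: "degree d > 0" and q': "\<And>s. s \<ge> 0 \<Longrightarrow> s \<noteq> a \<Longrightarrow> poly q' s \<ge> 0"
      and e: "degree e \<le> degree d" "\<And>x. poly d (- x\<^sup>2) = poly e x * poly e (- x)" for d q' e a
  proof (cases "q' = 0")
    case False
    then have deg: "degree q = degree d + degree q'"
      using d unfolding q by (intro degree_mult_eq) auto
    then obtain r where "degree r \<le> degree q'" "\<And>x. poly q' (- x\<^sup>2) = poly r x * poly r (- x)"
      using less.hyps[of q'] poly_nonneg_off_point[of 0 a q'] q' d by auto
    then show ?thesis
      using deg e by (intro exI[of _ "e * r"]) (auto simp: q intro: order.trans[OF degree_mult_le])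
  qed (auto simp: q intro: exI[of _ 0])
  show ?case
  proof (cases "degree q = 0")
    case True
    then obtain c where q: "q = [:c:]" by (metis degree_eq_zeroE)
    then have "c \<ge> 0" using nonneg[of 0] by simp
    then show ?thesis using q by (intro exI[of _ "[:sqrt c:]"]) simp
  next
    case False
    then have "degree q > 0" by simp
    then show ?thesis
    proof (cases q rule: real_poly_factor)
      case (linear a q')
      have sgn: "(s - a) * poly q' s \<ge> 0" if "s \<ge> 0" for s
        using nonneg[OF that] by (simp add: linear algebra_simps)
      show ?thesis
      proof (cases "a \<le> 0")
        case True
        show ?thesis
        proof (rule reduce[OF linear, where a = a and e = "[:sqrt (- a), 1:]"])
          show "poly q' s \<ge> 0" if "s \<ge> 0" "s \<noteq> a" for s
            using sgn[OF that(1)] that True by (simp add: zero_le_mult_iff)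
        qed (use True in \<open>auto simp: algebra_simps power2_eq_square\<close>)
      next
        case False
        \<comment> \<open>A positive root cannot be simple, since \<open>q\<close> would change sign
          there: the cofactor is nonnegative to the right of \<open>a\<close> and nonpositive to the
          left, so it vanishes at \<open>a\<close>. The double factor becomes the square of
          \<open>x^2 + a\<close>.\<close>
        have "poly q' s \<ge> 0" if "s \<ge> a" "s \<noteq> a" for s
          using sgn[of s] that False by (simp add: zero_le_mult_iff)
        then have "poly q' a \<ge> 0" by (rule poly_nonneg_off_point) auto
        moreover have "((\<lambda>x. poly q' x) \<longlongrightarrow> poly q' a) (at_left a)"
          by (intro tendsto_intros)
        then have "poly q' a \<le> 0"
        proof (rule tendsto_upperbound)
          show "\<forall>\<^sub>F x in at_left a. poly q' x \<le> 0"
            unfolding eventually_at_left_field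
          proof (intro exI[of _ 0] conjI allI impI)
            fix s assume "0 < s" "s < a"
            then show "poly q' s \<le> 0" using sgn[of s] by (simp add: zero_le_mult_iff)
          qed (use False in simp)
        qed simp
        ultimately obtain q'' where q'': "q' = [:- a, 1:] * q''"
          by (metis dvdE order_antisym poly_eq_0_iff_dvd)
        show ?thesis
        proof (rule reduce[where a = a and e = "[:a, 0, 1:]" and d = "[:- a, 1:] * [:- a, 1:]" and q' = q''])
          show "q = [:- a, 1:] * [:- a, 1:] * q''" using linear q'' by (simp only: mult.assoc)
          show "poly q'' s \<ge> 0" if "s \<ge> 0" "s \<noteq> a" for s
          proof -
            have "(s - a)\<^sup>2 * poly q'' s \<ge> 0"
              using sgn[OF that(1)] by (simp add: q'' power2_eq_square algebra_simps)
            then show ?thesis using that(2) by (simp add: zero_le_mult_iff)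
          qed
        qed (auto simp: algebra_simps power2_eq_square)
      qed
    next
      case (quadratic \<alpha> \<beta> q')
      \<comment> \<open>The modulus of the complex roots. In
        \<open>(x^2 + c x + \<rho>) (x^2 - c x + \<rho>)\<close> the coefficient of
        \<open>x^2\<close> is \<open>2 \<rho> - c^2\<close>, which has to equal
        \<open>2 \<alpha>\<close>; this fixes \<open>c\<close>.\<close>
      define \<rho> where "\<rho> = sqrt (\<alpha>\<^sup>2 + \<beta>\<^sup>2)"
      have rho: "\<rho> * \<rho> = \<alpha>\<^sup>2 + \<beta>\<^sup>2" "\<alpha> \<le> \<rho>"
        unfolding \<rho>_def by (auto simp: real_le_rsqrt)
      define c where "c = sqrt (2 * \<rho> - 2 * \<alpha>)"
      have c: "c * c = 2 * \<rho> - 2 * \<alpha>" unfolding c_def using rho by simp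
      show ?thesis
      \<comment> \<open>The quadratic has no real zero, so there is no exceptional point;
        \<open>-1\<close> is merely a value off the half-line.\<close>
      proof (rule reduce[OF quadratic(2), where a = "-1" and e = "[:\<rho>, c, 1:]"])
        show "poly q' s \<ge> 0" if "s \<ge> 0" for s
        proof -
          have "((s - \<alpha>)\<^sup>2 + \<beta>\<^sup>2) * poly q' s \<ge> 0"
            using nonneg[OF that] by (simp add: quadratic(2) power2_eq_square algebra_simps)
          moreover have "(s - \<alpha>)\<^sup>2 + \<beta>\<^sup>2 > 0" using quadratic(1) by (simp add: add_nonneg_pos)
          ultimately show ?thesis by (simp add: zero_le_mult_iff)
        qed
        show "poly [:\<alpha>\<^sup>2 + \<beta>\<^sup>2, - 2 * \<alpha>, 1:] (- x\<^sup>2) = poly [:\<rho>, c, 1:] x * poly [:\<rho>, c, 1:] (- x)" for x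
        proof -
          have "poly [:\<rho>, c, 1:] x * poly [:\<rho>, c, 1:] (- x) = \<rho> * \<rho> + (2 * \<rho> - c * c) * x\<^sup>2 + x\<^sup>2 * x\<^sup>2"
            by (simp add: algebra_simps power2_eq_square)
          then show ?thesis unfolding rho(1) c by (simp add: algebra_simps)
        qed
      qed auto
    qed
  qed
qed

section \<open>Kwong forms and the functionals they define\<close>

lemma Kwong_form_nonneg:
  fixes t x :: "nat \<Rightarrow> real"
  assumes "Kwong f" "inj_on t {..<n}" "\<And>i. i < n \<Longrightarrow> 0 < t i"
  shows "0 \<le> (\<Sum>i<n. \<Sum>j<n. x i * ((f (t i) + f (t j)) / (t i + t j)) * x j)"
proof -
  have "pos_semidef n (\<lambda>i j. (f (t i) + f (t j)) / (t i + t j))"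
    using assms unfolding Kwong_def by blast
  then show ?thesis unfolding pos_semidef_def by blast
qed

lemma KwongI:
  assumes "continuous_on {0<..} f"
    and "\<And>n (t :: nat \<Rightarrow> real) x. inj_on t {..<n} \<Longrightarrow> (\<And>i. i < n \<Longrightarrow> 0 < t i) \<Longrightarrow>
      0 \<le> (\<Sum>i<n. \<Sum>j<n. x i * ((f (t i) + f (t j)) / (t i + t j)) * x j)"
  shows "Kwong f"
  unfolding Kwong_def
proof (intro conjI allI impI assms(1))
  fix n and t :: "nat \<Rightarrow> real" assume "inj_on t {..<n} \<and> (\<forall>i<n. 0 < t i)"
  then show "pos_semidef n (\<lambda>i j. (f (t i) + f (t j)) / (t i + t j))"
    using assms(2)[of t n] unfolding pos_semidef_def by (simp add: add.commute)
qed

text \<open>Symmetry in \<open>i\<close> and \<open>j\<close> turns the quadratic form into a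
  functional linear in the values of \<open>f\<close>, so that forms of different functions can be
  mixed and dualized.\<close>

lemma Kwong_form_eq:
  fixes f :: "real \<Rightarrow> real" and t x :: "nat \<Rightarrow> real"
  shows "(\<Sum>i<n. \<Sum>j<n. x i * ((f (t i) + f (t j)) / (t i + t j)) * x j) =
    (\<Sum>i<n. 2 * x i * (\<Sum>j<n. x j / (t i + t j)) * f (t i))"
proof -
  have "(\<Sum>i<n. \<Sum>j<n. x i * ((f (t i) + f (t j)) / (t i + t j)) * x j) =
     (\<Sum>i<n. \<Sum>j<n. x i * (f (t i) / (t i + t j)) * x j) + (\<Sum>i<n. \<Sum>j<n. x i * (f (t j) / (t i + t j)) * x j)"
    by (simp add: sum.distrib[symmetric] add_divide_distrib algebra_simps)
  also have "(\<Sum>i<n. \<Sum>j<n. x i * (f (t j) / (t i + t j)) * x j) = (\<Sum>i<n. \<Sum>j<n. x i * (f (t i) / (t i + t j)) * x j)"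
    by (subst sum.swap) (simp add: mult_ac add_ac)
  finally show ?thesis
    by (simp add: sum_distrib_left sum_distrib_right sum.distrib[symmetric] mult_ac)
qed

text \<open>With \<open>q(- x\<^sup>2) = r(x) r(- x)\<close> for the numerator \<open>q\<close> of \<open>\<Sum>\<^sub>i y\<^sub>i t\<^sub>i / (t\<^sub>i\<^sup>2 + s)\<close>, the residues \<open>x\<^sub>i\<close> of
  \<open>r(x) / \<Prod>\<^sub>j (x - t\<^sub>j)\<close> satisfy \<open>y\<^sub>i = 2 x\<^sub>i \<Sum>\<^sub>j x\<^sub>j / (t\<^sub>i + t\<^sub>j)\<close>, so that the functional given by \<open>y\<close> is the
  Kwong form at \<open>x\<close>.\<close>

lemma Kwong_dual:
  fixes t y :: "nat \<Rightarrow> real"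
  assumes K: "Kwong g" and inj: "inj_on t {..<n}" and pos: "\<And>i. i < n \<Longrightarrow> 0 < t i"
    and y: "\<And>s. s \<ge> 0 \<Longrightarrow> 0 \<le> (\<Sum>i<n. y i * (t i / ((t i)\<^sup>2 + s)))"
  shows "0 \<le> (\<Sum>i<n. y i * g (t i))"
proof (cases "n = 0")
  case False
  define q where "q = (\<Sum>i<n. smult (y i * t i) (\<Prod>j\<in>{..<n}-{i}. [:(t j)\<^sup>2, 1:]))"
  have q: "poly q s = (\<Sum>i<n. y i * t i * (\<Prod>j\<in>{..<n}-{i}. (t j)\<^sup>2 + s))" for s
    unfolding q_def by (simp add: poly_sum poly_prod)
  have degq: "degree q \<le> n - 1"
    unfolding q_def
  proof (intro degree_sum_le)
    fix i assume "i \<in> {..<n}"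
    then have "(\<Sum>j\<in>{..<n}-{i}. degree [:(t j)\<^sup>2, 1:]) = n - 1" by simp
    moreover have "degree (\<Prod>j\<in>{..<n}-{i}. [:(t j)\<^sup>2, 1:]) \<le> (\<Sum>j\<in>{..<n}-{i}. degree [:(t j)\<^sup>2, 1:])"
      using degree_prod_sum_le[of "{..<n}-{i}" "\<lambda>j. [:(t j)\<^sup>2, 1:]"] by (simp add: o_def)
    ultimately show "degree (smult (y i * t i) (\<Prod>j\<in>{..<n}-{i}. [:(t j)\<^sup>2, 1:])) \<le> n - 1"
      by (intro order.trans[OF degree_smult_le]) simp
  qed simp
  have "poly q s \<ge> 0" if s: "s \<ge> 0" for s
  proof -
    have "poly q s = (\<Prod>j<n. (t j)\<^sup>2 + s) * (\<Sum>i<n. y i * (t i / ((t i)\<^sup>2 + s)))"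
      unfolding q sum_distrib_left
    proof (intro sum.cong refl)
      fix i assume i: "i \<in> {..<n}"
      have "(\<Prod>j<n. (t j)\<^sup>2 + s) = ((t i)\<^sup>2 + s) * (\<Prod>j\<in>{..<n}-{i}. (t j)\<^sup>2 + s)"
        using i by (intro prod.remove) auto
      moreover have "(t i)\<^sup>2 + s > 0" using pos[of i] i s by (simp add: add_pos_nonneg)
      ultimately show "y i * t i * (\<Prod>j\<in>{..<n}-{i}. (t j)\<^sup>2 + s) =
          (\<Prod>j<n. (t j)\<^sup>2 + s) * (y i * (t i / ((t i)\<^sup>2 + s)))"
        by (simp add: field_simps)
    qed
    moreover have "(\<Prod>j<n. (t j)\<^sup>2 + s) \<ge> 0" using s by (intro prod_nonneg) auto
    ultimately show ?thesis using y[OF s] by simp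
  qed
  then obtain r where r: "degree r \<le> degree q" "\<And>x. poly q (- x\<^sup>2) = poly r x * poly r (- x)"
    using spectral_factorization by blast
  define x where "x i = poly r (t i) / (\<Prod>j\<in>{..<n}-{i}. t i - t j)" for i
  have "2 * x i * (\<Sum>j<n. x j / (t i + t j)) = y i" if i: "i < n" for i
  proof -
    define D where "D = (\<Prod>j\<in>{..<n}-{i}. t i - t j)"
    define N where "N = (\<Prod>j\<in>{..<n}-{i}. - t i - t j)"
    have D: "D \<noteq> 0" unfolding D_def using inj i by (auto simp: inj_on_def)
    have N: "N \<noteq> 0" unfolding N_def using pos[OF i] pos by (fastforce simp: prod_zero_iff)
    \<comment> \<open>Evaluating the partial fractions at the reflected node \<open>- t i\<close>
      produces the Cauchy sum with denominators \<open>t i + t j\<close>.\<close>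
    have "(\<Sum>k<n. x k / (- t i - t k)) = (\<Sum>k<n. poly r (t k) / ((- t i - t k) * (\<Prod>l\<in>{..<n}-{k}. t k - t l)))"
      unfolding x_def by (simp add: mult.commute)
    also have "\<dots> = poly r (- t i) / (\<Prod>l<n. - t i - t l)"
    proof (rule lagrange_partial_fractions[OF _ inj])
      show "degree r < card {..<n}" using r(1) degq False by simp
      show "- t i \<noteq> t k" if "k \<in> {..<n}" for k using pos[OF i] pos[of k] that by auto
    qed simp
    also have "(\<Prod>l<n. - t i - t l) = - 2 * t i * N"
      unfolding N_def using i by (subst prod.remove[of _ i]) auto
    finally have s: "(\<Sum>k<n. x k / (- t i - t k)) = poly r (- t i) / (- 2 * t i * N)" .
    have "(\<Sum>j<n. x j / (t i + t j)) = - (\<Sum>k<n. x k / (- t i - t k))"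
      unfolding sum_negf[symmetric]
    proof (intro sum.cong refl)
      fix j
      have "- t i - t j = - (t i + t j)" by simp
      then show "x j / (t i + t j) = - (x j / (- t i - t j))" by (simp only: minus_divide_right minus_minus)
    qed
    then have s': "(\<Sum>j<n. x j / (t i + t j)) = poly r (- t i) / (2 * t i * N)" using s by simp
    \<comment> \<open>Every other summand of \<open>q\<close> contains the factor vanishing at
      \<open>- (t i)^2\<close>; in the surviving one each \<open>(t j)^2 - (t i)^2\<close> splits
      between \<open>D\<close> and \<open>N\<close>.\<close>
    have "poly q (- (t i)\<^sup>2) = (\<Sum>k<n. if k = i then y i * t i * (D * N) else 0)"
      unfolding q
    proof (intro sum.cong refl)
      fix k assume "k \<in> {..<n}"
      have "(\<Prod>j\<in>{..<n}-{k}. (t j)\<^sup>2 + - (t i)\<^sup>2) = 0" if "k \<noteq> i"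
        using that i by (intro prod_zero) auto
      moreover have "(\<Prod>j\<in>{..<n}-{i}. (t j)\<^sup>2 + - (t i)\<^sup>2) = D * N"
        unfolding D_def N_def prod.distrib[symmetric]
        by (intro prod.cong refl) (simp add: algebra_simps power2_eq_square)
      ultimately show "y k * t k * (\<Prod>j\<in>{..<n}-{k}. (t j)\<^sup>2 + - (t i)\<^sup>2) = (if k = i then y i * t i * (D * N) else 0)"
        by auto
    qed
    then have "poly r (t i) * poly r (- t i) = y i * t i * (D * N)" 
      using i r(2)[of "t i"] by (simp only: sum.delta finite_lessThan lessThan_iff if_True)
    moreover have "2 * x i * (\<Sum>j<n. x j / (t i + t j)) = poly r (t i) * poly r (- t i) / (D * N * t i)"
      unfolding s' x_def[of i] D_def[symmetric] by (simp only: times_divide_times_eq times_divide_eq_right times_divide_eq_left mult.assoc) (simp add: mult_ac)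
    ultimately show ?thesis using D N pos[OF i] by (simp only:) (simp add: field_simps)
  qed
  then have "(\<Sum>i<n. y i * g (t i)) = (\<Sum>i<n. 2 * x i * (\<Sum>j<n. x j / (t i + t j)) * g (t i))"
    by (intro sum.cong refl) (simp only: lessThan_iff)
  then show ?thesis
    using Kwong_form_nonneg[OF K inj pos, of x] unfolding Kwong_form_eq by (simp only:)
qed simp

section \<open>Schur products and powers\<close>

lemma quadratic_form_Suc:
  fixes C :: "nat \<Rightarrow> nat \<Rightarrow> real"
  assumes "\<And>i. i < n \<Longrightarrow> C n i = C i n"
  shows "(\<Sum>i<Suc n. \<Sum>j<Suc n. x i * C i j * x j) =
    (\<Sum>i<n. \<Sum>j<n. x i * C i j * x j) + 2 * x n * (\<Sum>i<n. x i * C i n) + C n n * (x n)\<^sup>2"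
proof -
  have "(\<Sum>j<n. x n * C n j * x j) = x n * (\<Sum>i<n. x i * C i n)"
    unfolding sum_distrib_left using assms by (intro sum.cong) auto
  moreover have "(\<Sum>i<n. x i * C i n * x n) = x n * (\<Sum>i<n. x i * C i n)"
    unfolding sum_distrib_left by (intro sum.cong) auto
  ultimately show ?thesis
    by (simp add: sum.distrib power2_eq_square algebra_simps)
qed

text \<open>Cholesky elimination of the last index: subtracting the rank-one part given by the last
  column leaves the Schur complement, which is again positive semidefinite.\<close>

lemma pos_semidef_gram:
  assumes "pos_semidef n C"
  shows "\<exists>u :: nat \<Rightarrow> nat \<Rightarrow> real. \<forall>i<n. \<forall>j<n. C i j = (\<Sum>l<n. u l i * u l j)"
  using assms
proof (induction n arbitrary: C)
  case (Suc n)
  have sym: "C i j = C j i" if "i < Suc n" "j < Suc n" for i j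
    using Suc.prems that unfolding pos_semidef_def by blast
  have form: "0 \<le> (\<Sum>i<n. \<Sum>j<n. x i * C i j * x j) + 2 * x n * (\<Sum>i<n. x i * C i n) + C n n * (x n)\<^sup>2" for x
  proof -
    have "0 \<le> (\<Sum>i<Suc n. \<Sum>j<Suc n. x i * C i j * x j)"
      using Suc.prems unfolding pos_semidef_def by blast
    then show ?thesis by (subst (asm) quadratic_form_Suc) (use sym in auto)
  qed
  have c: "C n n \<ge> 0" using form[of "\<lambda>i. if i = n then 1 else 0"] by simp
  have zero: "C i n = 0" if "C n n = 0" "i < n" for i
  proof (rule ccontr)
    assume nz: "C i n \<noteq> 0"
    \<comment> \<open>Makes the form equal to \<open>-1\<close> at the \<open>i\<close>-th unit
      vector plus \<tau> times the \<open>n\<close>-th.\<close>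
    define \<tau> where "\<tau> = - (C i i + 1) / (2 * C i n)"
    let ?x = "\<lambda>k. if k = i then 1 else if k = n then \<tau> else 0"
    have "(\<Sum>k<n. \<Sum>j<n. ?x k * C k j * ?x j) = (\<Sum>k<n. if k = i then (\<Sum>j<n. if j = i then C i i else 0) else 0)"
    proof (intro sum.cong refl)
      fix k assume k: "k \<in> {..<n}"
      have "?x k * C k j * ?x j = (if k = i then if j = i then C i i else 0 else 0)" if "j < n" for j
        using k that by auto
      then have "(\<Sum>j<n. ?x k * C k j * ?x j) = (\<Sum>j<n. if k = i then if j = i then C i i else 0 else 0)"
        by (intro sum.cong) auto
      then show "(\<Sum>j<n. ?x k * C k j * ?x j) = (if k = i then (\<Sum>j<n. if j = i then C i i else 0) else 0)"
        by auto
    qed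
    moreover have "(\<Sum>k<n. ?x k * C k n) = (\<Sum>k<n. if k = i then C i n else 0)"
      by (intro sum.cong) auto
    ultimately have "0 \<le> C i i + 2 * \<tau> * C i n"
      using form[of ?x] that by simp
    then show False unfolding \<tau>_def using nz by (simp add: field_simps)
  qed
  \<comment> \<open>For a zero pivot this division yields 0, as does \<open>- ?S / C n n\<close>
    below; by \<open>zero\<close> the last column then vanishes too, so both cases run
    together.\<close>
  define d where "d i = C i n / sqrt (C n n)" for i
  have d: "d i * d j = C i n * C j n / C n n" for i j
    unfolding d_def using c by simp
  have "pos_semidef n (\<lambda>i j. C i j - d i * d j)"
    unfolding pos_semidef_def
  proof (intro conjI allI impI)
    fix i j assume "i < n" "j < n"
    then show "C i j - d i * d j = C j i - d j * d i" using sym[of i j] by simp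
  next
    fix x
    let ?S = "\<Sum>i<n. x i * C i n"
    \<comment> \<open>The minimizer of the form in its last coordinate when the pivot is
      positive.\<close>
    let ?x = "x(n := - ?S / C n n)"
    have S2: "(\<Sum>i<n. \<Sum>j<n. x i * (d i * d j) * x j) = ?S\<^sup>2 / C n n"
      unfolding d power2_eq_square sum_product sum_divide_distrib
      by (intro sum.cong refl) simp
    have "0 \<le> (\<Sum>i<n. \<Sum>j<n. x i * C i j * x j) + 2 * (- ?S / C n n) * ?S + C n n * (- ?S / C n n)\<^sup>2"
      using form[of ?x] by (simp cong: sum.cong_simp)
    also have "\<dots> = (\<Sum>i<n. \<Sum>j<n. x i * C i j * x j) - ?S\<^sup>2 / C n n"
      by (simp add: power2_eq_square)
    finally show "0 \<le> (\<Sum>i<n. \<Sum>j<n. x i * (C i j - d i * d j) * x j)"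
      using S2 by (simp add: algebra_simps sum_subtractf)
  qed
  then obtain u where u: "\<And>i j. i < n \<Longrightarrow> j < n \<Longrightarrow> C i j - d i * d j = (\<Sum>l<n. u l i * u l j)"
    using Suc.IH by blast
  define v where "v l i = (if l = n then d i else if i = n then 0 else u l i)" for l i
  have "C i j = (\<Sum>l<Suc n. v l i * v l j)" if ij: "i < Suc n" "j < Suc n" for i j
  proof -
    have "(\<Sum>l<Suc n. v l i * v l j) = (\<Sum>l<n. v l i * v l j) + d i * d j"
      by (simp add: v_def)
    also have "(\<Sum>l<n. v l i * v l j) = (if i < n \<and> j < n then C i j - d i * d j else 0)"
      using u ij by (auto simp: v_def less_Suc_eq)
    also have "\<dots> + d i * d j = C i j"
      using ij sym[of i j] zero[of i] zero[of j] unfolding d by (auto simp: less_Suc_eq)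
    finally show ?thesis ..
  qed
  then show ?case by blast
qed simp

text \<open>A Gram decomposition of \<open>C\<close> writes the form as a sum of forms of
  \<open>N\<close> at rescaled vectors. The hypothesis on \<open>N\<close> concerns its form alone,
  so that it covers the nonsymmetric regularized Loewner matrices to which it is applied
  later.\<close>

lemma schur_product_form:
  fixes N C :: "nat \<Rightarrow> nat \<Rightarrow> real"
  assumes N: "\<And>x. 0 \<le> (\<Sum>i<n. \<Sum>j<n. x i * N i j * x j)" and C: "pos_semidef n C"
  shows "0 \<le> (\<Sum>i<n. \<Sum>j<n. x i * (N i j * C i j) * x j)"
proof -
  obtain u where u: "\<And>i j. i < n \<Longrightarrow> j < n \<Longrightarrow> C i j = (\<Sum>l<n. u l i * u l j)"
    using pos_semidef_gram[OF C] by blast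
  have "(\<Sum>i<n. \<Sum>j<n. x i * (N i j * C i j) * x j) =
      (\<Sum>i<n. \<Sum>j<n. \<Sum>l<n. (x i * u l i) * N i j * (x j * u l j))"
    using u by (intro sum.cong refl) (simp add: sum_distrib_left sum_distrib_right mult_ac)
  also have "\<dots> = (\<Sum>i<n. \<Sum>l<n. \<Sum>j<n. (x i * u l i) * N i j * (x j * u l j))"
    by (intro sum.cong refl sum.swap)
  also have "\<dots> = (\<Sum>l<n. \<Sum>i<n. \<Sum>j<n. (x i * u l i) * N i j * (x j * u l j))"
    by (rule sum.swap)
  also have "\<dots> \<ge> 0" by (intro sum_nonneg N)
  finally show ?thesis .
qed

text \<open>\<open>1 / (a + b)\<close> is the integral of \<open>exp (- a y) * exp (- b y)\<close>
  over \<open>y \<ge> 0\<close>, so the form is an integral of squares.\<close>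

lemma cauchy_form_nonneg:
  fixes t x :: "nat \<Rightarrow> real"
  assumes "\<And>i. i < n \<Longrightarrow> 0 < t i"
  shows "0 \<le> (\<Sum>i<n. \<Sum>j<n. x i * (1 / (t i + t j)) * x j)"
proof (rule has_integral_nonneg)
  have "((\<lambda>y. x i * exp (- (t i + t j) * y) * x j) has_integral x i * (1 / (t i + t j)) * x j) {0..}"
    if "i < n" "j < n" for i j
  proof -
    have "t i + t j > 0" using assms[OF that(1)] assms[OF that(2)] by simp
    then show ?thesis
      using has_integral_exp_minus_to_infinity[of "t i + t j" 0]
      by (intro has_integral_mult_left has_integral_mult_right) simp
  qed
  then show "((\<lambda>y. \<Sum>i<n. \<Sum>j<n. x i * exp (- (t i + t j) * y) * x j) has_integral
      (\<Sum>i<n. \<Sum>j<n. x i * (1 / (t i + t j)) * x j)) {0..}"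
    by (intro has_integral_sum) auto
  fix y :: real
  have "(\<Sum>i<n. \<Sum>j<n. x i * exp (- (t i + t j) * y) * x j) = (\<Sum>i<n. x i * exp (- t i * y))\<^sup>2"
    unfolding power2_eq_square sum_product
    by (intro sum.cong refl) (simp add: exp_add[symmetric] algebra_simps)
  then show "0 \<le> (\<Sum>i<n. \<Sum>j<n. x i * exp (- (t i + t j) * y) * x j)" by simp
qed

lemma cauchy_pos_semidef:
  fixes t :: "nat \<Rightarrow> real"
  assumes "\<And>i. i < n \<Longrightarrow> 0 < t i"
  shows "pos_semidef n (\<lambda>i j. 1 / (t i + t j))"
  using cauchy_form_nonneg[OF assms] unfolding pos_semidef_def by (simp add: add.commute)

lemma Kwong_const:
  assumes "c \<ge> 0"
  shows "Kwong (\<lambda>_. c)"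
proof (rule KwongI)
  fix n and t :: "nat \<Rightarrow> real" and x assume "\<And>i. i < n \<Longrightarrow> 0 < t i"
  then have "0 \<le> 2 * c * (\<Sum>i<n. \<Sum>j<n. x i * (1 / (t i + t j)) * x j)"
    using assms by (intro mult_nonneg_nonneg cauchy_form_nonneg) auto
  then show "0 \<le> (\<Sum>i<n. \<Sum>j<n. x i * ((c + c) / (t i + t j)) * x j)"
    by (simp add: sum_distrib_left mult_ac)
qed simp

text \<open>A congruence with the diagonal matrix of the values \<open>1 / k (t i)\<close>.\<close>

lemma Kwong_inverse:
  assumes K: "Kwong k" and pos: "\<And>t. t > 0 \<Longrightarrow> k t > 0"
  shows "Kwong (\<lambda>t. 1 / k t)"
proof (rule KwongI)
  show "continuous_on {0<..} (\<lambda>t. 1 / k t)"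
    using K pos unfolding Kwong_def by (intro continuous_intros) (auto simp: less_le)
  fix n and t :: "nat \<Rightarrow> real" and x assume t: "inj_on t {..<n}" "\<And>i. i < n \<Longrightarrow> 0 < t i"
  have "(\<Sum>i<n. \<Sum>j<n. x i * ((1 / k (t i) + 1 / k (t j)) / (t i + t j)) * x j) =
     (\<Sum>i<n. \<Sum>j<n. (x i / k (t i)) * ((k (t i) + k (t j)) / (t i + t j)) * (x j / k (t j)))"
  proof (intro sum.cong refl)
    fix i j assume "i \<in> {..<n}" "j \<in> {..<n}"
    then have "k (t i) > 0" "k (t j) > 0" using pos t by auto
    then show "x i * ((1 / k (t i) + 1 / k (t j)) / (t i + t j)) * x j =
        (x i / k (t i)) * ((k (t i) + k (t j)) / (t i + t j)) * (x j / k (t j))"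
      by (simp add: field_simps)
  qed
  then show "0 \<le> (\<Sum>i<n. \<Sum>j<n. x i * ((1 / k (t i) + 1 / k (t j)) / (t i + t j)) * x j)"
    using Kwong_form_nonneg[OF K t, of "\<lambda>i. x i / k (t i)"] by (simp only:)
qed

text \<open>Up to diagonal congruences the matrix is the Kwong matrix of \<open>k\<close> plus
  \<open>s\<close> times a rank-one square. Constant \<open>k\<close> gives the functions of which
  powers are mixtures; \<open>k t = t powr (2 * q - 1)\<close> gives the test functions in
  \<open>Kwong_powr_times_compose\<close>.\<close>

lemma Kwong_resolvent:
  assumes K: "Kwong k" and pos: "\<And>t. t > 0 \<Longrightarrow> k t > 0" and s: "s \<ge> 0"
  shows "Kwong (\<lambda>t. t / (t * k t + s))"
proof (rule KwongI)
  have nz: "t * k t + s > 0" if "t > 0" for t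
    using pos that s by (simp add: add_pos_nonneg)
  then show "continuous_on {0<..} (\<lambda>t. t / (t * k t + s))"
    using K unfolding Kwong_def by (intro continuous_intros) (auto simp: less_le)
  fix n and t :: "nat \<Rightarrow> real" and x assume t: "inj_on t {..<n}" "\<And>i. i < n \<Longrightarrow> 0 < t i"
  define w where "w i = 1 / (t i * k (t i) + s)" for i
  have "(\<Sum>i<n. \<Sum>j<n. x i * ((t i / (t i * k (t i) + s) + t j / (t j * k (t j) + s)) / (t i + t j)) * x j) =
     (\<Sum>i<n. \<Sum>j<n. (x i * w i * t i) * ((k (t i) + k (t j)) / (t i + t j)) * (x j * w j * t j)) +
     (\<Sum>i<n. \<Sum>j<n. s * ((x i * w i) * (x j * w j)))"
    unfolding sum.distrib[symmetric]
  proof (intro sum.cong refl)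
    fix i j assume "i \<in> {..<n}" "j \<in> {..<n}"
    then have p: "0 < t i" "0 < t j" "t i * k (t i) + s > 0" "t j * k (t j) + s > 0" using nz t by auto
    define A B where "A = t i * k (t i) + s" and "B = t j * k (t j) + s"
    have AB: "A > 0" "B > 0" "t i + t j > 0" using p by (auto simp: A_def B_def)
    have "(t i / A + t j / B) / (t i + t j) = ((t i * B + t j * A) / (t i + t j)) / (A * B)"
      using AB by (simp add: field_simps)
    also have "t i * B + t j * A = t i * t j * (k (t i) + k (t j)) + s * (t i + t j)"
      by (simp add: A_def B_def algebra_simps)
    also have "\<dots> / (t i + t j) = t i * t j * ((k (t i) + k (t j)) / (t i + t j)) + s"
      using AB by (simp add: field_simps)
    finally have eq: "(t i / A + t j / B) / (t i + t j) = (t i * t j * ((k (t i) + k (t j)) / (t i + t j)) + s) / (A * B)" .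
    show "x i * ((t i / (t i * k (t i) + s) + t j / (t j * k (t j) + s)) / (t i + t j)) * x j =
      (x i * w i * t i) * ((k (t i) + k (t j)) / (t i + t j)) * (x j * w j * t j) + s * ((x i * w i) * (x j * w j))"
      unfolding w_def A_def[symmetric] B_def[symmetric] eq
      by (simp add: add_divide_distrib algebra_simps)
  qed
  also have "(\<Sum>i<n. \<Sum>j<n. s * ((x i * w i) * (x j * w j))) = s * (\<Sum>i<n. x i * w i)\<^sup>2"
    by (simp only: power2_eq_square sum_product) (simp only: sum_distrib_left)
  also have "(\<Sum>i<n. \<Sum>j<n. (x i * w i * t i) * ((k (t i) + k (t j)) / (t i + t j)) * (x j * w j * t j)) +
      s * (\<Sum>i<n. x i * w i)\<^sup>2 \<ge> 0"
    using s by (intro add_nonneg_nonneg mult_nonneg_nonneg Kwong_form_nonneg[OF K t]) auto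
  finally show "0 \<le> (\<Sum>i<n. \<Sum>j<n. x i * ((t i / (t i * k (t i) + s) + t j / (t j * k (t j) + s)) / (t i + t j)) * x j)" .
qed

lemma Kwong_functional_nonneg:
  fixes t x :: "nat \<Rightarrow> real"
  assumes "Kwong f" "inj_on t {..<n}" "\<And>i. i < n \<Longrightarrow> 0 < t i"
  shows "0 \<le> (\<Sum>i<n. 2 * x i * (\<Sum>j<n. x j / (t i + t j)) * f (t i))"
  using Kwong_form_nonneg[OF assms] unfolding Kwong_form_eq .

section \<open>Powers as mixtures of resolvent functions\<close>

text \<open>Dominated by \<open>exp (- (1 - p) * y)\<close> on the right half-line and by
  \<open>exp (p * y)\<close> on the left, the latter entering as a reflection of
  \<open>e p\<close>.\<close>

lemma integrable_exp_quotient: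
  fixes p :: real
  assumes p: "0 < p" "p < 1"
  shows "integrable lborel (\<lambda>y. exp (p * y) / (1 + exp y))"
proof -
  have ex: "set_integrable lborel {0..} (\<lambda>y. exp (- c * y))" if "c > 0" for c :: real
  proof -
    have "(\<lambda>y. exp (- c * y)) absolutely_integrable_on {0..}"
      using has_integral_exp_minus_to_infinity[OF that, of 0]
      by (intro nonnegative_absolutely_integrable_1) (auto simp: integrable_on_def)
    then show ?thesis
      unfolding set_integrable_def by (subst (asm) integrable_completion) auto
  qed
  define e where "e c y = indicat_real {0..} y *\<^sub>R exp (- c * y)" for c y :: real
  have e: "integrable lborel (e c)" if "c > 0" for c
    using ex[OF that] unfolding set_integrable_def e_def .
  have "integrable lborel (\<lambda>y. e (1 - p) y + e p (0 + (- 1) * y))"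
    using p by (intro Bochner_Integration.integrable_add e lborel_integrable_real_affine) auto
  then show ?thesis
  proof (rule Bochner_Integration.integrable_bound)
    have "norm (exp (p * y) / (1 + exp y)) \<le> norm (e (1 - p) y + e p (0 + (- 1) * y))" for y
    proof (cases "y \<ge> 0")
      case True
      have "exp (p * y) / (1 + exp y) \<le> exp (p * y) / exp y"
        by (intro divide_left_mono) (auto simp: add_pos_pos)
      also have "\<dots> = exp (- (1 - p) * y)" by (simp add: exp_diff[symmetric] algebra_simps)
      finally show ?thesis using True by (simp add: e_def indicator_def)
    next
      case False
      have "exp (p * y) / (1 + exp y) \<le> exp (p * y)"
        by (simp add: divide_le_eq add_pos_pos)
      then show ?thesis using False by (simp add: e_def indicator_def)
    qed
    then show "AE y in lborel. norm (exp (p * y) / (1 + exp y)) \<le> norm (e (1 - p) y + e p (0 + (- 1) * y))"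
      by simp
  qed measurable
qed

text \<open>The classical formula for \<open>a^p\<close> as an integral of
  \<open>\<lambda>^(p - 1) * a / (a + \<lambda>)\<close> over \<lambda> > 0, with
  \<open>\<lambda> = exp y\<close>.\<close>

lemma powr_integral_representation:
  fixes p :: real
  assumes p: "0 < p" "p < 1"
  obtains c where "c > 0"
    and "\<And>a. a > 0 \<Longrightarrow> has_bochner_integral lborel (\<lambda>y. exp (p * y) * (a / (a + exp y))) (c * a powr p)"
proof -
  define \<phi> where "\<phi> y = exp (p * y) / (1 + exp y)" for y :: real
  have int: "integrable lborel \<phi>" unfolding \<phi>_def by (rule integrable_exp_quotient[OF p])
  have pos: "\<phi> y > 0" for y unfolding \<phi>_def by (simp add: add_pos_pos)
  have "integral\<^sup>L lborel \<phi> \<noteq> 0"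
  proof
    assume "integral\<^sup>L lborel \<phi> = 0"
    then have "AE y in lborel. \<phi> y = 0"
      using integral_nonneg_eq_0_iff_AE[OF int] pos by (auto simp: less_imp_le)
    moreover have "\<phi> y \<noteq> 0" for y using pos[of y] by simp
    ultimately show False by (simp add: AE_iff_null null_sets_def)
  qed
  moreover have "integral\<^sup>L lborel \<phi> \<ge> 0"
    using pos by (intro integral_nonneg_AE) (auto simp: less_imp_le)
  ultimately have ipos: "integral\<^sup>L lborel \<phi> > 0" by linarith
  have "has_bochner_integral lborel (\<lambda>y. exp (p * y) * (a / (a + exp y))) (integral\<^sup>L lborel \<phi> * a powr p)"
    if a: "a > 0" for a
  proof -
    \<comment> \<open>In the logarithmic variable, scaling by \<open>a\<close> is translation by
      \<open>ln a\<close>, under which Lebesgue measure is invariant.\<close>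
    have "has_bochner_integral lborel (\<lambda>x. a powr p * \<phi> x) (a powr p * integral\<^sup>L lborel \<phi>)"
      using int by (intro has_bochner_integral_mult_right) (auto simp: has_bochner_integral_iff)
    also have "(\<lambda>x. a powr p * \<phi> x) = (\<lambda>x. exp (p * (ln a + 1 * x)) * (a / (a + exp (ln a + 1 * x))))"
    proof
      fix x
      have "a + exp (ln a + 1 * x) = a * (1 + exp x)"
        using a by (simp add: exp_add algebra_simps)
      then have "a / (a + exp (ln a + 1 * x)) = 1 / (1 + exp x)" using a by simp
      then show "a powr p * \<phi> x = exp (p * (ln a + 1 * x)) * (a / (a + exp (ln a + 1 * x)))"
        using a unfolding \<phi>_def by (simp add: powr_def exp_add[symmetric] algebra_simps)
    qed
    finally show ?thesis
      by (subst lborel_has_bochner_integral_real_affine_iff[of 1 _ _ "ln a"]) (simp_all add: mult.commute)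
  qed
  with ipos show ?thesis by (rule that)
qed

text \<open>Exponents strictly between 0 and 1 are positive mixtures of the Kwong functions
  \<open>t / (t + exp y)\<close>; negative exponents are reciprocals.\<close>

lemma Kwong_powr:
  assumes r: "\<bar>r\<bar> \<le> 1"
  shows "Kwong (\<lambda>t. t powr r)"
proof -
  have nonneg: "Kwong (\<lambda>t. t powr p)" if p: "0 \<le> p" "p \<le> 1" for p
  proof (rule KwongI)
    show "continuous_on {0<..} (\<lambda>t. t powr p)" by (intro continuous_intros) auto
    fix n and t :: "nat \<Rightarrow> real" and x assume t: "inj_on t {..<n}" "\<And>i. i < n \<Longrightarrow> 0 < t i"
    consider "p = 0" | "p = 1" | "0 < p" "p < 1" using p by linarith
    then show "0 \<le> (\<Sum>i<n. \<Sum>j<n. x i * ((t i powr p + t j powr p) / (t i + t j)) * x j)"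
    proof cases
      case 1
      have "(\<Sum>i<n. \<Sum>j<n. x i * ((t i powr p + t j powr p) / (t i + t j)) * x j) =
          (\<Sum>i<n. \<Sum>j<n. x i * ((1 + 1) / (t i + t j)) * x j)"
        using t(2) 1 by (intro sum.cong refl) (auto simp: less_le)
      then show ?thesis using Kwong_form_nonneg[OF Kwong_const[of 1] t, of x] by simp
    next
      case 2
      have "(\<Sum>i<n. \<Sum>j<n. x i * ((t i powr p + t j powr p) / (t i + t j)) * x j) = (\<Sum>i<n. \<Sum>j<n. x i * x j)"
      proof (intro sum.cong refl)
        fix i j assume "i \<in> {..<n}" "j \<in> {..<n}"
        then have "0 < t i" "0 < t j" using t by auto
        then have "(t i powr p + t j powr p) / (t i + t j) = 1" using 2 by simp
        then show "x i * ((t i powr p + t j powr p) / (t i + t j)) * x j = x i * x j" by simp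
      qed
      also have "\<dots> = (\<Sum>i<n. x i)\<^sup>2" by (simp add: power2_eq_square sum_product)
      finally show ?thesis by simp
    next
      case 3
      obtain c where c: "c > 0"
        and rep: "\<And>a. a > 0 \<Longrightarrow> has_bochner_integral lborel (\<lambda>y. exp (p * y) * (a / (a + exp y))) (c * a powr p)"
        using powr_integral_representation[OF 3] by blast
      define w where "w i = 2 * x i * (\<Sum>j<n. x j / (t i + t j))" for i
      have "has_bochner_integral lborel (\<lambda>y. \<Sum>i<n. w i * (exp (p * y) * (t i / (t i + exp y)))) (\<Sum>i<n. w i * (c * t i powr p))"
        using t by (intro has_bochner_integral_sum has_bochner_integral_mult_right rep) auto
      moreover have "(\<Sum>i<n. w i * (exp (p * y) * (t i / (t i + exp y)))) \<ge> 0" for y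
      proof -
        have "Kwong (\<lambda>t. t / (t * 1 + exp y))" by (intro Kwong_resolvent Kwong_const) auto
        from Kwong_functional_nonneg[OF this t, of x]
        have "0 \<le> exp (p * y) * (\<Sum>i<n. w i * (t i / (t i + exp y)))"
          unfolding w_def by simp
        then show ?thesis by (simp add: sum_distrib_left mult_ac)
      qed
      ultimately have "0 \<le> (\<Sum>i<n. w i * (c * t i powr p))"
        by (metis (no_types, lifting) has_bochner_integral_integral_eq Bochner_Integration.integral_nonneg)
      also have "\<dots> = c * (\<Sum>i<n. w i * t i powr p)" by (simp add: sum_distrib_left mult_ac)
      finally have "0 \<le> (\<Sum>i<n. w i * t i powr p)" using c by (simp add: zero_le_mult_iff)
      then show ?thesis unfolding Kwong_form_eq[where f = "\<lambda>t. t powr p"] w_def .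
    qed
  qed
  show ?thesis
  proof (cases "r \<ge> 0")
    case False
    have "Kwong (\<lambda>t. 1 / t powr (- r))" using r False by (intro Kwong_inverse nonneg) auto
    then show ?thesis by (simp add: powr_minus divide_inverse)
  qed (use nonneg r in auto)
qed

section \<open>Composition with powers\<close>

lemma Kwong_nonneg:
  assumes "Kwong g" "t > 0"
  shows "g t \<ge> 0"
  using Kwong_form_nonneg[OF assms(1), of "\<lambda>_. t" 1 "\<lambda>_. 1"] assms(2)
  by (simp add: zero_le_divide_iff inj_on_def)

lemma continuous_on_compose_powr:
  fixes g :: "real \<Rightarrow> real"
  assumes "continuous_on {0<..} g"
  shows "continuous_on {0<..} (\<lambda>t. g (t powr p))"
  by (rule continuous_on_compose2[OF assms]) (auto intro!: continuous_intros)

lemma inj_on_powr_comp: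
  fixes t :: "nat \<Rightarrow> real"
  assumes "inj_on t {..<n}" "\<And>i. i < n \<Longrightarrow> 0 < t i" "p \<noteq> 0"
  shows "inj_on (\<lambda>i. t i powr p) {..<n}"
proof (rule inj_onI)
  fix i j assume ij: "i \<in> {..<n}" "j \<in> {..<n}" "t i powr p = t j powr p"
  then have "(t i powr p) powr (1 / p) = (t j powr p) powr (1 / p)" by simp
  then have "t i = t j"
    using assms(2)[of i] assms(2)[of j] assms(3) ij(1,2) unfolding powr_powr by simp
  then show "i = j" using assms(1) ij by (auto simp: inj_on_def)
qed

text \<open>The matrix is the Schur product of the Kwong matrix of \<open>g\<close> at the nodes
  \<open>t i powr p\<close> with that of \<open>t powr p\<close> at the nodes \<open>t i\<close>.
  For \<open>p = 0\<close> the nodes collapse, and the constant \<open>g 1\<close> is treated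
  directly.\<close>

lemma Kwong_compose_powr:
  assumes K: "Kwong g" and p: "\<bar>p\<bar> \<le> 1"
  shows "Kwong (\<lambda>t. g (t powr p))"
proof (rule KwongI)
  show "continuous_on {0<..} (\<lambda>t. g (t powr p))"
    using K unfolding Kwong_def by (intro continuous_on_compose_powr) auto
  fix n and t :: "nat \<Rightarrow> real" and x assume t: "inj_on t {..<n}" "\<And>i. i < n \<Longrightarrow> 0 < t i"
  show "0 \<le> (\<Sum>i<n. \<Sum>j<n. x i * ((g (t i powr p) + g (t j powr p)) / (t i + t j)) * x j)"
  proof (cases "p = 0")
    case True
    have "(\<Sum>i<n. \<Sum>j<n. x i * ((g (t i powr p) + g (t j powr p)) / (t i + t j)) * x j) =
        (\<Sum>i<n. \<Sum>j<n. x i * ((g 1 + g 1) / (t i + t j)) * x j)"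
      using t(2) True by (intro sum.cong refl) (auto simp: less_le)
    then show ?thesis
      using Kwong_form_nonneg[OF Kwong_const[OF Kwong_nonneg[OF K, of 1]] t, of x] by simp
  next
    case False
    let ?a = "\<lambda>i. t i powr p"
    have pos: "0 < ?a i" if "i < n" for i using t(2)[OF that] by simp
    have "pos_semidef n (\<lambda>i j. (t i powr p + t j powr p) / (t i + t j))"
      using Kwong_powr[OF p] t unfolding Kwong_def by blast
    from schur_product_form[OF Kwong_form_nonneg[OF K inj_on_powr_comp[OF t False] pos] this, of x]
    have "0 \<le> (\<Sum>i<n. \<Sum>j<n. x i * ((g (?a i) + g (?a j)) / (?a i + ?a j) * ((?a i + ?a j) / (t i + t j))) * x j)"
      by simp
    also have "\<dots> = (\<Sum>i<n. \<Sum>j<n. x i * ((g (?a i) + g (?a j)) / (t i + t j)) * x j)"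
    proof (intro sum.cong refl)
      fix i j assume "i \<in> {..<n}" "j \<in> {..<n}"
      then have "?a i + ?a j > 0" using pos[of i] pos[of j] by (intro add_pos_pos) auto
      then have "?a i + ?a j \<noteq> 0" by linarith
      then show "x i * ((g (?a i) + g (?a j)) / (?a i + ?a j) * ((?a i + ?a j) / (t i + t j))) * x j =
        x i * ((g (?a i) + g (?a j)) / (t i + t j)) * x j"
        by (simp only: times_divide_times_eq) (simp add: mult.commute)
    qed
    finally show ?thesis .
  qed
qed

text \<open>By duality only test functions have to be pulled back along \<open>u = t powr q\<close>:
  \<open>t powr (1 - q)\<close> times \<open>u / (u^2 + s)\<close> is
  \<open>t / (t * t powr (2 * q - 1) + s)\<close>, which is Kwong because \<open>2 * q - 1\<close>
  lies in \<open>[-1, 1]\<close>. For \<open>q = 0\<close> the nodes collapse again.\<close>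

lemma Kwong_powr_times_compose:
  assumes K: "Kwong g" and q: "0 \<le> q" "q \<le> 1"
  shows "Kwong (\<lambda>t. t powr (1 - q) * g (t powr q))"
proof (rule KwongI)
  show "continuous_on {0<..} (\<lambda>t. t powr (1 - q) * g (t powr q))"
    using K unfolding Kwong_def by (intro continuous_on_mult continuous_on_compose_powr continuous_intros) auto
  fix n and t :: "nat \<Rightarrow> real" and x assume t: "inj_on t {..<n}" "\<And>i. i < n \<Longrightarrow> 0 < t i"
  define w where "w i = 2 * x i * (\<Sum>j<n. x j / (t i + t j))" for i
  have "0 \<le> (\<Sum>i<n. w i * (t i powr (1 - q) * g (t i powr q)))"
  proof (cases "q = 0")
    case True
    have "0 \<le> g 1 * (\<Sum>i<n. w i * t i powr 1)"
      using Kwong_nonneg[OF K, of 1] Kwong_functional_nonneg[OF Kwong_powr[of 1] t, of x]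
      unfolding w_def by (intro mult_nonneg_nonneg) auto
    also have "\<dots> = (\<Sum>i<n. w i * (t i powr (1 - q) * g (t i powr q)))"
      unfolding sum_distrib_left using True t(2) by (intro sum.cong refl) (auto simp: less_le)
    finally show ?thesis .
  next
    case False
    have "0 \<le> (\<Sum>i<n. (w i * t i powr (1 - q)) * g (t i powr q))"
    proof (rule Kwong_dual[OF K inj_on_powr_comp[OF t False]])
      show "0 < t i powr q" if "i < n" for i using t(2)[OF that] by simp
      fix s :: real assume s: "s \<ge> 0"
      have "Kwong (\<lambda>t. t / (t * t powr (2 * q - 1) + s))"
        using s q by (intro Kwong_resolvent Kwong_powr) auto
      from Kwong_functional_nonneg[OF this t, of x]
      have "0 \<le> (\<Sum>i<n. w i * (t i / (t i * t i powr (2 * q - 1) + s)))"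
        unfolding w_def .
      also have "\<dots> = (\<Sum>i<n. w i * t i powr (1 - q) * (t i powr q / ((t i powr q)\<^sup>2 + s)))"
      proof (intro sum.cong refl)
        fix i assume "i \<in> {..<n}"
        then have ti: "t i > 0" using t by auto
        have "t i powr 1 * t i powr (2 * q - 1) = (t i powr q)\<^sup>2"
          unfolding power2_eq_square powr_add[symmetric] by simp
        moreover have "t i powr (1 - q) * t i powr q = t i"
          using ti unfolding powr_add[symmetric] by simp
        ultimately show "w i * (t i / (t i * t i powr (2 * q - 1) + s)) =
            w i * t i powr (1 - q) * (t i powr q / ((t i powr q)\<^sup>2 + s))"
          using ti by simp
      qed
      finally show "0 \<le> (\<Sum>i<n. w i * t i powr (1 - q) * (t i powr q / ((t i powr q)\<^sup>2 + s)))" .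
    qed
    then show ?thesis by (simp add: mult_ac)
  qed
  then show "0 \<le> (\<Sum>i<n. \<Sum>j<n. x i * ((t i powr (1 - q) * g (t i powr q) + t j powr (1 - q) * g (t j powr q)) / (t i + t j)) * x j)"
    unfolding Kwong_form_eq[where f = "\<lambda>t. t powr (1 - q) * g (t powr q)"] w_def .
qed

section \<open>Functional calculus\<close>

instance complex_hilbert \<subseteq> banach ..

lemma cinner_add_right: "cinner x (y + z) = cinner x y + cinner x (z :: 'a::complex_inner)"
  by (metis cinner_add_left cinner_commute complex_cnj_add)

lemma cinner_scaleC_right: "cinner x (c *\<^sub>C y) = cnj c * cinner x (y :: 'a::complex_inner)"
  by (metis cinner_scaleC_left cinner_commute complex_cnj_mult)

lemma cinner_scaleR_left: "cinner (r *\<^sub>R x) y = of_real r * cinner x (y :: 'a::complex_inner)"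
  by (metis cinner_scaleC_left scaleC_of_real)

lemma cinner_scaleR_right: "cinner x (r *\<^sub>R y) = of_real r * cinner x (y :: 'a::complex_inner)"
  by (metis cinner_scaleC_right scaleC_of_real complex_cnj_complex_of_real)

lemma scaleC_scaleR_commute: "c *\<^sub>C r *\<^sub>R x = r *\<^sub>R c *\<^sub>C (x :: 'a::complex_inner)"
  by (metis scaleC_of_real scaleC_scaleC mult.commute)

lemma cinner_self: "cinner x x = of_real ((norm (x :: 'a::complex_inner))\<^sup>2)"
proof -
  have "Im (cinner x x) = 0" using arg_cong[OF cinner_commute[of x x], of Im] by simp
  then show ?thesis by (simp add: complex_eq_iff power2_norm_eq_inner inner_eq_Re_cinner)
qed

definition selfadjoint_on :: "('h::complex_hilbert \<Rightarrow>\<^sub>L 'h) \<Rightarrow> ('h \<Rightarrow>\<^sub>L 'h) \<Rightarrow> bool" where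
  "selfadjoint_on E A \<longleftrightarrow> orth_projection E \<and> operator_on E A \<and> selfadjoint A"

lemma selfadjoint_inner: "selfadjoint A \<Longrightarrow> inner (A x) y = inner x (A y)"
  by (simp add: selfadjoint_def inner_eq_Re_cinner)

lemma orth_projection_idem: "orth_projection E \<Longrightarrow> E (E x) = E x"
  unfolding orth_projection_def by (metis blinfun_apply_blinfun_compose)

lemma orth_projection_inner: "orth_projection E \<Longrightarrow> inner (E x) y = inner x (E y)"
  unfolding orth_projection_def by (auto intro: selfadjoint_inner)

lemma operator_on_absorb:
  assumes "orth_projection E" "operator_on E A"
  shows "E (A x) = A x" "A (E x) = A x"
  using assms unfolding operator_on_def
  by (metis blinfun_apply_blinfun_compose orth_projection_idem)+

lemma selfadjoint_onD:
  assumes "selfadjoint_on E A"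
  shows "orth_projection E" "E (E x) = E x" "inner (E x) y = inner x (E y)"
    "E (A x) = A x" "A (E x) = A x" "inner (A x) y = inner x (A y)" "cinner (A x) y = cinner x (A y)"
    "A (c *\<^sub>C x) = c *\<^sub>C A x" "E (c *\<^sub>C x) = c *\<^sub>C E x" "operator_on E A" "cinner (E x) y = cinner x (E y)"
proof -
  have *: "orth_projection E" "operator_on E A" "selfadjoint A"
    using assms by (simp_all add: selfadjoint_on_def)
  then have "selfadjoint E" by (simp add: orth_projection_def)
  then show "E (c *\<^sub>C x) = c *\<^sub>C E x" "cinner (E x) y = cinner x (E y)" "inner (E x) y = inner x (E y)"
    by (auto simp: selfadjoint_def clinear_op_def inner_eq_Re_cinner)
  show "A (c *\<^sub>C x) = c *\<^sub>C A x" "cinner (A x) y = cinner x (A y)" "inner (A x) y = inner x (A y)"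
    using *(3) by (auto simp: selfadjoint_def clinear_op_def inner_eq_Re_cinner)
  show "orth_projection E" "operator_on E A" by fact+
  show "E (E x) = E x" "E (A x) = A x" "A (E x) = A x"
    using * by (simp_all add: orth_projection_idem operator_on_absorb)
qed

lemma op_poly_on_0 [simp]: "op_poly_on E 0 A = 0"
  by (simp add: op_poly_on_def)

lemma op_poly_on_pCons:
  "op_poly_on E (pCons a p) A x = a *\<^sub>R E x + A (op_poly_on E p A x)"
proof (cases "p = 0")
  case False
  have "op_poly_on E (pCons a p) A x = (\<Sum>i\<le>Suc (degree p). coeff (pCons a p) i *\<^sub>R (((o\<^sub>L) A ^^ i) E) x)"
    unfolding op_poly_on_def using False by (simp add: blinfun.sum_left blinfun.scaleR_left blinfun.add_left)
  also have "\<dots> = a *\<^sub>R E x + (\<Sum>i\<le>degree p. coeff p i *\<^sub>R A ((((o\<^sub>L) A ^^ i) E) x))"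
    by (subst sum.atMost_Suc_shift) simp
  also have "(\<Sum>i\<le>degree p. coeff p i *\<^sub>R A ((((o\<^sub>L) A ^^ i) E) x)) = A (op_poly_on E p A x)"
    unfolding op_poly_on_def by (simp add: blinfun.sum_left blinfun.scaleR_left blinfun.sum_right blinfun.scaleR_right)
  finally show ?thesis .
qed (simp add: op_poly_on_def blinfun.scaleR_left)

lemma op_poly_on_add: "op_poly_on E (p + q) A x = op_poly_on E p A x + op_poly_on E q A x"
proof (induction p arbitrary: q)
  case (pCons a p)
  then show ?case
    by (cases q) (simp add: op_poly_on_pCons blinfun.add_right scaleR_add_left)
qed simp

lemma op_poly_on_smult: "op_poly_on E (smult c p) A x = c *\<^sub>R op_poly_on E p A x"
  by (induction p) (simp_all add: op_poly_on_pCons blinfun.scaleR_right scaleR_add_right)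

lemma op_poly_on_diff: "op_poly_on E (p - q) A x = op_poly_on E p A x - op_poly_on E q A x"
  using op_poly_on_add[of E p "smult (- 1) q" A x] op_poly_on_smult[of E "- 1" q A x] by simp

lemma op_poly_on_sum: "op_poly_on E (\<Sum>i\<in>I. p i) A x = (\<Sum>i\<in>I. op_poly_on E (p i) A x)"
  by (induction I rule: infinite_finite_induct) (simp_all add: op_poly_on_add)

lemma op_poly_on_const: "op_poly_on E [:c:] A x = c *\<^sub>R E x"
  by (simp add: op_poly_on_pCons)

context
  fixes E A :: "'h::complex_hilbert \<Rightarrow>\<^sub>L 'h"
  assumes EA: "selfadjoint_on E A"
begin

lemma op_poly_on_absorb:
  "E (op_poly_on E p A x) = op_poly_on E p A x" "op_poly_on E p A (E x) = op_poly_on E p A x"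
  by (induction p arbitrary: x) (simp_all add: op_poly_on_pCons blinfun.add_right blinfun.scaleR_right selfadjoint_onD[OF EA])

lemma op_poly_on_mult: "op_poly_on E (p * q) A x = op_poly_on E p A (op_poly_on E q A x)"
  by (induction p arbitrary: x)
     (simp_all add: op_poly_on_pCons op_poly_on_add op_poly_on_smult op_poly_on_absorb)

lemma op_poly_on_X: "op_poly_on E [:a, 1:] A x = A x + a *\<^sub>R E x"
  by (simp add: op_poly_on_pCons selfadjoint_onD[OF EA])

lemma op_poly_on_commute: "op_poly_on E p A (A x) = A (op_poly_on E p A x)"
proof -
  have "op_poly_on E (p * [:0, 1:]) A x = op_poly_on E ([:0, 1:] * p) A x" by (simp only: mult.commute)
  then show ?thesis unfolding op_poly_on_mult op_poly_on_X by simp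
qed

lemma op_poly_on_selfadjoint: "selfadjoint_on E (op_poly_on E p A)"
proof -
  have "op_poly_on E p A (c *\<^sub>C x) = c *\<^sub>C op_poly_on E p A x" for c x
    by (induction p) (simp_all add: op_poly_on_pCons selfadjoint_onD[OF EA] scaleC_add_right scaleC_scaleR_commute)
  then have 1: "clinear_op (op_poly_on E p A)" by (simp add: clinear_op_def)
  have "cinner (op_poly_on E p A x) y = cinner x (op_poly_on E p A y)" for x y
  proof (induction p arbitrary: x y)
    case (pCons a p)
    then show ?case
      by (simp add: op_poly_on_pCons cinner_add_left cinner_add_right cinner_scaleR_left cinner_scaleR_right
          selfadjoint_onD(7,11)[OF EA] op_poly_on_commute)
  qed (simp add: cinner_scaleR_left[of 0, simplified] cinner_scaleR_right[of _ 0, simplified])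
  then show ?thesis
    using EA 1 unfolding selfadjoint_on_def selfadjoint_def operator_on_def
    by (auto intro!: blinfun_eqI simp: op_poly_on_absorb)
qed

end

section \<open>Lower bounds, numerical range and spectrum\<close>

text \<open>For self-adjoint \<open>X\<close> on the range of \<open>E\<close> this amounts to
  invertibility there, but it passes to products by multiplying constants and requires no inverse to
  be constructed.\<close>

definition bounded_below_on :: "('h::complex_hilbert \<Rightarrow>\<^sub>L 'h) \<Rightarrow> ('h \<Rightarrow>\<^sub>L 'h) \<Rightarrow> bool" where
  "bounded_below_on E X \<longleftrightarrow> (\<exists>c>0. \<forall>x. c * norm (E x) \<le> norm (X x))"

lemma bounded_below_onI:
  fixes E X :: "'h::complex_hilbert \<Rightarrow>\<^sub>L 'h"
  assumes X: "\<And>x. X (E x) = X x" and E: "orth_projection E" and c: "c > 0"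
    and le: "\<And>y. E y = y \<Longrightarrow> c * (norm y)\<^sup>2 \<le> inner (X y) y"
  shows "bounded_below_on E X"
  unfolding bounded_below_on_def
proof (intro exI conjI allI)
  fix x
  have "c * (norm (E x))\<^sup>2 \<le> inner (X (E x)) (E x)" using le orth_projection_idem[OF E] by blast
  also have "\<dots> \<le> norm (X x) * norm (E x)" unfolding X by (rule norm_cauchy_schwarz)
  finally show "c * norm (E x) \<le> norm (X x)"
    by (cases "norm (E x) = 0") (simp_all add: power2_eq_square)
qed (rule c)

text \<open>The bottom of the numerical range is an approximate eigenvalue:
  \<open>Y = X - \<mu> E\<close> is positive, hence the square of \<open>norm (Y x)\<close> is at
  most \<open>K\<close> times \<open>inner (Y x) x\<close>, and a lower bound for
  \<open>norm (Y x)\<close> would raise the infimum. \<open>E \<noteq> 0\<close> provides unit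
  vectors.\<close>

lemma numerical_range_inf:
  assumes EX: "selfadjoint_on E X" and "E \<noteq> 0"
  obtains \<mu> where "\<And>x. \<mu> * (norm (E x))\<^sup>2 \<le> inner (X x) x" "\<not> bounded_below_on E (X - \<mu> *\<^sub>R E)"
proof -
  note D = selfadjoint_onD[OF EX]
  define W where "W = {inner (X x) x | x. E x = x \<and> norm x = 1}"
  define \<mu> where "\<mu> = Inf W"
  have W: "inner (X ((1 / norm (E x)) *\<^sub>R E x)) ((1 / norm (E x)) *\<^sub>R E x) \<in> W" if "E x \<noteq> 0" for x
    unfolding W_def using D(2) that
    by (intro CollectI exI[of _ "(1 / norm (E x)) *\<^sub>R E x"] conjI refl) (simp_all add: blinfun.scaleR_right)
  obtain x0 where "E x0 \<noteq> 0" using \<open>E \<noteq> 0\<close> by (metis blinfun_eqI zero_blinfun.rep_eq)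
  then have ne: "W \<noteq> {}" using W by auto
  have "- norm X \<le> w" if w: "w \<in> W" for w
  proof -
    obtain x where x: "w = inner (X x) x" "norm x = 1" using w unfolding W_def by blast
    have "\<bar>inner (X x) x\<bar> \<le> norm (X x) * norm x" by (rule Cauchy_Schwarz_ineq2)
    also have "\<dots> \<le> norm X" using norm_blinfun[of X x] x by simp
    finally show ?thesis using x by simp
  qed
  then have bdd: "bdd_below W" by (auto simp: bdd_below_def)
  have XE: "inner (X x) x = inner (X (E x)) (E x)" for x
    by (metis D(3,4,5))
  have low: "\<mu> * (norm (E x))\<^sup>2 \<le> inner (X x) x" for x
  proof (cases "E x = 0")
    case True
    then show ?thesis using XE[of x] by simp
  next
    case False
    let ?n = "norm (E x)" and ?y = "(1 / norm (E x)) *\<^sub>R E x"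
    have "\<mu> \<le> inner (X ?y) ?y" unfolding \<mu>_def by (intro cInf_lower W False bdd)
    also have "\<dots> = inner (X (E x)) (E x) / ?n\<^sup>2" by (simp add: blinfun.scaleR_right power2_eq_square)
    finally show ?thesis using False unfolding XE[of x] by (simp add: field_simps)
  qed
  have "\<not> bounded_below_on E (X - \<mu> *\<^sub>R E)"
  proof
    assume "bounded_below_on E (X - \<mu> *\<^sub>R E)"
    then obtain c where c: "c > 0" "\<And>x. c * norm (E x) \<le> norm ((X - \<mu> *\<^sub>R E) x)"
      unfolding bounded_below_on_def by blast
    define Y where "Y = X - \<mu> *\<^sub>R E"
    \<comment> \<open>The added 1 keeps \<open>K\<close> positive when \<open>Y = 0\<close>.\<close>
    define K where "K = norm Y + 1"
    have K: "K > 0" unfolding K_def by (simp add: add_nonneg_pos)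
    have Ypos: "0 \<le> inner (Y x) x" for x
      using low[of x] D(2,3) unfolding Y_def
      by (simp add: blinfun.diff_left blinfun.scaleR_left inner_diff_left power2_norm_eq_inner)
    have Ysym: "inner (Y x) y = inner x (Y y)" for x y
      unfolding Y_def using D(3,6)
      by (simp add: blinfun.diff_left blinfun.scaleR_left inner_diff_left inner_diff_right)
    have sq: "(norm (Y x))\<^sup>2 \<le> K * inner (Y x) x" for x
    proof -
      have "inner (Y (Y x)) (Y x) \<le> norm (Y (Y x)) * norm (Y x)" by (rule norm_cauchy_schwarz)
      also have "\<dots> \<le> K * (norm (Y x))\<^sup>2"
      proof -
        have "norm (Y (Y x)) \<le> K * norm (Y x)"
          using norm_blinfun[of Y "Y x"] norm_ge_zero[of "Y x"] unfolding K_def distrib_right by linarith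
        then show ?thesis unfolding power2_eq_square mult.assoc[symmetric] by (rule mult_right_mono) simp
      qed
      finally have yy: "inner (Y (Y x)) (Y x) \<le> K * (norm (Y x))\<^sup>2" .
      \<comment> \<open>Expanding the positive form of \<open>Y\<close> at this vector and inserting
        \<open>yy\<close> is an operator version of the Cauchy-Schwarz argument.\<close>
      have "0 \<le> inner (Y (K *\<^sub>R x - Y x)) (K *\<^sub>R x - Y x)" by (rule Ypos)
      also have "\<dots> = K * K * inner (Y x) x - 2 * K * (norm (Y x))\<^sup>2 + inner (Y (Y x)) (Y x)"
        using Ysym[of "Y x" x] by (simp add: blinfun.diff_right blinfun.scaleR_right inner_diff_left inner_diff_right
          power2_norm_eq_inner algebra_simps)
      finally have "0 \<le> K * (K * inner (Y x) x - (norm (Y x))\<^sup>2)" using yy by (simp add: algebra_simps)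
      then show ?thesis using K by (simp add: zero_le_mult_iff)
    qed
    have "\<mu> + c\<^sup>2 / K \<le> w" if "w \<in> W" for w
    proof -
      obtain x where x: "w = inner (X x) x" "E x = x" "norm x = 1" using \<open>w \<in> W\<close> unfolding W_def by blast
      have "c \<le> norm (Y x)" using c(2)[of x] x by (simp add: Y_def)
      then have "c\<^sup>2 \<le> K * inner (Y x) x" using sq[of x] c(1) by (meson power_mono order.trans less_imp_le)
      moreover have "inner (Y x) x = w - \<mu>"
        using x unfolding Y_def
        by (simp add: blinfun.diff_left blinfun.scaleR_left inner_diff_left power2_norm_eq_inner[symmetric])
      ultimately show ?thesis using K by (simp add: field_simps)
    qed
    then have "\<mu> + c\<^sup>2 / K \<le> \<mu>" unfolding \<mu>_def using ne by (intro cInf_greatest) (auto simp: \<mu>_def)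
    then show False using c(1) K by (simp add: field_simps)
  qed
  then show ?thesis using that low by blast
qed

text \<open>Two instances matter for \<open>K\<close>: the real points of the spectrum, over which \<open>cfc_on\<close> takes its
  limits, and an interval containing the numerical range, on which Bernstein polynomials converge.\<close>

definition spectral_set :: "('h::complex_hilbert \<Rightarrow>\<^sub>L 'h) \<Rightarrow> ('h \<Rightarrow>\<^sub>L 'h) \<Rightarrow> real set \<Rightarrow> bool" where
  "spectral_set E A K \<longleftrightarrow> (\<forall>t. t \<notin> K \<longrightarrow> bounded_below_on E (A - t *\<^sub>R E))"

abbreviation real_spectrum_on :: "('h::complex_hilbert \<Rightarrow>\<^sub>L 'h) \<Rightarrow> ('h \<Rightarrow>\<^sub>L 'h) \<Rightarrow> real set" where
  "real_spectrum_on E A \<equiv> {t. complex_of_real t \<in> spectrum_on E A}"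

text \<open>A bounded left inverse gives the lower bound; the 1 added to its norm covers
  \<open>R = 0\<close>.\<close>

lemma spectral_set_spectrum: "spectral_set E A (real_spectrum_on E A)"
  unfolding spectral_set_def
proof (intro allI impI)
  fix t assume "t \<notin> real_spectrum_on E A"
  then obtain R :: "'a \<Rightarrow>\<^sub>L 'a" where R: "\<And>x. R (A x - complex_of_real t *\<^sub>C E x) = E x"
    unfolding spectrum_on_def by auto
  have "1 / (norm R + 1) * norm (E x) \<le> norm ((A - t *\<^sub>R E) x)" for x
  proof -
    have "norm (E x) \<le> norm R * norm (A x - t *\<^sub>R E x)"
      using norm_blinfun[of R "A x - t *\<^sub>R E x"] R[of x] by (simp add: scaleC_of_real)
    also have "\<dots> \<le> (norm R + 1) * norm ((A - t *\<^sub>R E) x)"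
      by (intro mult_mono) (auto simp: blinfun.diff_left blinfun.scaleR_left)
    finally show ?thesis
      using divide_le_eq[of "norm (E x)" "norm R + 1"] by (simp add: add_nonneg_pos mult.commute)
  qed
  moreover have "1 / (norm R + 1) > 0" by (simp add: add_nonneg_pos)
  ultimately show "bounded_below_on E (A - t *\<^sub>R E)" unfolding bounded_below_on_def by blast
qed

lemma spectral_set_numerical_range:
  assumes EA: "selfadjoint_on E A"
    and m: "\<And>x. m * (norm (E x))\<^sup>2 \<le> inner (A x) x" and M: "\<And>x. inner (A x) x \<le> M * (norm (E x))\<^sup>2"
  shows "spectral_set E A {m..M}"
  unfolding spectral_set_def
proof (intro allI impI)
  fix t assume "t \<notin> {m..M}"
  then consider "t < m" | "t > M" by fastforce
  then show "bounded_below_on E (A - t *\<^sub>R E)"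
  proof cases
    case 1
    show ?thesis
    proof (rule bounded_below_onI[where c = "m - t"])
      fix y assume "E y = y"
      then show "(m - t) * (norm y)\<^sup>2 \<le> inner ((A - t *\<^sub>R E) y) y"
        using m[of y] by (simp add: blinfun.diff_left blinfun.scaleR_left inner_diff_left power2_norm_eq_inner algebra_simps)
    qed (use 1 selfadjoint_onD[OF EA] in \<open>auto simp: blinfun.diff_left blinfun.scaleR_left\<close>)
  next
    case 2
    have "bounded_below_on E (- (A - t *\<^sub>R E))"
    proof (rule bounded_below_onI[where c = "t - M"])
      fix y assume "E y = y"
      then show "(t - M) * (norm y)\<^sup>2 \<le> inner ((- (A - t *\<^sub>R E)) y) y"
        using M[of y] by (simp add: blinfun.diff_left blinfun.scaleR_left blinfun.minus_left inner_diff_left power2_norm_eq_inner algebra_simps)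
    qed (use 2 selfadjoint_onD[OF EA] in \<open>auto simp: blinfun.diff_left blinfun.scaleR_left blinfun.minus_left\<close>)
    moreover have "norm ((- (A - t *\<^sub>R E)) x) = norm ((A - t *\<^sub>R E) x)" for x
      unfolding blinfun.minus_left by (rule norm_minus_cancel)
    ultimately show ?thesis unfolding bounded_below_on_def by (simp only:)
  qed
qed

text \<open>The real factors are treated one by one: a linear factor has its root off
  \<open>K\<close>, and an irreducible quadratic is \<open>(A - \<alpha>)^2 + \<beta>^2\<close>,
  bounded below by \<open>\<beta>^2\<close> whatever \<open>K\<close> is.\<close>

lemma bounded_below_op_poly:
  assumes EA: "selfadjoint_on E A" and K: "spectral_set E A K"
    and "q \<noteq> 0" "\<And>t. t \<in> K \<Longrightarrow> poly q t \<noteq> 0"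
  shows "bounded_below_on E (op_poly_on E q A)"
  using assms(3,4)
proof (induction "degree q" arbitrary: q rule: less_induct)
  case less
  note D = selfadjoint_onD[OF EA]
  have reduce: ?case
    if q: "q = d * q'" and d: "degree d > 0" and bd: "bounded_below_on E (op_poly_on E d A)" for d q'
  proof -
    have nz: "d \<noteq> 0" "q' \<noteq> 0" using less.prems(1) q by auto
    then have "degree q' < degree q" unfolding q using d by (simp add: degree_mult_eq)
    then have "bounded_below_on E (op_poly_on E q' A)"
      using nz(2) less.prems(2) q by (intro less.hyps) auto
    then obtain c where c: "c > 0" "\<And>x. c * norm (E x) \<le> norm (op_poly_on E q' A x)"
      unfolding bounded_below_on_def by blast
    obtain c' where c': "c' > 0" "\<And>x. c' * norm (E x) \<le> norm (op_poly_on E d A x)"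
      using bd unfolding bounded_below_on_def by blast
    have "(c' * c) * norm (E x) \<le> norm (op_poly_on E q A x)" for x
    proof -
      have "(c' * c) * norm (E x) \<le> c' * norm (op_poly_on E q' A x)"
        using c(2)[of x] c'(1) by (simp add: mult.assoc)
      also have "\<dots> \<le> norm (op_poly_on E d A (op_poly_on E q' A x))"
        using c'(2)[of "op_poly_on E q' A x"] by (simp add: op_poly_on_absorb[OF EA])
      finally show ?thesis by (simp add: q op_poly_on_mult[OF EA])
    qed
    then show ?thesis using c(1) c'(1) unfolding bounded_below_on_def by (intro exI[of _ "c' * c"]) auto
  qed
  show ?case
  proof (cases "degree q = 0")
    case True
    then obtain a where q: "q = [:a:]" by (metis degree_eq_zeroE)
    then have "\<bar>a\<bar> > 0" using less.prems by auto
    then show ?thesis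
      unfolding bounded_below_on_def by (intro exI[of _ "\<bar>a\<bar>"]) (simp add: q op_poly_on_const)
  next
    case False
    then have "degree q > 0" by simp
    then show ?thesis
    proof (cases q rule: real_poly_factor)
      case (linear a q')
      have "a \<notin> K" using less.prems(2)[of a] linear by auto
      moreover have "op_poly_on E [:- a, 1:] A = A - a *\<^sub>R E"
        by (intro blinfun_eqI) (simp add: op_poly_on_X[OF EA] blinfun.diff_left blinfun.scaleR_left)
      ultimately show ?thesis using K by (intro reduce[OF linear]) (auto simp: spectral_set_def)
    next
      case (quadratic \<alpha> \<beta> q')
      let ?d = "[:\<alpha>\<^sup>2 + \<beta>\<^sup>2, - 2 * \<alpha>, 1:]"
      have "?d = [:- \<alpha>, 1:] * [:- \<alpha>, 1:] + [:\<beta>\<^sup>2:]" by (simp add: power2_eq_square)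
      then have d: "op_poly_on E ?d A x = op_poly_on E [:- \<alpha>, 1:] A (op_poly_on E [:- \<alpha>, 1:] A x) + \<beta>\<^sup>2 *\<^sub>R E x" for x
        by (simp only: op_poly_on_add op_poly_on_mult[OF EA] op_poly_on_const)
      have "bounded_below_on E (op_poly_on E ?d A)"
      proof (rule bounded_below_onI[where c = "\<beta>\<^sup>2"])
        fix y assume y: "E y = y"
        have "inner (op_poly_on E ?d A y) y = (norm (op_poly_on E [:- \<alpha>, 1:] A y))\<^sup>2 + \<beta>\<^sup>2 * (norm y)\<^sup>2"
          unfolding d y inner_add_left selfadjoint_onD(6)[OF op_poly_on_selfadjoint[OF EA, of "[:- \<alpha>, 1:]"], of "op_poly_on E [:- \<alpha>, 1:] A y"]
          by (simp add: power2_norm_eq_inner)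
        then show "\<beta>\<^sup>2 * (norm y)\<^sup>2 \<le> inner (op_poly_on E ?d A y) y" by simp
      qed (use quadratic(1) D(1) op_poly_on_absorb[OF EA] in auto)
      then show ?thesis by (intro reduce[OF quadratic(2)]) auto
    qed
  qed
qed

text \<open>If the bottom \<mu> of the numerical range of \<open>q(A)\<close> were negative,
  \<open>q - \<mu>\<close> would have no zero in \<open>K\<close>, so \<open>q(A) - \<mu>\<close>
  would be bounded below, against \<open>numerical_range_inf\<close>.\<close>

lemma op_poly_nonneg:
  assumes EA: "selfadjoint_on E A" and K: "spectral_set E A K"
    and q: "\<And>t. t \<in> K \<Longrightarrow> poly q t \<ge> 0"
  shows "0 \<le> inner (op_poly_on E q A x) x"
proof (cases "E = 0")
  case True
  then have "op_poly_on E q A x = 0" using op_poly_on_absorb(1)[OF EA, of q x] by simp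
  then show ?thesis by simp
next
  case False
  \<comment> \<open>A witness that \<open>K\<close> is nonempty, which excludes that
    \<open>q - [:\<mu>:]\<close> is the zero polynomial.\<close>
  obtain \<mu>' where "\<not> bounded_below_on E (A - \<mu>' *\<^sub>R E)"
    using numerical_range_inf[OF EA False] .
  then have "\<mu>' \<in> K" using K unfolding spectral_set_def by blast
  obtain \<mu> where \<mu>: "\<And>x. \<mu> * (norm (E x))\<^sup>2 \<le> inner (op_poly_on E q A x) x"
    "\<not> bounded_below_on E (op_poly_on E q A - \<mu> *\<^sub>R E)"
    using numerical_range_inf[OF op_poly_on_selfadjoint[OF EA, of q] False] by blast
  have "\<mu> \<ge> 0"
  proof (rule ccontr)
    assume neg: "\<not> \<mu> \<ge> 0"
    have pos: "poly (q - [:\<mu>:]) t > 0" if "t \<in> K" for t using q[OF that] neg by simp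
    have "bounded_below_on E (op_poly_on E (q - [:\<mu>:]) A)"
    proof (rule bounded_below_op_poly[OF EA K])
      show "q - [:\<mu>:] \<noteq> 0" using pos[OF \<open>\<mu>' \<in> K\<close>] by auto
      show "poly (q - [:\<mu>:]) t \<noteq> 0" if "t \<in> K" for t using pos[OF that] by simp
    qed
    moreover have "op_poly_on E (q - [:\<mu>:]) A = op_poly_on E q A - \<mu> *\<^sub>R E"
      by (intro blinfun_eqI) (simp add: op_poly_on_diff op_poly_on_const blinfun.diff_left blinfun.scaleR_left)
    ultimately show False using \<mu>(2) by simp
  qed
  then show ?thesis using \<mu>(1)[of x] by (meson mult_nonneg_nonneg order.trans zero_le_power2)
qed

text \<open>Positivity applied to \<open>\<epsilon>^2 - q^2\<close>.\<close>

lemma op_poly_norm_le: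
  assumes EA: "selfadjoint_on E A" and K: "spectral_set E A K"
    and q: "\<And>t. t \<in> K \<Longrightarrow> \<bar>poly q t\<bar> \<le> \<epsilon>" and \<epsilon>: "\<epsilon> \<ge> 0"
  shows "norm (op_poly_on E q A) \<le> \<epsilon>"
proof (rule norm_blinfun_bound[OF \<epsilon>])
  fix x
  note D = selfadjoint_onD[OF EA]
  have "norm (E x) \<le> norm x"
  proof -
    have "(norm (E x))\<^sup>2 \<le> norm (E x) * norm x"
      unfolding power2_norm_eq_inner using norm_cauchy_schwarz[of "E x" x] D(2)[of x] D(3)[of x "E x"] D(3)[of "E x" x] by (simp add: power2_norm_eq_inner[symmetric])
    then show ?thesis by (cases "norm (E x) = 0") (auto simp: power2_eq_square)
  qed
  have "0 \<le> inner (op_poly_on E ([:\<epsilon>\<^sup>2:] - q * q) A x) x"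
  proof (rule op_poly_nonneg[OF EA K])
    fix t assume "t \<in> K"
    then have "(poly q t)\<^sup>2 \<le> \<epsilon>\<^sup>2" using q abs_le_square_iff \<epsilon> by fastforce
    then show "0 \<le> poly ([:\<epsilon>\<^sup>2:] - q * q) t" by (simp add: power2_eq_square)
  qed
  then have "(norm (op_poly_on E q A x))\<^sup>2 \<le> \<epsilon>\<^sup>2 * (norm (E x))\<^sup>2"
    using selfadjoint_onD(6)[OF op_poly_on_selfadjoint[OF EA, of q], of "op_poly_on E q A x" x] D(2)[of x] D(3)[of x "E x"] D(3)[of "E x" x]
    by (simp add: op_poly_on_diff op_poly_on_mult[OF EA] op_poly_on_const inner_diff_left power2_norm_eq_inner)
  also have "\<dots> \<le> (\<epsilon> * norm x)\<^sup>2"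
    using \<open>norm (E x) \<le> norm x\<close> by (simp add: power_mult_distrib mult_left_mono power_mono)
  finally show "norm (op_poly_on E q A x) \<le> \<epsilon> * norm x"
    using \<epsilon> by (simp add: power2_le_iff_abs_le)
qed

lemma op_poly_uniform_limit:
  assumes EA: "selfadjoint_on E A" and K: "spectral_set E A K"
    and lim: "uniform_limit K (\<lambda>n t. poly (p n) t - poly (p' n) t) (\<lambda>_. 0) sequentially"
  shows "(\<lambda>n. op_poly_on E (p n) A - op_poly_on E (p' n) A) \<longlonglongrightarrow> 0"
proof (rule LIMSEQ_I)
  fix r :: real assume r: "r > 0"
  then have "\<forall>\<^sub>F n in sequentially. \<forall>t\<in>K. dist (poly (p n) t - poly (p' n) t) 0 < r / 2"
    using lim unfolding uniform_limit_iff by (meson half_gt_zero)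
  then obtain N where N: "\<And>n t. n \<ge> N \<Longrightarrow> t \<in> K \<Longrightarrow> \<bar>poly (p n) t - poly (p' n) t\<bar> < r / 2"
    unfolding eventually_sequentially by auto
  have "norm (op_poly_on E (p n) A - op_poly_on E (p' n) A - 0) < r" if "n \<ge> N" for n
  proof -
    have "norm (op_poly_on E (p n - p' n) A) \<le> r / 2"
      using N[OF that] r by (intro op_poly_norm_le[OF EA K]) (auto simp: less_imp_le)
    moreover have "op_poly_on E (p n - p' n) A = op_poly_on E (p n) A - op_poly_on E (p' n) A"
      by (intro blinfun_eqI) (simp add: op_poly_on_diff blinfun.diff_left)
    ultimately show ?thesis using r by simp
  qed
  then show "\<exists>N. \<forall>n\<ge>N. norm (op_poly_on E (p n) A - op_poly_on E (p' n) A - 0) < r" by blast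
qed

text \<open>Two approximating sequences differ by polynomials tending to 0 uniformly on the real
  spectrum, so their operators share the limit; this gives the definite description in
  \<open>cfc_on\<close> its meaning.\<close>

lemma cfc_on_eqI:
  assumes EA: "selfadjoint_on E A"
    and lim: "uniform_limit (real_spectrum_on E A) (\<lambda>n. poly (p n)) g sequentially"
    and B: "(\<lambda>n. op_poly_on E (p n) A) \<longlonglongrightarrow> B"
  shows "cfc_on E g A = B"
  unfolding cfc_on_def
proof (rule the_equality)
  fix B' assume "\<exists>p. uniform_limit (real_spectrum_on E A) (\<lambda>n. poly (p n)) g sequentially \<and> (\<lambda>n. op_poly_on E (p n) A) \<longlonglongrightarrow> B'"
  then obtain p' where p': "uniform_limit (real_spectrum_on E A) (\<lambda>n. poly (p' n)) g sequentially"
    "(\<lambda>n. op_poly_on E (p' n) A) \<longlonglongrightarrow> B'" by blast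
  have "uniform_limit (real_spectrum_on E A) (\<lambda>n t. poly (p' n) t - poly (p n) t) (\<lambda>t. g t - g t) sequentially"
    using p'(1) lim by (rule uniform_limit_minus)
  then have "(\<lambda>n. op_poly_on E (p' n) A - op_poly_on E (p n) A) \<longlonglongrightarrow> 0"
    by (intro op_poly_uniform_limit[OF EA spectral_set_spectrum]) simp
  moreover have "(\<lambda>n. op_poly_on E (p' n) A - op_poly_on E (p n) A) \<longlonglongrightarrow> B' - B"
    by (intro tendsto_diff p'(2) B)
  ultimately show "B' = B" using LIMSEQ_unique by force
qed (use lim B in blast)

lemma op_poly_convergent:
  assumes EA: "selfadjoint_on E A" and K: "spectral_set E A K"
    and lim: "uniform_limit K (\<lambda>n. poly (p n)) g sequentially"
  shows "convergent (\<lambda>n. op_poly_on E (p n) A)"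
proof (rule Cauchy_convergent, rule CauchyI)
  fix r :: real assume r: "r > 0"
  then have "\<forall>\<^sub>F n in sequentially. \<forall>t\<in>K. dist (poly (p n) t) (g t) < r / 4"
    using lim unfolding uniform_limit_iff by (meson divide_pos_pos zero_less_numeral)
  then obtain N where N: "\<And>n t. n \<ge> N \<Longrightarrow> t \<in> K \<Longrightarrow> \<bar>poly (p n) t - g t\<bar> < r / 4"
    unfolding eventually_sequentially dist_real_def by auto
  have "norm (op_poly_on E (p n) A - op_poly_on E (p k) A) < r" if "n \<ge> N" "k \<ge> N" for n k
  proof -
    have "norm (op_poly_on E (p n - p k) A) \<le> r / 2"
    proof (rule op_poly_norm_le[OF EA K])
      show "\<bar>poly (p n - p k) t\<bar> \<le> r / 2" if "t \<in> K" for t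
        using N[OF \<open>n \<ge> N\<close> that] N[OF \<open>k \<ge> N\<close> that] unfolding poly_diff by linarith
    qed (use r in simp)
    moreover have "op_poly_on E (p n - p k) A = op_poly_on E (p n) A - op_poly_on E (p k) A"
      by (intro blinfun_eqI) (simp add: op_poly_on_diff blinfun.diff_left)
    ultimately show ?thesis using r by simp
  qed
  then show "\<exists>N. \<forall>n\<ge>N. \<forall>k\<ge>N. norm (op_poly_on E (p n) A - op_poly_on E (p k) A) < r" by blast
qed

section \<open>Bernstein approximation on an interval\<close>

text \<open>Kept as a \<open>real poly\<close> so that \<open>op_poly_on\<close> applies; the two
  linear factors are \<open>(u - m) / (M - m)\<close> and \<open>(M - u) / (M - m)\<close>.\<close>

definition bernstein_basis :: "real \<Rightarrow> real \<Rightarrow> nat \<Rightarrow> nat \<Rightarrow> real poly" where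
  "bernstein_basis m M n k = smult (of_nat (n choose k))
     ([:- m / (M - m), 1 / (M - m):] ^ k * [:M / (M - m), - 1 / (M - m):] ^ (n - k))"

definition bernstein_node :: "real \<Rightarrow> real \<Rightarrow> nat \<Rightarrow> nat \<Rightarrow> real" where
  "bernstein_node m M n k = m + (M - m) * (real k / real n)"

definition bernstein_poly :: "(real \<Rightarrow> real) \<Rightarrow> real \<Rightarrow> real \<Rightarrow> nat \<Rightarrow> real poly" where
  "bernstein_poly f m M n = (\<Sum>k\<le>n. smult (f (bernstein_node m M n k)) (bernstein_basis m M n k))"

lemma poly_bernstein_basis:
  assumes "m < M"
  shows "poly (bernstein_basis m M n k) u = Bernstein n k ((u - m) / (M - m))"
proof -
  have "- m / (M - m) + u * (1 / (M - m)) = (u - m) / (M - m)" by (simp add: diff_divide_distrib)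
  moreover have "M / (M - m) + u * (- 1 / (M - m)) = 1 - (u - m) / (M - m)"
  proof -
    have "1 - (u - m) / (M - m) = (M - m) / (M - m) - (u - m) / (M - m)" using assms by simp
    also have "\<dots> = (M - u) / (M - m)" unfolding diff_divide_distrib[symmetric] by simp
    finally show ?thesis by (simp add: diff_divide_distrib)
  qed
  ultimately show ?thesis
    unfolding bernstein_basis_def Bernstein_def
    by (simp only: poly_smult poly_mult poly_power poly_pCons poly_0 mult_zero_right add_0_right)
qed

lemma poly_bernstein_poly:
  assumes "m < M"
  shows "poly (bernstein_poly f m M n) u =
    (\<Sum>k\<le>n. f (bernstein_node m M n k) * Bernstein n k ((u - m) / (M - m)))"
  unfolding bernstein_poly_def by (simp add: poly_sum poly_bernstein_basis[OF assms])

lemma bernstein_node_bounds: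
  assumes "m < M" "k \<le> n"
  shows "bernstein_node m M n k \<in> {m..M}"
proof -
  have "0 \<le> real k / real n" "real k / real n \<le> 1" using assms(2) by (auto simp: divide_le_eq)
  then have "0 \<le> (M - m) * (real k / real n)" "(M - m) * (real k / real n) \<le> (M - m) * 1"
    using assms(1) by (intro mult_nonneg_nonneg mult_left_mono; simp)+
  then show ?thesis unfolding bernstein_node_def by simp
qed

lemma bernstein_uniform_limit:
  assumes mM: "m < M" and f: "continuous_on {m..M} f"
  shows "uniform_limit {m..M} (\<lambda>n. poly (bernstein_poly f m M n)) f sequentially"
  unfolding uniform_limit_sequentially_iff
proof (intro allI impI)
  fix e :: real assume e: "e > 0"
  have aff: "m + (M - m) * x \<in> {m..M}" if "x \<in> {0..1}" for x
  proof -
    have "0 \<le> (M - m) * x" "(M - m) * x \<le> (M - m) * 1"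
      using that mM by (intro mult_nonneg_nonneg mult_left_mono; simp)+
    then show ?thesis by simp
  qed
  have "continuous_on {0..1} (\<lambda>x. f (m + (M - m) * x))"
    by (rule continuous_on_compose2[OF f]) (use aff in \<open>auto intro!: continuous_intros\<close>)
  from Bernstein_Weierstrass[OF this e] obtain N where N:
    "\<And>n x. N \<le> n \<Longrightarrow> x \<in> {0..1} \<Longrightarrow>
      \<bar>f (m + (M - m) * x) - (\<Sum>k\<le>n. f (m + (M - m) * (real k / real n)) * Bernstein n k x)\<bar> < e" by blast
  have "dist (poly (bernstein_poly f m M n) u) (f u) < e" if "n \<ge> N" "u \<in> {m..M}" for n u
  proof -
    let ?x = "(u - m) / (M - m)"
    have "?x \<in> {0..1}" using that(2) mM by (auto simp: divide_le_eq)
    moreover have "m + (M - m) * ?x = u" using mM by simp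
    ultimately show ?thesis
      using N[OF that(1), of ?x] unfolding poly_bernstein_poly[OF mM] dist_real_def bernstein_node_def
      by (simp only: abs_minus_commute)
  qed
  then show "\<exists>N. \<forall>n\<ge>N. \<forall>u\<in>{m..M}. dist (poly (bernstein_poly f m M n) u) (f u) < e" by blast
qed

text \<open>The variance of a binomial frequency, from the moments of the basis.\<close>

lemma bernstein_variance:
  assumes "n > 0"
  shows "(\<Sum>k\<le>n. (x - real k / real n)\<^sup>2 * Bernstein n k x) = x * (1 - x) / real n"
proof -
  have "(x - real k / real n)\<^sup>2 * Bernstein n k x =
     x\<^sup>2 * Bernstein n k x + (1 / (real n)\<^sup>2 - 2 * x / real n) * (real k * Bernstein n k x)
       + 1 / (real n)\<^sup>2 * (real k * (real k - 1) * Bernstein n k x)" for k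
    using assms by (simp add: field_simps power2_eq_square)
  then have "(\<Sum>k\<le>n. (x - real k / real n)\<^sup>2 * Bernstein n k x) =
     x\<^sup>2 * 1 + (1 / (real n)\<^sup>2 - 2 * x / real n) * (real n * x) + 1 / (real n)\<^sup>2 * (real n * (real n - 1) * x\<^sup>2)"
    by (simp only: sum.distrib sum_distrib_left[symmetric] sum_Bernstein sum_k_Bernstein sum_kk_Bernstein)
  also have "\<dots> = x * (1 - x) / real n"
    using assms by (simp add: field_simps power2_eq_square)
  finally show ?thesis .
qed

text \<open>An explicit rate, linear in \<open>L\<close>: for resolvent functions the error has to
  be controlled uniformly in their parameter, which convergence alone does not give.\<close>

lemma bernstein_lipschitz:
  assumes mM: "m < M" and n: "n > 0" and u: "u \<in> {m..M}" and L: "L \<ge> 0"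
    and lip: "\<And>v w. v \<in> {m..M} \<Longrightarrow> w \<in> {m..M} \<Longrightarrow> \<bar>f v - f w\<bar> \<le> L * \<bar>v - w\<bar>"
  shows "\<bar>poly (bernstein_poly f m M n) u - f u\<bar> \<le> L * (M - m) / sqrt (real n)"
proof -
  let ?x = "(u - m) / (M - m)"
  have x: "0 \<le> ?x" "?x \<le> 1" using u mM by (auto simp: divide_le_eq)
  have ux: "u = m + (M - m) * ?x" using mM by simp
  \<comment> \<open>Linearizes the absolute value so that only the variance has to be summed; the
    weight \<open>sqrt n\<close> balances both terms at order \<open>1 / sqrt n\<close>.\<close>
  have am_gm: "\<bar>d\<bar> \<le> 1 / (2 * sqrt (real n)) + sqrt (real n) / 2 * d\<^sup>2" for d :: real
  proof -
    have "0 \<le> (1 - sqrt (real n) * \<bar>d\<bar>)\<^sup>2" by simp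
    then have "2 * (sqrt (real n) * \<bar>d\<bar>) \<le> 1 + (sqrt (real n))\<^sup>2 * d\<^sup>2"
      by (simp add: power2_diff power_mult_distrib)
    then show ?thesis using n by (simp add: field_simps power2_eq_square)
  qed
  have B: "Bernstein n k ?x \<ge> 0" for k using x by (rule Bernstein_nonneg)
  have "\<bar>f (bernstein_node m M n k) - f u\<bar> \<le> L * (M - m) * \<bar>?x - real k / real n\<bar>" if "k \<le> n" for k
  proof -
    have "\<bar>f (bernstein_node m M n k) - f u\<bar> \<le> L * \<bar>bernstein_node m M n k - u\<bar>"
      using bernstein_node_bounds[OF mM that] u by (rule lip)
    also have "bernstein_node m M n k - u = (M - m) * (real k / real n - ?x)"
      by (subst ux) (simp add: bernstein_node_def algebra_simps)
    finally show ?thesis using mM by (simp add: abs_mult abs_minus_commute mult.assoc)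
  qed
  then have summand: "\<bar>(f (bernstein_node m M n k) - f u) * Bernstein n k ?x\<bar> \<le>
      L * (M - m) * (1 / (2 * sqrt (real n)) + sqrt (real n) / 2 * (?x - real k / real n)\<^sup>2) * Bernstein n k ?x"
    if "k \<le> n" for k
    unfolding abs_mult using am_gm[of "?x - real k / real n"] B[of k] L mM that
    by (intro mult_mono order.trans[OF _ mult_left_mono[OF am_gm]]) auto
  have "poly (bernstein_poly f m M n) u - f u = (\<Sum>k\<le>n. (f (bernstein_node m M n k) - f u) * Bernstein n k ?x)"
    unfolding poly_bernstein_poly[OF mM]
    by (simp add: left_diff_distrib sum_subtractf sum_distrib_left[symmetric])
  then have "\<bar>poly (bernstein_poly f m M n) u - f u\<bar> \<le>
      (\<Sum>k\<le>n. L * (M - m) * (1 / (2 * sqrt (real n)) + sqrt (real n) / 2 * (?x - real k / real n)\<^sup>2) * Bernstein n k ?x)"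
    using summand by (simp only: atMost_iff) (intro order.trans[OF sum_abs] sum_mono, simp)
  also have "\<dots> = L * (M - m) * (1 / (2 * sqrt (real n)) * (\<Sum>k\<le>n. Bernstein n k ?x) +
      sqrt (real n) / 2 * (\<Sum>k\<le>n. (?x - real k / real n)\<^sup>2 * Bernstein n k ?x))"
    unfolding sum_distrib_left sum.distrib[symmetric]
    by (intro sum.cong refl) (simp only: distrib_left distrib_right mult.assoc)
  also have "\<dots> = L * (M - m) * (1 / (2 * sqrt (real n)) + sqrt (real n) / 2 * (?x * (1 - ?x) / real n))"
    by (simp only: bernstein_variance[OF n] sum_Bernstein mult_1_right)
  also have "\<dots> \<le> L * (M - m) * (1 / (2 * sqrt (real n)) + sqrt (real n) / 2 * (1 / real n))"
    using x L mM mult_le_one[of ?x "1 - ?x"]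
    by (intro mult_left_mono add_left_mono divide_right_mono) auto
  also have "sqrt (real n) / 2 * (1 / real n) = 1 / (2 * sqrt (real n))"
    using n real_sqrt_mult_self[of "real n"] by (simp add: field_simps)
  finally show ?thesis by (simp add: field_simps)
qed

lemma op_poly_bernstein:
  "op_poly_on E (bernstein_poly f m M n) A x =
    (\<Sum>k\<le>n. f (bernstein_node m M n k) *\<^sub>R op_poly_on E (bernstein_basis m M n k) A x)"
  unfolding bernstein_poly_def op_poly_on_sum op_poly_on_smult ..

section \<open>Resolvents\<close>

lemma norm_scaleC: "norm (c *\<^sub>C (x :: 'a::complex_inner)) = cmod c * norm x"
proof -
  have "complex_of_real ((norm (c *\<^sub>C x))\<^sup>2) = c * cnj c * complex_of_real ((norm x)\<^sup>2)"
    unfolding cinner_self[symmetric] cinner_scaleC_left cinner_scaleC_right by simp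
  also have "\<dots> = complex_of_real ((cmod c * norm x)\<^sup>2)"
    by (simp add: complex_norm_square[symmetric] power_mult_distrib)
  finally have "(norm (c *\<^sub>C x))\<^sup>2 = (cmod c * norm x)\<^sup>2" by (simp only: of_real_eq_iff)
  then show ?thesis by (simp add: power2_eq_iff_nonneg)
qed

lemma bounded_linear_scaleC: "bounded_linear (\<lambda>x :: 'a::complex_inner. c *\<^sub>C x)"
proof (rule bounded_linear_intro)
  show "norm (c *\<^sub>C x) \<le> norm x * cmod c" for x :: 'a by (simp add: norm_scaleC)
qed (simp_all add: scaleC_add_right scaleC_scaleR_commute)

lemma bounded_linear_blinfun_at: "bounded_linear (\<lambda>X :: 'a::real_normed_vector \<Rightarrow>\<^sub>L 'b::real_normed_vector. X x)"
  by (rule blinfun.bounded_linear_left)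

context
  fixes E A R :: "'h::complex_hilbert \<Rightarrow>\<^sub>L 'h" and p :: "nat \<Rightarrow> real poly"
  assumes EA: "selfadjoint_on E A" and R: "(\<lambda>n. op_poly_on E (p n) A) \<longlonglongrightarrow> R"
begin

lemma op_poly_limit_at: "(\<lambda>n. op_poly_on E (p n) A x) \<longlonglongrightarrow> R x"
  by (rule bounded_linear.tendsto[OF bounded_linear_blinfun_at R])

lemma op_poly_limit_absorb: "E (R x) = R x" "R (E x) = R x"
proof -
  have "(\<lambda>n. E (op_poly_on E (p n) A x)) \<longlonglongrightarrow> E (R x)"
    by (intro tendsto_intros op_poly_limit_at)
  then show "E (R x) = R x"
    unfolding op_poly_on_absorb[OF EA] using op_poly_limit_at LIMSEQ_unique by blast
  show "R (E x) = R x"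
    using op_poly_limit_at[of "E x"] op_poly_limit_at[of x]
    unfolding op_poly_on_absorb[OF EA] by (rule LIMSEQ_unique)
qed

lemma op_poly_limit_operator_on: "operator_on E R"
proof -
  have "R (c *\<^sub>C x) = c *\<^sub>C R x" for c x
  proof -
    have "(\<lambda>n. c *\<^sub>C op_poly_on E (p n) A x) \<longlonglongrightarrow> c *\<^sub>C R x"
      by (rule bounded_linear.tendsto[OF bounded_linear_scaleC op_poly_limit_at])
    then show ?thesis
      using op_poly_limit_at[of "c *\<^sub>C x"] LIMSEQ_unique
      unfolding selfadjoint_onD(8)[OF op_poly_on_selfadjoint[OF EA]] by blast
  qed
  then show ?thesis
    unfolding operator_on_def clinear_op_def by (auto intro!: blinfun_eqI simp: op_poly_limit_absorb)
qed

text \<open>\<open>(u - t) * p n u\<close> tends to 1 uniformly because \<open>u - t\<close> is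
  bounded on \<open>K\<close>; polynomials in \<open>A\<close> commute, so the limit is a two-sided
  inverse.\<close>

lemma op_poly_limit_inverse:
  assumes K: "spectral_set E A K" and bd: "bounded K" and t: "t \<notin> K"
    and lim: "uniform_limit K (\<lambda>n. poly (p n)) (\<lambda>u. 1 / (u - t)) sequentially"
  shows "A (R x) - t *\<^sub>R R x = E x" "R (A x - t *\<^sub>R E x) = E x"
proof -
  obtain C where C: "\<And>u. u \<in> K \<Longrightarrow> \<bar>u\<bar> \<le> C" using bd by (auto simp: bounded_iff)
  have "uniform_limit K (\<lambda>n u. poly ([:- t, 1:] * p n) u - poly [:1:] u) (\<lambda>_. 0) sequentially"
  proof (rule uniform_limitI)
    fix e :: real assume e: "e > 0"
    define D where "D = \<bar>C\<bar> + \<bar>t\<bar> + 1"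
    have D: "D > 0" by (simp add: D_def)
    have "\<forall>\<^sub>F n in sequentially. \<forall>u\<in>K. dist (poly (p n) u) (1 / (u - t)) < e / D"
      using lim e D by (intro uniform_limitD) auto
    then show "\<forall>\<^sub>F n in sequentially. \<forall>u\<in>K. dist (poly ([:- t, 1:] * p n) u - poly [:1:] u) 0 < e"
    proof eventually_elim
      case (elim n)
      show ?case
      proof
        fix u assume u: "u \<in> K"
        then have "u \<noteq> t" using t by auto
        then have "\<bar>poly ([:- t, 1:] * p n) u - 1\<bar> = \<bar>u - t\<bar> * \<bar>poly (p n) u - 1 / (u - t)\<bar>"
          unfolding abs_mult[symmetric] by (simp add: algebra_simps diff_divide_distrib[symmetric])
        also have "\<dots> \<le> D * \<bar>poly (p n) u - 1 / (u - t)\<bar>"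
          using C[OF u] unfolding D_def by (intro mult_right_mono) auto
        also have "\<dots> < D * (e / D)"
          using elim u D unfolding dist_real_def by (intro mult_strict_left_mono) auto
        finally show "dist (poly ([:- t, 1:] * p n) u - poly [:1:] u) 0 < e" using D by simp
      qed
    qed
  qed
  from op_poly_uniform_limit[OF EA K this]
  have "(\<lambda>n. op_poly_on E ([:- t, 1:] * p n) A x - op_poly_on E [:1:] A x) \<longlonglongrightarrow> 0" for x
    using bounded_linear.tendsto[OF bounded_linear_blinfun_at, of _ 0 sequentially x]
    by (fastforce simp: blinfun.diff_left)
  then have "(\<lambda>n. (op_poly_on E ([:- t, 1:] * p n) A x - op_poly_on E [:1:] A x) + E x) \<longlonglongrightarrow> 0 + E x" for x
    by (intro tendsto_add tendsto_const)
  then have E: "(\<lambda>n. op_poly_on E ([:- t, 1:] * p n) A x) \<longlonglongrightarrow> E x" for x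
    by (simp only: op_poly_on_const scaleR_one diff_add_cancel add_0)
  have "(\<lambda>n. A (op_poly_on E (p n) A x) - t *\<^sub>R op_poly_on E (p n) A x) \<longlonglongrightarrow> A (R x) - t *\<^sub>R R x"
    by (intro tendsto_intros op_poly_limit_at)
  moreover have "op_poly_on E ([:- t, 1:] * p n) A x = A (op_poly_on E (p n) A x) - t *\<^sub>R op_poly_on E (p n) A x" for n
    unfolding op_poly_on_mult[OF EA] op_poly_on_X[OF EA] op_poly_on_absorb[OF EA] by simp
  ultimately show "A (R x) - t *\<^sub>R R x = E x" using E[of x] LIMSEQ_unique by auto
  have "op_poly_on E ([:- t, 1:] * p n) A x = op_poly_on E (p n) A (A x - t *\<^sub>R E x)" for n
  proof -
    have "op_poly_on E ([:- t, 1:] * p n) A x = op_poly_on E (p n * [:- t, 1:]) A x" by (simp only: mult.commute)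
    then show ?thesis unfolding op_poly_on_mult[OF EA] op_poly_on_X[OF EA] by simp
  qed
  then show "R (A x - t *\<^sub>R E x) = E x"
    using E[of x] op_poly_limit_at[of "A x - t *\<^sub>R E x"] LIMSEQ_unique by auto
qed

end

context
  fixes E A :: "'h::complex_hilbert \<Rightarrow>\<^sub>L 'h" and m M :: real
  assumes EA: "selfadjoint_on E A" and mM: "m < M" and K: "spectral_set E A {m..M}"
begin

lemma bernstein_op_convergent:
  assumes "continuous_on {m..M} f"
  shows "convergent (\<lambda>n. op_poly_on E (bernstein_poly f m M n) A)"
  by (rule op_poly_convergent[OF EA K bernstein_uniform_limit[OF mM assms]])

text \<open>The lower bounds in \<open>spectral_set\<close> say nothing about surjectivity. The
  two-sided inverse that \<open>spectrum_on\<close> asks for is built as a limit of Bernstein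
  polynomials of \<open>1 / (u - t)\<close>.\<close>

lemma real_spectrum_on_subset: "real_spectrum_on E A \<subseteq> {m..M}"
proof (rule ccontr)
  assume "\<not> real_spectrum_on E A \<subseteq> {m..M}"
  then obtain t where t: "complex_of_real t \<in> spectrum_on E A" "t \<notin> {m..M}" by blast
  have cont: "continuous_on {m..M} (\<lambda>u. 1 / (u - t))"
    using t(2) by (intro continuous_intros) auto
  obtain R where R: "(\<lambda>n. op_poly_on E (bernstein_poly (\<lambda>u. 1 / (u - t)) m M n) A) \<longlonglongrightarrow> R"
    using bernstein_op_convergent[OF cont] unfolding convergent_def by blast
  have "operator_on E R" "\<And>x. R (A x - complex_of_real t *\<^sub>C E x) = E x"
    "\<And>x. A (R x) - complex_of_real t *\<^sub>C R x = E x"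
    using op_poly_limit_inverse[OF EA R K _ t(2) bernstein_uniform_limit[OF mM cont]]
      op_poly_limit_operator_on[OF EA R] by (simp_all add: scaleC_of_real)
  then show False using t(1) unfolding spectrum_on_def by blast
qed

lemma bernstein_cfc_on:
  assumes "continuous_on {m..M} f"
  shows "(\<lambda>n. op_poly_on E (bernstein_poly f m M n) A) \<longlonglongrightarrow> cfc_on E f A"
proof -
  obtain B where B: "(\<lambda>n. op_poly_on E (bernstein_poly f m M n) A) \<longlonglongrightarrow> B"
    using bernstein_op_convergent[OF assms] unfolding convergent_def by blast
  moreover have "cfc_on E f A = B"
    by (rule cfc_on_eqI[OF EA uniform_limit_on_subset[OF bernstein_uniform_limit[OF mM assms] real_spectrum_on_subset] B])
  ultimately show ?thesis by simp
qed

lemma cfc_on_norm_diff_le: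
  assumes f: "continuous_on {m..M} f" and p: "\<And>u. u \<in> {m..M} \<Longrightarrow> \<bar>poly p u - f u\<bar> \<le> \<epsilon>" and "\<epsilon> \<ge> 0"
  shows "norm (op_poly_on E p A - cfc_on E f A) \<le> \<epsilon>"
proof (rule field_le_epsilon)
  fix e :: real assume e: "e > 0"
  have "\<forall>\<^sub>F n in sequentially. \<forall>u\<in>{m..M}. dist (poly (bernstein_poly f m M n) u) (f u) < e"
    using bernstein_uniform_limit[OF mM f] e by (rule uniform_limitD)
  then have "\<forall>\<^sub>F n in sequentially. norm (op_poly_on E p A - op_poly_on E (bernstein_poly f m M n) A) \<le> \<epsilon> + e"
  proof eventually_elim
    case (elim n)
    have "norm (op_poly_on E (p - bernstein_poly f m M n) A) \<le> \<epsilon> + e"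
    proof (rule op_poly_norm_le[OF EA K])
      show "\<bar>poly (p - bernstein_poly f m M n) u\<bar> \<le> \<epsilon> + e" if "u \<in> {m..M}" for u
        using elim[rule_format, OF that] p[OF that] unfolding poly_diff dist_real_def by linarith
    qed (use \<open>\<epsilon> \<ge> 0\<close> e in simp)
    moreover have "op_poly_on E (p - bernstein_poly f m M n) A = op_poly_on E p A - op_poly_on E (bernstein_poly f m M n) A"
      by (intro blinfun_eqI) (simp add: op_poly_on_diff blinfun.diff_left)
    ultimately show ?case by simp
  qed
  then show "norm (op_poly_on E p A - cfc_on E f A) \<le> \<epsilon> + e"
    by (intro tendsto_upperbound[OF tendsto_norm[OF tendsto_diff[OF tendsto_const bernstein_cfc_on[OF f]]]]) auto
qed

lemma cfc_on_absorb:
  assumes "continuous_on {m..M} f"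
  shows "E (cfc_on E f A x) = cfc_on E f A x" "cfc_on E f A (E x) = cfc_on E f A x"
  using op_poly_limit_absorb[OF EA bernstein_cfc_on[OF assms]] .

lemma cfc_on_resolvent:
  assumes "0 < m" "s \<ge> 0"
  shows "A (cfc_on E (\<lambda>u. 1 / (u + s)) A x) + s *\<^sub>R cfc_on E (\<lambda>u. 1 / (u + s)) A x = E x"
proof -
  have cont: "continuous_on {m..M} (\<lambda>u. 1 / (u - (- s)))"
    using assms by (intro continuous_intros) auto
  have "- s \<notin> {m..M}" using assms by auto
  from op_poly_limit_inverse(1)[OF EA bernstein_cfc_on[OF cont] K bounded_closed_interval this bernstein_uniform_limit[OF mM cont]]
  show ?thesis by simp
qed

end

text \<open>With \<open>T = A + s\<close> and \<open>y = (P T P)\<^sup>-\<^sup>1 x\<close>, this is \<open>0 \<le> \<langle>T (T\<^sup>-\<^sup>1 x - y), T\<^sup>-\<^sup>1 x - y\<rangle>\<close>.\<close>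

lemma resolvent_compression_le:
  assumes EA: "selfadjoint_on E A" and pos: "\<And>x. 0 \<le> inner (A x) x" and s: "s \<ge> 0"
    and P: "orth_projection P" and EP: "E o\<^sub>L P = P"
    and R: "\<And>x. A (R x) + s *\<^sub>R R x = E x" "\<And>x. E (R x) = R x"
    and Q: "\<And>x. P (A (P (Q x))) + s *\<^sub>R Q x = P x" "\<And>x. P (Q x) = Q x"
  shows "inner (Q x) x \<le> inner (R x) x"
proof -
  note D = selfadjoint_onD[OF EA]
  let ?y = "Q x" and ?z = "R x - Q x"
  have EQ: "E ?y = ?y" using EP Q(2)[of x] by (metis blinfun_apply_blinfun_compose)
  have "0 \<le> inner (A ?z) ?z + s * inner ?z ?z" using pos s by simp
  also have "\<dots> = inner (A (R x) + s *\<^sub>R R x) (R x) - 2 * inner (A (R x) + s *\<^sub>R R x) ?y + inner (A ?y + s *\<^sub>R ?y) ?y"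
    using D(6)[of ?y "R x"]
    by (simp add: blinfun.diff_right inner_diff_left inner_diff_right inner_add_left inner_commute algebra_simps)
  also have "inner (A ?y + s *\<^sub>R ?y) ?y = inner (P x) ?y"
    using Q(1)[of x] orth_projection_inner[OF P, of "A ?y" ?y] unfolding Q(2)
    by (metis inner_add_left Q(2))
  also have "inner (P x) ?y = inner x ?y" using orth_projection_inner[OF P, of x ?y] Q(2) by simp
  also have "inner (A (R x) + s *\<^sub>R R x) (R x) = inner x (R x)" using R D(3)[of x "R x"] by simp
  also have "inner (A (R x) + s *\<^sub>R R x) ?y = inner x ?y" using R EQ D(3)[of x ?y] by simp
  finally show ?thesis by (simp add: inner_commute)
qed

section \<open>From Kwong functions to strong operator convexity\<close>

text \<open>The constant is deliberately weaker than \<open>1 / (m + s)^2\<close>: as a multiple of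
  \<open>1 / (M + s)\<close> it makes the approximation error a multiple of the resolvent function
  at the node \<open>M\<close>.\<close>

lemma resolvent_lipschitz:
  fixes m M s :: real
  assumes m: "0 < m" and s: "s \<ge> 0" and vw: "v \<in> {m..M}" "w \<in> {m..M}"
  shows "\<bar>1 / (v + s) - 1 / (w + s)\<bar> \<le> M / (m\<^sup>2 * (M + s)) * \<bar>v - w\<bar>"
proof -
  have M: "M \<ge> m" using vw by auto
  have le: "m + s \<le> v + s" "m + s \<le> w + s" "0 < m + s" using assms by auto
  have "1 / (v + s) - 1 / (w + s) = (w - v) / ((v + s) * (w + s))"
    using le by (simp add: divide_simps)
  then have "\<bar>1 / (v + s) - 1 / (w + s)\<bar> = \<bar>v - w\<bar> / ((v + s) * (w + s))"
    using le by (simp add: abs_mult)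
  also have "\<dots> \<le> \<bar>v - w\<bar> / ((m + s) * (m + s))"
    using le by (intro divide_left_mono mult_mono mult_pos_pos) auto
  also have "\<dots> \<le> \<bar>v - w\<bar> * (M / (m\<^sup>2 * (M + s)))"
  proof -
    have "m * (M + s) \<le> M * (m + s)" using M s m by (simp add: algebra_simps mult_right_mono)
    then have "(m * (M + s)) * m \<le> (M * (m + s)) * (m + s)"
      by (rule mult_mono) (use m s M in auto)
    then have "1 / ((m + s) * (m + s)) \<le> M / (m\<^sup>2 * (M + s))"
      using m s M le(3) by (simp add: field_simps power2_eq_square add_pos_nonneg)
    then show ?thesis using mult_left_mono[of _ _ "\<bar>v - w\<bar>"] by fastforce
  qed
  finally show ?thesis by (simp add: mult.commute)
qed

text \<open>The bottom of the numerical range lies in the spectrum, hence is positive.\<close>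

lemma spectrum_pos_lower_bound:
  assumes EA: "selfadjoint_on E A" and sp: "spectrum_on E A \<subseteq> complex_of_real ` {0<..}"
  obtains m where "m > 0" "\<And>x. m * (norm (E x))\<^sup>2 \<le> inner (A x) x"
proof (cases "E = 0")
  case True
  then have "A x = 0" for x using selfadjoint_onD(4)[OF EA, of x] by simp
  then show ?thesis using that[of 1] True by simp
next
  case False
  obtain \<mu> where \<mu>: "\<And>x. \<mu> * (norm (E x))\<^sup>2 \<le> inner (A x) x" "\<not> bounded_below_on E (A - \<mu> *\<^sub>R E)"
    using numerical_range_inf[OF EA False] by blast
  then have "\<mu> \<in> real_spectrum_on E A"
    using spectral_set_spectrum unfolding spectral_set_def by blast
  then have "\<mu> > 0" using sp by auto
  then show ?thesis using that \<mu>(1) by blast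
qed

lemma compression_selfadjoint_on:
  fixes P A :: "'h::complex_hilbert \<Rightarrow>\<^sub>L 'h"
  assumes P: "orth_projection P" and A: "selfadjoint A"
  shows "selfadjoint_on P (P o\<^sub>L A o\<^sub>L P)"
proof -
  have s: "selfadjoint P" using P by (simp add: orth_projection_def)
  then have "selfadjoint (P o\<^sub>L A o\<^sub>L P)"
    using A unfolding selfadjoint_def clinear_op_def by simp
  then show ?thesis
    using P orth_projection_idem[OF P] unfolding selfadjoint_on_def operator_on_def selfadjoint_def
    by (auto intro!: blinfun_eqI)
qed

lemma Kwong_imp_cfc_compression_le:
  fixes E A P :: "'h::complex_hilbert \<Rightarrow>\<^sub>L 'h"
  assumes g: "Kwong g" and p: "0 \<le> p" "p \<le> 1 / 2"
    and EA: "selfadjoint_on E A" and sp: "spectrum_on E A \<subseteq> complex_of_real ` {0<..}"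
    and P: "orth_projection P" and EP: "E o\<^sub>L P = P"
  defines "G \<equiv> \<lambda>t. g (t powr p) / t powr p" and "B \<equiv> P o\<^sub>L A o\<^sub>L P"
  shows "inner (P (cfc_on P G B (P x))) x \<le> inner (cfc_on E G A x) x"
proof -
  note D = selfadjoint_onD[OF EA]
  have PB: "selfadjoint_on P B"
    unfolding B_def using P EA by (intro compression_selfadjoint_on) (auto simp: selfadjoint_on_def)
  obtain m where m: "m > 0" "\<And>x. m * (norm (E x))\<^sup>2 \<le> inner (A x) x"
    using spectrum_pos_lower_bound[OF EA sp] by blast
  \<comment> \<open>Above the numerical range, and strictly above \<open>m\<close> so that the
    interval is nondegenerate.\<close>
  define M where "M = norm A + m + 1"
  have mM: "m < M" by (simp add: M_def add_nonneg_pos)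
  have AM: "inner (A x) x \<le> M * (norm (E x))\<^sup>2" for x
  proof -
    have "inner (A x) x = inner (A (E x)) (E x)" by (metis D(3,4,5))
    also have "\<dots> \<le> norm (A (E x)) * norm (E x)" by (rule norm_cauchy_schwarz)
    also have "\<dots> \<le> (norm A * norm (E x)) * norm (E x)"
      by (intro mult_right_mono norm_blinfun) simp
    also have "\<dots> \<le> M * (norm (E x))\<^sup>2"
      using m(1) unfolding M_def power2_eq_square mult.assoc by (intro mult_right_mono) auto
    finally show ?thesis .
  qed
  have EP': "E (P x) = P x" for x using EP by (metis blinfun_apply_blinfun_compose)
  have Bin: "inner (B x) x = inner (A (P x)) (P x)" for x
    unfolding B_def by (simp add: orth_projection_inner[OF P])
  have KA: "spectral_set E A {m..M}" using spectral_set_numerical_range[OF EA m(2) AM] .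
  \<comment> \<open>The numerical range of the compression lies in that of \<open>A\<close>, so one
    interval, and with it one set of nodes, serves both operators.\<close>
  have KB: "spectral_set P B {m..M}"
    using m(2)[of "P _"] AM[of "P _"] by (intro spectral_set_numerical_range[OF PB]) (simp_all add: Bin EP')
  have contg: "continuous_on {0<..} g" using g by (simp add: Kwong_def)
  have "continuous_on {0<..} G"
    unfolding G_def by (intro continuous_on_divide continuous_on_compose_powr contg continuous_intros) auto
  then have contG: "continuous_on {m..M} G"
    by (rule continuous_on_subset) (use m(1) in auto)
  have PxB: "P (cfc_on P f B (P x)) = cfc_on P f B x" if "continuous_on {m..M} f" for f
    using cfc_on_absorb[OF PB mM KB that] by simp
  \<comment> \<open>The mass that the discretized functional puts on the \<open>k\<close>-th
    node.\<close>
  define y where "y n k = inner (op_poly_on E (bernstein_basis m M n k) A x) x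
      - inner (op_poly_on P (bernstein_basis m M n k) B x) x" for n k
  have y: "(\<Sum>k\<le>n. y n k * f (bernstein_node m M n k)) =
      inner (op_poly_on E (bernstein_poly f m M n) A x) x - inner (op_poly_on P (bernstein_poly f m M n) B x) x" for n f
    unfolding y_def op_poly_bernstein inner_sum_left
    by (simp add: sum_subtractf[symmetric] algebra_simps)
  have lim: "(\<lambda>n. \<Sum>k\<le>n. y n k * G (bernstein_node m M n k)) \<longlonglongrightarrow>
      inner (cfc_on E G A x) x - inner (cfc_on P G B x) x"
    unfolding y
    by (intro tendsto_intros op_poly_limit_at[OF EA] op_poly_limit_at[OF PB]
        bernstein_cfc_on[OF EA mM KA contG] bernstein_cfc_on[OF PB mM KB contG])
  \<comment> \<open>Two Bernstein errors of the size given by \<open>bernstein_lipschitz\<close> and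
    \<open>resolvent_lipschitz\<close>, with the factor \<open>1 / (M + s)\<close> taken
    out.\<close>
  define \<eta> where "\<eta> n = 2 * (norm x)\<^sup>2 * (M * (M - m) / m\<^sup>2) / sqrt (real n)" for n
  have \<eta>_nonneg: "\<eta> n \<ge> 0" for n unfolding \<eta>_def using m mM by simp
  have resolvent: "0 \<le> (\<Sum>k\<le>n. y n k * (1 / (bernstein_node m M n k + s))) + \<eta> n * (1 / (M + s))"
    if n: "n > 0" and s: "s \<ge> 0" for n s
  proof -
    let ?f = "\<lambda>u. 1 / (u + s)"
    let ?\<epsilon> = "M / (m\<^sup>2 * (M + s)) * (M - m) / sqrt (real n)"
    have cont: "continuous_on {m..M} ?f" using m s by (intro continuous_intros) auto
    have eps: "?\<epsilon> \<ge> 0" using m mM s by simp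
    have bern: "\<bar>poly (bernstein_poly ?f m M n) u - ?f u\<bar> \<le> ?\<epsilon>" if "u \<in> {m..M}" for u
      using m mM s by (intro bernstein_lipschitz[OF mM n that] resolvent_lipschitz) auto
    have close: "\<bar>inner (X x) x - inner (Y x) x\<bar> \<le> ?\<epsilon> * (norm x)\<^sup>2" if "norm (X - Y) \<le> ?\<epsilon>" for X Y :: "'h \<Rightarrow>\<^sub>L 'h"
    proof -
      have "\<bar>inner ((X - Y) x) x\<bar> \<le> norm ((X - Y) x) * norm x" by (rule Cauchy_Schwarz_ineq2)
      also have "\<dots> \<le> (?\<epsilon> * norm x) * norm x"
        by (intro mult_right_mono order.trans[OF norm_blinfun] that) auto
      finally show ?thesis by (simp add: blinfun.diff_left inner_diff_left power2_eq_square)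
    qed
    have "inner (cfc_on P ?f B x) x \<le> inner (cfc_on E ?f A x) x"
    proof (rule resolvent_compression_le[OF EA _ s P EP])
      show "0 \<le> inner (A x) x" for x using m by (meson mult_nonneg_nonneg less_imp_le order.trans zero_le_power2)
      show "A (cfc_on E ?f A x) + s *\<^sub>R cfc_on E ?f A x = E x" for x
        by (rule cfc_on_resolvent[OF EA mM KA m(1) s])
      show "E (cfc_on E ?f A x) = cfc_on E ?f A x" for x by (rule cfc_on_absorb[OF EA mM KA cont])
      show "P (cfc_on P ?f B x) = cfc_on P ?f B x" for x by (rule cfc_on_absorb[OF PB mM KB cont])
      show "P (A (P (cfc_on P ?f B x))) + s *\<^sub>R cfc_on P ?f B x = P x" for x
        using cfc_on_resolvent[OF PB mM KB m(1) s, of x] unfolding B_def by simp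
    qed
    moreover have "norm (op_poly_on E (bernstein_poly ?f m M n) A - cfc_on E ?f A) \<le> ?\<epsilon>"
      by (rule cfc_on_norm_diff_le[OF EA mM KA cont _ eps]) (rule bern)
    note close[OF this]
    moreover have "norm (op_poly_on P (bernstein_poly ?f m M n) B - cfc_on P ?f B) \<le> ?\<epsilon>"
      by (rule cfc_on_norm_diff_le[OF PB mM KB cont _ eps]) (rule bern)
    note close[OF this]
    ultimately have "0 \<le> (\<Sum>k\<le>n. y n k * ?f (bernstein_node m M n k)) + 2 * (?\<epsilon> * (norm x)\<^sup>2)"
      unfolding y[of n ?f] by linarith
    also have "2 * (?\<epsilon> * (norm x)\<^sup>2) = \<eta> n * (1 / (M + s))"
      unfolding \<eta>_def by (simp add: mult_ac)
    finally show ?thesis .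
  qed
  have discrete: "0 \<le> (\<Sum>k\<le>n. y n k * G (bernstein_node m M n k)) + \<eta> n * G M" if n: "n > 0" for n
  proof -
    let ?c = "bernstein_node m M n"
    \<comment> \<open>The extra mass sits at the last node, which is \<open>M\<close>; there the
      resolvent function is exactly \<open>1 / (M + s)\<close>.\<close>
    define Y where "Y k = y n k + (if k = n then \<eta> n else 0)" for k
    have cn: "?c n = M" using n by (simp add: bernstein_node_def)
    have Y: "(\<Sum>k<Suc n. Y k * f (?c k)) = (\<Sum>k\<le>n. y n k * f (?c k)) + \<eta> n * f M" for f
    proof -
      have "(\<Sum>k\<le>n. Y k * f (?c k)) = (\<Sum>k\<le>n. y n k * f (?c k) + (if k = n then \<eta> n * f M else 0))"
        unfolding Y_def by (intro sum.cong refl) (auto simp: cn algebra_simps)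
      then show ?thesis by (simp only: sum.distrib lessThan_Suc_atMost) simp
    qed
    have cpos: "?c k > 0" if "k < Suc n" for k
      using bernstein_node_bounds[OF mM, of k n] that m(1) by auto
    have c_inj: "inj_on (\<lambda>k. sqrt (?c k)) {..<Suc n}"
      using n mM unfolding bernstein_node_def by (auto simp: inj_on_def)
    \<comment> \<open>At \<open>t = sqrt (?c k)\<close> the test function
      \<open>t / (t^2 + s)\<close> divided by \<open>t\<close> is the resolvent function at
      \<open>?c k\<close>, and the Kwong function divided by \<open>t\<close> is
      \<open>G (?c k)\<close>; hence the masses \<open>Y k / sqrt (?c k)\<close>.\<close>
    have "0 \<le> (\<Sum>k<Suc n. (Y k / sqrt (?c k)) * ((sqrt (?c k)) powr (1 - 2 * p) * g (sqrt (?c k) powr (2 * p))))"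
    proof (rule Kwong_dual[OF Kwong_powr_times_compose[OF g] c_inj])
      show "0 < sqrt (?c k)" if "k < Suc n" for k using cpos[OF that] by simp
      fix s :: real assume s: "s \<ge> 0"
      have "0 \<le> (\<Sum>k<Suc n. Y k * (1 / (?c k + s)))" unfolding Y[of "\<lambda>u. 1 / (u + s)"] by (rule resolvent[OF n s])
      also have "\<dots> = (\<Sum>k<Suc n. (Y k / sqrt (?c k)) * (sqrt (?c k) / ((sqrt (?c k))\<^sup>2 + s)))"
      proof (intro sum.cong refl)
        fix k assume "k \<in> {..<Suc n}"
        then have "?c k > 0" using cpos by auto
        then show "Y k * (1 / (?c k + s)) = (Y k / sqrt (?c k)) * (sqrt (?c k) / ((sqrt (?c k))\<^sup>2 + s))" by simp
      qed
      finally show "0 \<le> (\<Sum>k<Suc n. (Y k / sqrt (?c k)) * (sqrt (?c k) / ((sqrt (?c k))\<^sup>2 + s)))" .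
    qed (use p in auto)
    also have "\<dots> = (\<Sum>k<Suc n. Y k * G (?c k))"
    proof (intro sum.cong refl)
      fix k assume "k \<in> {..<Suc n}"
      then have c: "?c k > 0" using cpos by auto
      have sq: "sqrt (?c k) = ?c k powr (1 / 2)" using c by (simp add: powr_half_sqrt)
      have "sqrt (?c k) powr (2 * p) = ?c k powr p" unfolding sq powr_powr by simp
      moreover have "sqrt (?c k) powr (1 - 2 * p) = sqrt (?c k) / sqrt (?c k) powr (2 * p)"
        using c by (simp add: powr_diff)
      ultimately show "(Y k / sqrt (?c k)) * ((sqrt (?c k)) powr (1 - 2 * p) * g (sqrt (?c k) powr (2 * p))) = Y k * G (?c k)"
        using c by (simp add: G_def)
    qed
    finally show ?thesis unfolding Y .
  qed
  have "(\<lambda>n. \<eta> n * G M) \<longlonglongrightarrow> 0"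
    unfolding \<eta>_def by (intro tendsto_mult_left_zero tendsto_divide_0[OF tendsto_const] filterlim_compose[OF sqrt_at_top] filterlim_real_at_infinity_sequentially filterlim_at_top_imp_at_infinity filterlim_real_sequentially)
  from tendsto_add[OF lim this]
  have "0 \<le> inner (cfc_on E G A x) x - inner (cfc_on P G B x) x + 0"
    by (rule tendsto_lowerbound) (use discrete in \<open>auto intro!: eventually_sequentiallyI[of 1]\<close>)
  then show ?thesis unfolding PxB[OF contG] by simp
qed

lemma SOC_of_Kwong:
  assumes g: "Kwong g" and p: "0 \<le> p" "p \<le> 1 / 2"
  shows "SOC TYPE('k::complex_hilbert) {0<..} (\<lambda>t. g (t powr p) / t powr p)"
  unfolding SOC_def
proof (intro conjI allI impI)
  show "continuous_on {0<..} (\<lambda>t. g (t powr p) / t powr p)"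
    using g unfolding Kwong_def
    by (intro continuous_on_divide continuous_on_compose_powr continuous_intros) auto
next
  fix E A P :: "'k \<Rightarrow>\<^sub>L 'k"
  assume H: "orth_projection E \<and> operator_on E A \<and> selfadjoint A \<and> spectrum_on E A \<subseteq> complex_of_real ` {0<..} \<and>
    orth_projection P \<and> E o\<^sub>L P = P"
  then have "selfadjoint_on E A" by (simp add: selfadjoint_on_def)
  from Kwong_imp_cfc_compression_le[OF g p this] H
  show "op_le (P o\<^sub>L cfc_on P (\<lambda>t. g (t powr p) / t powr p) (P o\<^sub>L A o\<^sub>L P) o\<^sub>L P)
      (cfc_on E (\<lambda>t. g (t powr p) / t powr p) A)"
    unfolding op_le_def inner_eq_Re_cinner[symmetric] by (simp add: blinfun.diff_left inner_diff_left)
qed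

section \<open>Diagonal operators\<close>

lemma cinner_sum_left: "cinner (\<Sum>i\<in>I. f i) (y :: 'a::complex_inner) = (\<Sum>i\<in>I. cinner (f i) y)"
  using cinner_scaleR_left[of 0 "0 :: 'a" y]
  by (induction I rule: infinite_finite_induct) (simp_all add: cinner_add_left)

lemma cinner_sum_right: "cinner (y :: 'a::complex_inner) (\<Sum>i\<in>I. f i) = (\<Sum>i\<in>I. cinner y (f i))"
  using cinner_scaleR_right[of y 0 "0 :: 'a"]
  by (induction I rule: infinite_finite_induct) (simp_all add: cinner_add_right)

lemma cinner_cauchy_schwarz: "cmod (cinner x y) \<le> norm x * norm (y :: 'a::complex_inner)"
proof (cases "cinner x y = 0")
  case False
  \<comment> \<open>A unimodular factor that makes the inner product real and nonnegative.\<close>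
  let ?c = "cnj (sgn (cinner x y))"
  have "cinner (?c *\<^sub>C x) y = of_real (cmod (cinner x y))"
    unfolding cinner_scaleC_left using False
    by (simp add: sgn_div_norm scaleR_conv_of_real complex_norm_square[symmetric] power2_eq_square field_simps)
  then have "cmod (cinner x y) = inner (?c *\<^sub>C x) y" by (simp add: inner_eq_Re_cinner)
  also have "\<dots> \<le> norm (?c *\<^sub>C x) * norm y" by (rule norm_cauchy_schwarz)
  also have "norm (?c *\<^sub>C x) = norm x" using False by (simp add: norm_scaleC norm_sgn)
  finally show ?thesis .
qed simp

lemma bounded_linear_rank_one:
  "bounded_linear (\<lambda>x. (c * cinner x f) *\<^sub>C (f :: 'a::complex_inner))"
proof (rule bounded_linear_intro)
  show "norm ((c * cinner x f) *\<^sub>C f) \<le> norm x * (cmod c * norm f * norm f)" for x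
    using mult_left_mono[OF cinner_cauchy_schwarz[of x f], of "cmod c * norm f"]
    by (simp add: norm_scaleC norm_mult mult_ac)
  show "(c * cinner (x + y) f) *\<^sub>C f = (c * cinner x f) *\<^sub>C f + (c * cinner y f) *\<^sub>C f" for x y
    by (simp add: cinner_add_left distrib_left scaleC_add_left)
  show "(c * cinner (r *\<^sub>R x) f) *\<^sub>C f = r *\<^sub>R ((c * cinner x f) *\<^sub>C f)" for r x
  proof -
    have "c * cinner (r *\<^sub>R x) f = of_real r * (c * cinner x f)" by (simp add: cinner_scaleR_left)
    then show ?thesis by (simp only: scaleC_scaleC[symmetric] scaleC_of_real)
  qed
qed

text \<open>For orthonormal \<open>f\<close> and \<open>d = 1\<close> this is the projection onto
  the span of \<open>f\<close>, so the unit \<open>E\<close>, the operator \<open>A\<close> and the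
  projection \<open>P\<close> of the test configuration all take this form.\<close>

definition diag_op :: "nat \<Rightarrow> (nat \<Rightarrow> 'h::complex_hilbert) \<Rightarrow> (nat \<Rightarrow> complex) \<Rightarrow> 'h \<Rightarrow>\<^sub>L 'h" where
  "diag_op n f d = (\<Sum>k<n. Blinfun (\<lambda>x. (d k * cinner x (f k)) *\<^sub>C f k))"

definition orthonormal :: "nat \<Rightarrow> (nat \<Rightarrow> 'h::complex_inner) \<Rightarrow> bool" where
  "orthonormal n f \<longleftrightarrow> (\<forall>i<n. \<forall>j<n. cinner (f i) (f j) = (if i = j then 1 else 0))"

lemma diag_op_apply: "diag_op n f d x = (\<Sum>k<n. (d k * cinner x (f k)) *\<^sub>C f k)"
  unfolding diag_op_def by (simp add: blinfun.sum_left bounded_linear_Blinfun_apply[OF bounded_linear_rank_one])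

lemma diag_op_scaleC: "diag_op n f d (c *\<^sub>C x) = c *\<^sub>C diag_op n f d x"
  unfolding diag_op_apply complex_vector.scale_sum_right
  by (intro sum.cong refl) (simp add: cinner_scaleC_left scaleC_scaleC mult_ac)

lemma diag_op_add: "diag_op n f (\<lambda>k. d k + e k) x = diag_op n f d x + diag_op n f e x"
  unfolding diag_op_apply by (simp add: distrib_right scaleC_add_left sum.distrib)

lemma diag_op_smult: "diag_op n f (\<lambda>k. c * d k) x = c *\<^sub>C diag_op n f d x"
  unfolding diag_op_apply complex_vector.scale_sum_right
  by (intro sum.cong refl) (simp add: scaleC_scaleC mult_ac)

lemma cinner_diag_op: "cinner (diag_op n f d x) y = (\<Sum>k<n. d k * cinner x (f k) * cnj (cinner y (f k)))"
  unfolding diag_op_apply cinner_sum_left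
  by (intro sum.cong refl) (metis cinner_commute cinner_scaleC_left)

lemma diag_op_selfadjoint: "selfadjoint (diag_op n f (\<lambda>k. complex_of_real (d k)))"
proof -
  have "cinner (diag_op n f (\<lambda>k. complex_of_real (d k)) x) y = cinner x (diag_op n f (\<lambda>k. complex_of_real (d k)) y)" for x y
  proof -
    have "cinner x (diag_op n f (\<lambda>k. complex_of_real (d k)) y) = cnj (cinner (diag_op n f (\<lambda>k. complex_of_real (d k)) y) x)"
      by (rule cinner_commute)
    then show ?thesis unfolding cinner_diag_op by (simp add: mult_ac)
  qed
  then show ?thesis unfolding selfadjoint_def clinear_op_def by (simp add: diag_op_scaleC)
qed

context
  fixes n :: nat and f :: "nat \<Rightarrow> 'h::complex_hilbert"
  assumes orth: "orthonormal n f"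
begin

lemma cinner_diag_op_basis: "j < n \<Longrightarrow> cinner (diag_op n f d x) (f j) = d j * cinner x (f j)"
proof -
  assume j: "j < n"
  have "cinner (diag_op n f d x) (f j) = (\<Sum>k<n. if k = j then d j * cinner x (f j) else 0)"
    unfolding cinner_diag_op using orth j by (intro sum.cong refl) (auto simp: orthonormal_def)
  then show ?thesis using j by simp
qed

lemma diag_op_mult: "diag_op n f d (diag_op n f e x) = diag_op n f (\<lambda>k. d k * e k) x"
  unfolding diag_op_apply[of n f d] diag_op_apply[of n f "\<lambda>k. d k * e k"]
  by (intro sum.cong refl) (simp add: cinner_diag_op_basis mult.assoc)

lemma diag_op_orth_projection: "orth_projection (diag_op n f (\<lambda>_. 1))"
  using diag_op_selfadjoint[of n f "\<lambda>_. 1"]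
  unfolding orth_projection_def by (auto intro!: blinfun_eqI simp: diag_op_mult)

lemma diag_op_operator_on: "operator_on (diag_op n f (\<lambda>_. 1)) (diag_op n f d)"
  unfolding operator_on_def clinear_op_def by (auto intro!: blinfun_eqI simp: diag_op_mult diag_op_scaleC)

lemma diag_op_selfadjoint_on: "selfadjoint_on (diag_op n f (\<lambda>_. 1)) (diag_op n f (\<lambda>k. complex_of_real (d k)))"
  unfolding selfadjoint_on_def
  by (intro conjI diag_op_orth_projection diag_op_operator_on diag_op_selfadjoint)

lemma diag_op_spectrum: "spectrum_on (diag_op n f (\<lambda>_. 1)) (diag_op n f d) \<subseteq> d ` {..<n}"
proof
  fix z assume z: "z \<in> spectrum_on (diag_op n f (\<lambda>_. 1)) (diag_op n f d)"
  show "z \<in> d ` {..<n}"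
  proof (rule ccontr)
    assume nz: "z \<notin> d ` {..<n}"
    let ?R = "diag_op n f (\<lambda>k. 1 / (d k - z))"
    have eq: "diag_op n f d x - z *\<^sub>C diag_op n f e x = diag_op n f (\<lambda>k. d k - z * e k) x" for e x
      using diag_op_add[of n f d "\<lambda>k. (- z) * e k" x] diag_op_smult[of n f "- z" e x] by simp
    have one: "diag_op n f (\<lambda>k. 1 / (d k - z) * (d k - z)) x = diag_op n f (\<lambda>_. 1) x" for x
      using nz unfolding diag_op_apply by (intro sum.cong refl) auto
    have "?R (diag_op n f d x - z *\<^sub>C diag_op n f (\<lambda>_. 1) x) = diag_op n f (\<lambda>_. 1) x" for x
      unfolding eq diag_op_mult using one by simp
    moreover have "diag_op n f d (?R x) - z *\<^sub>C ?R x = diag_op n f (\<lambda>_. 1) x" for x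
    proof -
      have "z *\<^sub>C ?R x = diag_op n f (\<lambda>k. z * (1 / (d k - z))) x" by (rule diag_op_smult[symmetric])
      moreover have "diag_op n f d (?R x) = diag_op n f (\<lambda>k. d k * (1 / (d k - z))) x" by (rule diag_op_mult)
      moreover have "diag_op n f (\<lambda>k. d k * (1 / (d k - z))) x =
          diag_op n f (\<lambda>_. 1) x + diag_op n f (\<lambda>k. z * (1 / (d k - z))) x"
        unfolding diag_op_add[symmetric] unfolding diag_op_apply
      proof (intro sum.cong refl)
        fix k assume "k \<in> {..<n}"
        then have "d k - z \<noteq> 0" using nz by auto
        then have "d k * (1 / (d k - z)) = 1 + z * (1 / (d k - z))" by (simp add: field_simps)
        then show "(d k * (1 / (d k - z)) * cinner x (f k)) *\<^sub>C f k = ((1 + z * (1 / (d k - z))) * cinner x (f k)) *\<^sub>C f k"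
          by simp
      qed
      ultimately show ?thesis by simp
    qed
    ultimately show False using z diag_op_operator_on unfolding spectrum_on_def by blast
  qed
qed

lemma op_poly_diag_op:
  "op_poly_on (diag_op n f (\<lambda>_. 1)) p (diag_op n f (\<lambda>k. complex_of_real (d k))) =
    diag_op n f (\<lambda>k. complex_of_real (poly p (d k)))"
proof (rule blinfun_eqI)
  fix x
  show "op_poly_on (diag_op n f (\<lambda>_. 1)) p (diag_op n f (\<lambda>k. complex_of_real (d k))) x =
      diag_op n f (\<lambda>k. complex_of_real (poly p (d k))) x"
  proof (induction p)
    case 0
    then show ?case by (simp add: diag_op_apply)
  next
    case (pCons a p)
    have "op_poly_on (diag_op n f (\<lambda>_. 1)) (pCons a p) (diag_op n f (\<lambda>k. complex_of_real (d k))) x =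
        complex_of_real a *\<^sub>C diag_op n f (\<lambda>_. 1) x +
        diag_op n f (\<lambda>k. complex_of_real (d k)) (diag_op n f (\<lambda>k. complex_of_real (poly p (d k))) x)"
      unfolding op_poly_on_pCons pCons.IH scaleC_of_real ..
    also have "\<dots> = diag_op n f (\<lambda>k. complex_of_real (poly (pCons a p) (d k))) x"
      unfolding diag_op_smult[symmetric] diag_op_mult diag_op_add[symmetric] by simp
    finally show ?case .
  qed
qed

text \<open>The spectrum is finite, so one polynomial interpolating \<open>g\<close> there serves as
  a constant approximating sequence.\<close>

lemma cfc_on_diag_op:
  "cfc_on (diag_op n f (\<lambda>_. 1)) g (diag_op n f (\<lambda>k. complex_of_real (d k))) =
    diag_op n f (\<lambda>k. complex_of_real (g (d k)))"
proof -
  let ?A = "diag_op n f (\<lambda>k. complex_of_real (d k))" and ?E = "diag_op n f (\<lambda>_. 1)"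
  obtain p where p: "\<And>x. x \<in> d ` {..<n} \<Longrightarrow> poly p x = g x"
    using poly_interpolation_exists[of "d ` {..<n}" g] by blast
  have "real_spectrum_on ?E ?A \<subseteq> d ` {..<n}"
    using diag_op_spectrum[of "\<lambda>k. complex_of_real (d k)"] by (force simp: image_iff)
  then have "uniform_limit (real_spectrum_on ?E ?A) (\<lambda>_. poly p) g sequentially"
    using p by (intro uniform_limitI) (auto intro!: always_eventually)
  moreover have "op_poly_on ?E p ?A = diag_op n f (\<lambda>k. complex_of_real (g (d k)))"
  proof (rule blinfun_eqI)
    fix x
    show "op_poly_on ?E p ?A x = diag_op n f (\<lambda>k. complex_of_real (g (d k))) x"
      unfolding op_poly_diag_op diag_op_apply using p by (intro sum.cong refl) auto
  qed
  ultimately show ?thesis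
    by (intro cfc_on_eqI[OF diag_op_selfadjoint_on, of "\<lambda>_. p"]) auto
qed

end

section \<open>Test configurations as real matrices\<close>

lemma orthonormal_exists:
  assumes "infinite_dimensional TYPE('h::complex_hilbert)"
  shows "\<exists>e :: nat \<Rightarrow> 'h. orthonormal n e"
proof (induction n)
  case (Suc n)
  then obtain e :: "nat \<Rightarrow> 'h" where e: "orthonormal n e" by blast
  have "complex_vector.span (e ` {..<n}) \<noteq> UNIV"
    using assms unfolding infinite_dimensional_def by blast
  then obtain x where x: "x \<notin> complex_vector.span (e ` {..<n})" by blast
  define y where "y = x - diag_op n e (\<lambda>_. 1) x"
  have "diag_op n e (\<lambda>_. 1) x \<in> complex_vector.span (e ` {..<n})"
    unfolding diag_op_apply
    by (intro complex_vector.span_sum complex_vector.span_scale complex_vector.span_base) auto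
  then have y0: "y \<noteq> 0" using x unfolding y_def by auto
  have perp: "cinner y (e j) = 0" if "j < n" for j
  proof -
    have "x = y + diag_op n e (\<lambda>_. 1) x" by (simp add: y_def)
    then have "cinner x (e j) = cinner y (e j) + cinner (diag_op n e (\<lambda>_. 1) x) (e j)"
      by (metis cinner_add_left)
    then show ?thesis using cinner_diag_op_basis[OF e that, of "\<lambda>_. 1" x] by simp
  qed
  define u where "u = (1 / norm y) *\<^sub>R y"
  have uu: "cinner u u = 1"
    unfolding u_def cinner_scaleR_left cinner_scaleR_right cinner_self using y0
    by (simp add: power2_eq_square)
  have ue: "cinner u (e j) = 0" "cinner (e j) u = 0" if "j < n" for j
    using perp[OF that] cinner_commute[of "e j" u] by (simp_all add: u_def cinner_scaleR_left)
  have "orthonormal (Suc n) (e(n := u))"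
    using e uu ue unfolding orthonormal_def by (auto simp: less_Suc_eq)
  then show ?case by blast
qed (simp add: orthonormal_def)

text \<open>The rows of \<open>W\<close> are the coordinates, in the eigenbasis of \<open>A\<close>,
  of orthonormal vectors spanning the range of \<open>P\<close>; \<open>cW\<close> says that they
  diagonalize the compression with eigenvalues \<open>a i\<close>. Infinite dimension enters through
  the orthonormal system of length \<open>N\<close>.\<close>

lemma SOC_matrix:
  fixes c a x :: "nat \<Rightarrow> real" and W :: "nat \<Rightarrow> nat \<Rightarrow> real"
  assumes inf: "infinite_dimensional TYPE('h::complex_hilbert)" and soc: "SOC TYPE('h) {0<..} g"
    and c: "\<And>k. k < N \<Longrightarrow> 0 < c k"
    and W: "\<And>i j. i < n \<Longrightarrow> j < n \<Longrightarrow> (\<Sum>k<N. W i k * W j k) = (if i = j then 1 else 0)"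
    and cW: "\<And>i j. i < n \<Longrightarrow> j < n \<Longrightarrow> (\<Sum>k<N. c k * W i k * W j k) = (if i = j then a i else 0)"
  shows "(\<Sum>i<n. g (a i) * (\<Sum>k<N. W i k * x k)\<^sup>2) \<le> (\<Sum>k<N. g (c k) * (x k)\<^sup>2)"
proof -
  obtain e :: "nat \<Rightarrow> 'h" where e: "orthonormal N e" using orthonormal_exists[OF inf] by blast
  have vec: "cinner (\<Sum>k<N. u k *\<^sub>R e k) (e j) = of_real (u j)" if "j < N" for u :: "nat \<Rightarrow> real" and j
  proof -
    have "cinner (\<Sum>k<N. u k *\<^sub>R e k) (e j) = (\<Sum>k<N. if k = j then of_real (u j) else 0)"
      unfolding cinner_sum_left cinner_scaleR_left using e that
      by (intro sum.cong refl) (auto simp: orthonormal_def)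
    then show ?thesis using that by simp
  qed
  have vecs: "cinner (\<Sum>k<N. u k *\<^sub>R e k) (\<Sum>k<N. v k *\<^sub>R e k) = of_real (\<Sum>k<N. u k * v k)" for u v :: "nat \<Rightarrow> real"
    unfolding cinner_sum_right[of _ "\<lambda>k. v k *\<^sub>R e k"] cinner_scaleR_right of_real_sum
    by (intro sum.cong refl) (simp add: vec)
  define w where "w i = (\<Sum>k<N. W i k *\<^sub>R e k)" for i
  have w: "orthonormal n w"
    unfolding orthonormal_def w_def vecs using W by simp
  let ?E = "diag_op N e (\<lambda>_. 1)" and ?A = "diag_op N e (\<lambda>k. complex_of_real (c k))"
  let ?P = "diag_op n w (\<lambda>_. 1)"
  have comb: "diag_op N e (\<lambda>k. complex_of_real (d k)) (\<Sum>k<N. u k *\<^sub>R e k) = (\<Sum>k<N. (d k * u k) *\<^sub>R e k)" for d u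
    unfolding diag_op_apply
  proof (intro sum.cong refl)
    fix k assume "k \<in> {..<N}"
    then have "complex_of_real (d k) * cinner (\<Sum>k<N. u k *\<^sub>R e k) (e k) = complex_of_real (d k * u k)"
      using vec[of k u] by simp
    then show "(complex_of_real (d k) * cinner (\<Sum>k<N. u k *\<^sub>R e k) (e k)) *\<^sub>C e k = (d k * u k) *\<^sub>R e k"
      by (simp only: scaleC_of_real)
  qed
  have Ew: "?E (w i) = w i" for i
    using comb[of "\<lambda>_. 1" "W i"] by (simp add: w_def)
  have "?E o\<^sub>L ?P = ?P"
  proof (rule blinfun_eqI)
    fix y
    show "(?E o\<^sub>L ?P) y = ?P y"
      by (simp add: diag_op_apply[of n w] blinfun.sum_right diag_op_scaleC Ew)
  qed
  moreover have "?P o\<^sub>L ?A o\<^sub>L ?P = diag_op n w (\<lambda>i. complex_of_real (a i))"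
  proof (rule blinfun_eqI)
    fix y
    have PAw: "?P (?A (w i)) = of_real (a i) *\<^sub>C w i" if i: "i < n" for i
    proof -
      have "?P (?A (w i)) = (\<Sum>j<n. if j = i then of_real (a i) *\<^sub>C w i else 0)"
        unfolding w_def comb diag_op_apply[of n] vecs
        using cW[OF i] i by (intro sum.cong refl) auto
      then show ?thesis using i by simp
    qed
    have "?P (?A (?P y)) = (\<Sum>i<n. cinner y (w i) *\<^sub>C ?P (?A (w i)))"
      unfolding diag_op_apply[of n w "\<lambda>_. 1" y] by (simp add: blinfun.sum_right diag_op_scaleC)
    also have "\<dots> = diag_op n w (\<lambda>i. complex_of_real (a i)) y"
      unfolding diag_op_apply[of n w "\<lambda>i. complex_of_real (a i)"]
      by (intro sum.cong refl) (simp add: PAw scaleC_scaleC mult.commute)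
    finally show "(?P o\<^sub>L ?A o\<^sub>L ?P) y = diag_op n w (\<lambda>i. complex_of_real (a i)) y" by simp
  qed
  moreover have "spectrum_on ?E ?A \<subseteq> complex_of_real ` {0<..}"
    using diag_op_spectrum[OF e, of "\<lambda>k. complex_of_real (c k)"] c by force
  ultimately have "op_le (?P o\<^sub>L cfc_on ?P g (diag_op n w (\<lambda>i. complex_of_real (a i))) o\<^sub>L ?P) (cfc_on ?E g ?A)"
    using soc diag_op_orth_projection[OF e] diag_op_orth_projection[OF w] diag_op_operator_on[OF e]
      diag_op_selfadjoint[of N e c] unfolding SOC_def by metis
  then have le: "op_le (?P o\<^sub>L diag_op n w (\<lambda>i. complex_of_real (g (a i))) o\<^sub>L ?P) (diag_op N e (\<lambda>k. complex_of_real (g (c k))))"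
    unfolding cfc_on_diag_op[OF e] cfc_on_diag_op[OF w] .
  let ?x = "\<Sum>k<N. x k *\<^sub>R e k"
  have "Re (cinner (diag_op n w (\<lambda>i. complex_of_real (g (a i))) X) X) \<le>
      Re (cinner (diag_op N e (\<lambda>k. complex_of_real (g (c k))) X) X)" for X
  proof -
    have "0 \<le> inner ((diag_op N e (\<lambda>k. complex_of_real (g (c k))) -
        (?P o\<^sub>L diag_op n w (\<lambda>i. complex_of_real (g (a i))) o\<^sub>L ?P)) X) X"
      using le unfolding op_le_def inner_eq_Re_cinner by blast
    moreover have "(?P o\<^sub>L diag_op n w (\<lambda>i. complex_of_real (g (a i))) o\<^sub>L ?P) X =
        diag_op n w (\<lambda>i. complex_of_real (g (a i))) X"
      by (simp add: diag_op_mult[OF w])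
    ultimately show ?thesis
      unfolding inner_eq_Re_cinner[symmetric] blinfun.diff_left inner_diff_left by simp
  qed
  note this[of ?x]
  moreover have "cinner (diag_op n w (\<lambda>i. complex_of_real (g (a i))) ?x) ?x = of_real (\<Sum>i<n. g (a i) * (\<Sum>k<N. W i k * x k)\<^sup>2)"
    unfolding cinner_diag_op w_def vecs of_real_sum
    by (intro sum.cong refl) (simp add: power2_eq_square mult_ac)
  moreover have "cinner (diag_op N e (\<lambda>k. complex_of_real (g (c k))) ?x) ?x = of_real (\<Sum>k<N. g (c k) * (x k)\<^sup>2)"
    unfolding comb vecs by (simp add: power2_eq_square mult.assoc)
  ultimately show ?thesis by (simp only: Re_complex_of_real)
qed

section \<open>From strong operator convexity to Kwong functions\<close>

text \<open>Take \<open>A\<close> diagonal with eigenvalues \<open>b\<^sub>k\<close> and \<open>s\<close> (together the \<open>c\<^sub>k\<close>), and let \<open>P\<close> project onto the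
  complement of \<open>v\<close> with \<open>v\<^sub>k\<^sup>2 = \<alpha>\<^sub>k\<close>, where \<open>\<alpha>\<^sub>k\<close> is the residue at \<open>c\<^sub>k\<close> of
  \<open>\<Prod>\<^sub>i (x - a\<^sub>i) / \<Prod>\<^sub>k (x - c\<^sub>k)\<close>. Then \<open>P A P\<close> has the eigenvectors \<open>(A - a\<^sub>i)\<^sup>-\<^sup>1 v\<close> with eigenvalues \<open>a\<^sub>i\<close>.
  The last three order assumptions express that the \<open>a\<^sub>i\<close> interlace the \<open>c\<^sub>k\<close>, without sorting them.\<close>

lemma SOC_mixed_loewner_form:
  fixes a b :: "nat \<Rightarrow> real" and s :: real and r :: "real poly"
  assumes inf: "infinite_dimensional TYPE('h::complex_hilbert)" and soc: "SOC TYPE('h) {0<..} g"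
    and deg: "degree r < n" and bpos: "\<And>i. i < n \<Longrightarrow> 0 < b i" and spos: "0 < s"
    and inj: "inj_on a {..<n}"
    and pairs: "\<And>i. i < n \<Longrightarrow> 0 < (b i - a i) * (b i - s)"
    and cross: "\<And>i k. i < n \<Longrightarrow> k < n \<Longrightarrow> k \<noteq> i \<Longrightarrow> 0 < (b k - a i) * (b k - b i)"
    and outer: "\<And>i. i < n \<Longrightarrow> 0 < (s - a i) * (s - b i)"
  defines "\<eta> \<equiv> \<lambda>i. poly r (a i) / (\<Prod>j\<in>{..<n}-{i}. a i - a j)"
    and "\<xi> \<equiv> \<lambda>k. poly r (b k) / (\<Prod>l\<in>{..<n}-{k}. b k - b l)"
  shows "0 \<le> (\<Sum>k<n. \<Sum>i<n. \<xi> k * \<eta> i * (((b k - s) * g (b k) - (a i - s) * g (a i)) / (b k - a i)))"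
proof -
  \<comment> \<open>The additional eigenvalue \<open>s\<close> sits at index \<open>n\<close>, one
    past the \<open>b k\<close>.\<close>
  define c where "c k = (if k < n then b k else s)" for k
  define D where "D k = (\<Prod>l\<in>{..<Suc n}-{k}. c k - c l)" for k
  define \<alpha> where "\<alpha> k = (\<Prod>i<n. c k - a i) / D k" for k
  have cb: "c k = b k" if "k < n" for k using that by (simp add: c_def)
  have cn: "c n = s" by (simp add: c_def)
  have b_inj: "inj_on b {..<n}"
  proof (rule inj_onI)
    fix k i assume "k \<in> {..<n}" "i \<in> {..<n}" "b k = b i"
    then show "k = i" using cross[of i k] by auto
  qed
  have ab: "b k \<noteq> a i" if "k < n" "i < n" for k i
    using pairs[of i] cross[of i k] that by (cases "k = i") auto
  have bs: "b k \<noteq> s" and as: "a k \<noteq> s" if "k < n" for k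
    using outer[OF that] by auto
  have ac: "a i \<noteq> c k" if "i < n" for i k
    using ab[of k i] as[OF that] that unfolding c_def by auto
  have c_inj: "inj_on c {..<Suc n}"
    using b_inj bs unfolding inj_on_def c_def by (auto simp: less_Suc_eq)
  have D: "D k = (b k - s) * (\<Prod>l\<in>{..<n}-{k}. b k - b l)" if "k < n" for k
  proof -
    have "{..<Suc n} - {k} = insert n ({..<n} - {k})" using that by auto
    then have "D k = (c k - c n) * (\<Prod>l\<in>{..<n}-{k}. c k - c l)" unfolding D_def by simp
    also have "(\<Prod>l\<in>{..<n}-{k}. c k - c l) = (\<Prod>l\<in>{..<n}-{k}. b k - b l)"
      using that by (intro prod.cong refl) (simp add: c_def)
    finally show ?thesis using that by (simp add: cb cn)
  qed
  \<comment> \<open>The order assumptions make each quotient of matching factors positive, so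
    \<alpha> can serve as the squared coordinates of \<open>v\<close>.\<close>
  have \<alpha>: "\<alpha> k > 0" if "k < Suc n" for k
  proof (cases "k = n")
    case True
    have "D k = (\<Prod>i<n. s - b i)"
      unfolding D_def True by (intro prod.cong) (auto simp: c_def)
    then have "\<alpha> k = (\<Prod>i<n. (s - a i) / (s - b i))"
      unfolding \<alpha>_def True cn by (simp add: prod_dividef)
    also have "\<dots> > 0"
      using outer by (intro prod_pos) (auto simp: zero_less_divide_iff zero_less_mult_iff)
    finally show ?thesis .
  next
    case False
    then have k: "k < n" using that by simp
    have "(\<Prod>i<n. b k - a i) = (b k - a k) * (\<Prod>i\<in>{..<n}-{k}. b k - a i)"
      using k by (intro prod.remove) auto
    then have "\<alpha> k = (b k - a k) / (b k - s) * (\<Prod>i\<in>{..<n}-{k}. (b k - a i) / (b k - b i))"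
      unfolding \<alpha>_def D[OF k] cb[OF k] by (simp add: prod_dividef)
    also have "\<dots> > 0"
    proof (intro mult_pos_pos prod_pos ballI)
      show "(b k - a k) / (b k - s) > 0" using pairs[OF k] by (auto simp: zero_less_divide_iff zero_less_mult_iff)
      show "0 < (b k - a i) / (b k - b i)" if "i \<in> {..<n} - {k}" for i
        using cross[of i k] that k by (auto simp: zero_less_divide_iff zero_less_mult_iff)
    qed
    finally show ?thesis .
  qed
  have flip: "y / ((a i - c k) * z) = - (y / ((c k - a i) * z))" for y z i k
    by (metis minus_diff_eq minus_divide_right mult_minus_left)
  \<comment> \<open>The numerator has degree \<open>n\<close>, below the number \<open>n + 1\<close>
    of nodes, and vanishes at \<open>a i\<close>. This is the secular equation:
    \<open>(A - a i)^-1 v\<close> is orthogonal to \<open>v\<close>.\<close>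
  have sum1: "(\<Sum>k<Suc n. \<alpha> k / (c k - a i)) = 0" if i: "i < n" for i
  proof -
    let ?f = "\<Prod>j<n. [:- a j, 1:]"
    have "degree ?f \<le> n"
      using degree_prod_sum_le[of "{..<n}" "\<lambda>j. [:- a j, 1:]"] by (simp add: o_def)
    then have "(\<Sum>k<Suc n. poly ?f (c k) / ((a i - c k) * (\<Prod>l\<in>{..<Suc n}-{k}. c k - c l))) =
        poly ?f (a i) / (\<Prod>l<Suc n. a i - c l)"
      by (intro lagrange_partial_fractions[OF _ c_inj]) (use ac[OF i] in auto)
    moreover have "poly ?f (a i) = 0" using i by (auto simp: poly_prod)
    moreover have "poly ?f (c k) / ((a i - c k) * (\<Prod>l\<in>{..<Suc n}-{k}. c k - c l)) = - (\<alpha> k / (c k - a i))" for k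
      unfolding \<alpha>_def D_def[symmetric] flip by (simp add: poly_prod mult.commute)
    ultimately show ?thesis by (simp add: sum_negf)
  qed
  \<comment> \<open>Removing the factor of \<open>a i\<close> from the numerator evaluates the
    squared norm of \<open>(A - a i)^-1 v\<close>.\<close>
  have sum2: "(\<Sum>k<Suc n. \<alpha> k / (c k - a i)\<^sup>2) = - (\<Prod>j\<in>{..<n}-{i}. a i - a j) / (\<Prod>l<Suc n. a i - c l)" if i: "i < n" for i
  proof -
    let ?f = "\<Prod>j\<in>{..<n}-{i}. [:- a j, 1:]"
    have "degree ?f \<le> n - 1"
      using degree_prod_sum_le[of "{..<n}-{i}" "\<lambda>j. [:- a j, 1:]"] i by (simp add: o_def)
    then have "(\<Sum>k<Suc n. poly ?f (c k) / ((a i - c k) * (\<Prod>l\<in>{..<Suc n}-{k}. c k - c l))) =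
        poly ?f (a i) / (\<Prod>l<Suc n. a i - c l)"
      by (intro lagrange_partial_fractions[OF _ c_inj]) (use ac[OF i] in auto)
    moreover have "poly ?f (a i) = (\<Prod>j\<in>{..<n}-{i}. a i - a j)" by (simp add: poly_prod)
    moreover have "poly ?f (c k) / ((a i - c k) * (\<Prod>l\<in>{..<Suc n}-{k}. c k - c l)) = - (\<alpha> k / (c k - a i)\<^sup>2)" for k
    proof -
      have "(\<Prod>j<n. c k - a j) = (c k - a i) * (\<Prod>j\<in>{..<n}-{i}. c k - a j)"
        using i by (intro prod.remove) auto
      then have "poly ?f (c k) = (\<Prod>j<n. c k - a j) / (c k - a i)"
        using ac[OF i, of k] by (simp add: poly_prod)
      then show ?thesis
        unfolding \<alpha>_def D_def[symmetric] flip by (simp add: power2_eq_square mult_ac)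
    qed
    ultimately show ?thesis by (simp only: sum_negf)
  qed
  \<comment> \<open>Normalizes \<open>(A - a i)^-1 v\<close>; the unit vectors obtained have the
    coordinates \<open>W i k\<close>.\<close>
  define \<beta> where "\<beta> i = 1 / (\<Sum>k<Suc n. \<alpha> k / (c k - a i)\<^sup>2)" for i
  have \<beta>: "\<beta> i > 0" if i: "i < n" for i
    unfolding \<beta>_def
  proof (intro divide_pos_pos sum_pos)
    fix k assume "k \<in> {..<Suc n}"
    then show "\<alpha> k > 0" using \<alpha> by simp
    show "(c k - a i)\<^sup>2 > 0" using ac[OF i, of k] by simp
  qed auto
  define W where "W i k = sqrt (\<alpha> k) * sqrt (\<beta> i) / (c k - a i)" for i k
  have WW: "W i k * W j k = sqrt (\<beta> i) * sqrt (\<beta> j) * (\<alpha> k / ((c k - a i) * (c k - a j)))" if "k < Suc n" for i j k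
  proof -
    have "W i k * W j k = (sqrt (\<alpha> k) * sqrt (\<alpha> k)) * (sqrt (\<beta> i) * sqrt (\<beta> j)) / ((c k - a i) * (c k - a j))"
      unfolding W_def by (simp add: mult_ac)
    then show ?thesis using \<alpha>[OF that] by (simp add: mult_ac)
  qed
  have orth: "(\<Sum>k<Suc n. W i k * W j k) = (if i = j then 1 else 0)" if ij: "i < n" "j < n" for i j
  proof -
    have "(\<Sum>k<Suc n. W i k * W j k) = sqrt (\<beta> i) * sqrt (\<beta> j) * (\<Sum>k<Suc n. \<alpha> k / ((c k - a i) * (c k - a j)))"
      unfolding sum_distrib_left by (intro sum.cong refl WW) auto
    also have "\<dots> = (if i = j then 1 else 0)"
    proof (cases "i = j")
      case True
      then have "sqrt (\<beta> i) * sqrt (\<beta> j) = \<beta> i" using \<beta>[OF ij(1)] by simp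
      then show ?thesis using True \<beta>[OF ij(1)] unfolding \<beta>_def by (simp add: power2_eq_square)
    next
      case False
      then have "a i \<noteq> a j" using inj ij by (auto simp: inj_on_def)
      \<comment> \<open>Partial fractions reduce orthogonality to two secular equations.\<close>
      have "(\<Sum>k<Suc n. \<alpha> k / ((c k - a i) * (c k - a j))) =
          (\<Sum>k<Suc n. (\<alpha> k / (c k - a i) - \<alpha> k / (c k - a j)) / (a i - a j))"
      proof (intro sum.cong refl)
        fix k
        have "c k - a i \<noteq> 0" "c k - a j \<noteq> 0" "a i - a j \<noteq> 0"
          using ac[OF ij(1), of k] ac[OF ij(2), of k] \<open>a i \<noteq> a j\<close> by auto
        moreover define u v where "u = c k - a i" and "v = c k - a j"
        ultimately have "u \<noteq> 0" "v \<noteq> 0" "v - u \<noteq> 0" and uv: "a i - a j = v - u" by auto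
        then have "\<alpha> k / (u * v) = (\<alpha> k / u - \<alpha> k / v) / (v - u)"
          by (simp add: divide_simps) (simp add: algebra_simps)
        then show "\<alpha> k / ((c k - a i) * (c k - a j)) = (\<alpha> k / (c k - a i) - \<alpha> k / (c k - a j)) / (a i - a j)"
          unfolding uv u_def v_def .
      qed
      also have "\<dots> = ((\<Sum>k<Suc n. \<alpha> k / (c k - a i)) - (\<Sum>k<Suc n. \<alpha> k / (c k - a j))) / (a i - a j)"
        by (simp only: sum_divide_distrib[symmetric] sum_subtractf)
      finally show ?thesis using False sum1[OF ij(1)] sum1[OF ij(2)] by simp
    qed
    finally show ?thesis .
  qed
  have diag: "(\<Sum>k<Suc n. c k * W i k * W j k) = (if i = j then a i else 0)" if ij: "i < n" "j < n" for i j
  proof -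
    \<comment> \<open>Splits \<open>c k\<close> as \<open>(c k - a i) + a i\<close>; after summation
      the secular equation kills the first part.\<close>
    have "c k * W i k * W j k = sqrt (\<beta> i) * sqrt (\<beta> j) * (\<alpha> k / (c k - a j)) + a i * (W i k * W j k)" if "k < Suc n" for k
    proof -
      have "c k * (\<alpha> k / ((c k - a i) * (c k - a j))) = \<alpha> k / (c k - a j) + a i * (\<alpha> k / ((c k - a i) * (c k - a j)))"
      proof -
        define u where "u = c k - a i"
        have "u \<noteq> 0" "c k = u + a i" using ac[OF ij(1), of k] by (auto simp: u_def)
        then have "c k * (\<alpha> k / (u * (c k - a j))) = \<alpha> k / (c k - a j) + a i * (\<alpha> k / (u * (c k - a j)))"
          by (simp add: distrib_right add_divide_distrib)
        then show ?thesis unfolding u_def .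
      qed
      then have "c k * (W i k * W j k) = sqrt (\<beta> i) * sqrt (\<beta> j) * (\<alpha> k / (c k - a j)) + a i * (W i k * W j k)"
        unfolding WW[OF that] by (simp only: mult.left_commute[of "c k"] mult.left_commute[of "a i"] distrib_left)
      then show ?thesis by (simp only: mult.assoc)
    qed
    then have "(\<Sum>k<Suc n. c k * W i k * W j k) =
        sqrt (\<beta> i) * sqrt (\<beta> j) * (\<Sum>k<Suc n. \<alpha> k / (c k - a j)) + a i * (\<Sum>k<Suc n. W i k * W j k)"
      unfolding sum_distrib_left sum.distrib[symmetric] by (intro sum.cong refl) auto
    then show ?thesis unfolding sum1[OF ij(2)] orth[OF ij] by simp
  qed
  \<comment> \<open>Coordinate \<open>n\<close> is 0, which removes \<open>g s\<close> from the
    inequality; dividing by \<open>sqrt (\<alpha> k)\<close> cancels the weight in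
    \<open>W\<close>.\<close>
  define x where "x k = (if k < n then \<xi> k / sqrt (\<alpha> k) else 0)" for k
  \<comment> \<open>\<open>T\<close> and \<open>U\<close> are the partial fraction sums of
    \<open>r\<close> over the nodal polynomials of \<open>b\<close> and \<open>a\<close>, so they
    have closed forms at \<open>a i\<close> and \<open>b k\<close>.\<close>
  define T where "T i = (\<Sum>k<n. \<xi> k / (a i - b k))" for i
  define U where "U k = (\<Sum>i<n. \<eta> i / (b k - a i))" for k
  have "(\<Sum>i<n. g (a i) * (\<Sum>k<Suc n. W i k * x k)\<^sup>2) \<le> (\<Sum>k<Suc n. g (c k) * (x k)\<^sup>2)"
    by (rule SOC_matrix[OF inf soc _ orth diag]) (use bpos spos in \<open>auto simp: c_def\<close>)
  moreover have "(\<Sum>k<Suc n. W i k * x k)\<^sup>2 = - ((a i - s) * \<eta> i * T i)" if i: "i < n" for i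
  proof -
    have "(\<Sum>k<Suc n. W i k * x k) = (\<Sum>k<n. - sqrt (\<beta> i) * (\<xi> k / (a i - b k)))"
    proof -
      have "W i k * x k = - sqrt (\<beta> i) * (\<xi> k / (a i - b k))" if "k < n" for k
      proof -
        have "W i k * x k = sqrt (\<beta> i) * (\<xi> k / (b k - a i))"
          using that \<alpha>[of k] unfolding W_def x_def cb[OF that] by simp
        also have "\<xi> k / (b k - a i) = - (\<xi> k / (a i - b k))"
          by (metis minus_diff_eq minus_divide_right)
        finally show ?thesis by simp
      qed
      then show ?thesis by (simp add: x_def)
    qed
    also have "\<dots> = - sqrt (\<beta> i) * T i" unfolding T_def sum_distrib_left ..
    finally have "(\<Sum>k<Suc n. W i k * x k)\<^sup>2 = \<beta> i * T i * T i"
      using \<beta>[OF i] by (simp add: power_mult_distrib power2_eq_square)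
    moreover have "\<beta> i * T i = - ((a i - s) * \<eta> i)"
    proof -
      have "T i = (\<Sum>k<n. poly r (b k) / ((a i - b k) * (\<Prod>l\<in>{..<n}-{k}. b k - b l)))"
        unfolding T_def \<xi>_def by (simp add: mult.commute)
      also have "\<dots> = poly r (a i) / (\<Prod>l<n. a i - b l)"
        by (intro lagrange_partial_fractions[OF _ b_inj]) (use deg ab[OF _ i] in fastforce)+
      finally have T: "T i = poly r (a i) / (\<Prod>l<n. a i - b l)" .
      have P: "(\<Prod>l<Suc n. a i - c l) = (\<Prod>l<n. a i - b l) * (a i - s)"
        by (simp add: cn cb)
      have nz: "(\<Prod>l<n. a i - b l) \<noteq> 0" using ab[OF _ i] by (fastforce simp: prod_zero_iff)
      have "\<beta> i = - ((\<Prod>l<Suc n. a i - c l) / (\<Prod>j\<in>{..<n}-{i}. a i - a j))"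
        unfolding \<beta>_def sum2[OF i] by simp
      then show ?thesis unfolding T P \<eta>_def using nz by simp
    qed
    ultimately show ?thesis by simp
  qed
  moreover have "(\<Sum>k<Suc n. g (c k) * (x k)\<^sup>2) = (\<Sum>k<n. (b k - s) * g (b k) * \<xi> k * U k)"
  proof -
    have "g (c k) * (x k)\<^sup>2 = (b k - s) * g (b k) * \<xi> k * U k" if k: "k < n" for k
    proof -
      have "U k = (\<Sum>i<n. poly r (a i) / ((b k - a i) * (\<Prod>l\<in>{..<n}-{i}. a i - a l)))"
        unfolding U_def \<eta>_def by (simp add: mult.commute)
      also have "\<dots> = poly r (b k) / (\<Prod>l<n. b k - a l)"
        by (intro lagrange_partial_fractions[OF _ inj]) (use deg ab[OF k] in fastforce)+
      finally have U: "U k = poly r (b k) / (\<Prod>l<n. b k - a l)" .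
      have nz: "(\<Prod>l\<in>{..<n}-{k}. b k - b l) \<noteq> 0"
        using b_inj k by (auto simp: prod_zero_iff inj_on_def)
      have "\<xi> k / \<alpha> k = (b k - s) * U k"
        unfolding \<alpha>_def D[OF k] cb[OF k] U \<xi>_def using nz by simp
      moreover have "(x k)\<^sup>2 = \<xi> k * (\<xi> k / \<alpha> k)"
        using k \<alpha>[of k] by (simp add: x_def power_divide power2_eq_square)
      ultimately show ?thesis using k by (simp add: cb)
    qed
    then show ?thesis by (simp add: x_def)
  qed
  ultimately have "0 \<le> (\<Sum>k<n. (b k - s) * g (b k) * \<xi> k * U k) + (\<Sum>i<n. (a i - s) * g (a i) * \<eta> i * T i)"
    by (simp add: sum_negf mult_ac)
  also have "(\<Sum>k<n. (b k - s) * g (b k) * \<xi> k * U k) =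
      (\<Sum>k<n. \<Sum>i<n. \<xi> k * \<eta> i * ((b k - s) * g (b k) / (b k - a i)))"
    unfolding U_def sum_distrib_left by (intro sum.cong refl) (simp add: mult_ac)
  also have "(\<Sum>i<n. (a i - s) * g (a i) * \<eta> i * T i) =
      (\<Sum>i<n. \<Sum>k<n. \<xi> k * \<eta> i * (- ((a i - s) * g (a i) / (b k - a i))))"
    unfolding T_def sum_distrib_left
  proof (intro sum.cong refl)
    fix i k
    have "a i - b k = - (b k - a i)" by simp
    then show "(a i - s) * g (a i) * \<eta> i * (\<xi> k / (a i - b k)) = \<xi> k * \<eta> i * (- ((a i - s) * g (a i) / (b k - a i)))"
      by (simp only: minus_divide_right[symmetric]) (simp add: mult_ac)
  qed
  also have "\<dots> = (\<Sum>k<n. \<Sum>i<n. \<xi> k * \<eta> i * (- ((a i - s) * g (a i) / (b k - a i))))"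
    by (rule sum.swap)
  finally show ?thesis
    unfolding sum.distrib[symmetric] distrib_left[symmetric] by (simp add: diff_divide_distrib)
qed

section \<open>Loewner forms and the passage to the diagonal\<close>

lemma linear_nonneg_small_large:
  fixes X Y \<delta> K :: real
  assumes small: "\<And>s. 0 < s \<Longrightarrow> s < \<delta> \<Longrightarrow> 0 \<le> Y - s * X" and "\<delta> > 0"
    and large: "\<And>s. K < s \<Longrightarrow> 0 \<le> Y - s * X"
  shows "0 \<le> Y" "X \<le> 0"
proof -
  have lim: "((\<lambda>s. Y - s * X) \<longlongrightarrow> Y - 0 * X) (at_right 0)" by (intro tendsto_intros)
  have ev: "\<forall>\<^sub>F s in at_right 0. 0 \<le> Y - s * X"
    unfolding eventually_at_right_field using assms by blast
  have "0 \<le> Y - 0 * X" by (rule tendsto_lowerbound[OF lim ev]) simp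
  then show "0 \<le> Y" by simp
  show "X \<le> 0"
  proof (rule ccontr)
    assume "\<not> X \<le> 0"
    then have X: "X > 0" by simp
    define s where "s = max (K + 1) (Y / X + 1)"
    have "(Y / X + 1) * X \<le> s * X" unfolding s_def using X by (intro mult_right_mono) auto
    then have "Y + X \<le> s * X" using X by (simp add: distrib_right)
    moreover have "K < s" unfolding s_def by linarith
    ultimately show False using large[of s] X by linarith
  qed
qed

text \<open>The mixed form is affine in the free eigenvalue \<open>s\<close>, which may lie below
  all nodes or above them. Since \<epsilon> is smaller than every gap, each \<open>b i\<close> lies
  between \<open>a i\<close> and the next larger node.\<close>

lemma SOC_loewner_forms:
  fixes a :: "nat \<Rightarrow> real" and \<epsilon> :: real and r :: "real poly"
  assumes inf: "infinite_dimensional TYPE('h::complex_hilbert)" and soc: "SOC TYPE('h) {0<..} g"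
    and deg: "degree r < n" and apos: "\<And>i. i < n \<Longrightarrow> 0 < a i"
    and \<epsilon>: "\<epsilon> > 0" "\<And>i j. i < n \<Longrightarrow> j < n \<Longrightarrow> i \<noteq> j \<Longrightarrow> \<epsilon> < \<bar>a i - a j\<bar>"
  defines "b \<equiv> \<lambda>i. a i + \<epsilon>"
  defines "\<eta> \<equiv> \<lambda>i. poly r (a i) / (\<Prod>j\<in>{..<n}-{i}. a i - a j)"
    and "\<xi> \<equiv> \<lambda>k. poly r (b k) / (\<Prod>l\<in>{..<n}-{k}. b k - b l)"
  shows "0 \<le> (\<Sum>k<n. \<Sum>i<n. \<xi> k * \<eta> i * ((b k * g (b k) - a i * g (a i)) / (b k - a i)))" (is "0 \<le> ?Y")
    and "(\<Sum>k<n. \<Sum>i<n. \<xi> k * \<eta> i * ((g (b k) - g (a i)) / (b k - a i))) \<le> 0" (is "?X \<le> 0")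
proof -
  have ba: "b i - a j = a i - a j + \<epsilon>" "b i - b j = a i - a j" "a i - b j = a i - a j - \<epsilon>" for i j
    by (simp_all add: b_def)
  have bpos: "0 < b i" if "i < n" for i using apos[OF that] \<epsilon>(1) by (simp add: b_def)
  have a_inj: "inj_on a {..<n}" using \<epsilon> by (fastforce simp: inj_on_def)
  then have b_inj: "inj_on b {..<n}" by (auto simp: inj_on_def b_def)
  have cross: "0 < (b k - a i) * (b k - b i)" "0 < (a k - b i) * (a k - a i)"
    if "i < n" "k < n" "k \<noteq> i" for i k
    using \<epsilon>(1) \<epsilon>(2)[OF that(2,1,3)] unfolding ba by (auto simp: zero_less_mult_iff abs_if split: if_splits)
  have split: "(\<Sum>k<n. \<Sum>i<n. \<xi> k * \<eta> i * (((b k - s) * g (b k) - (a i - s) * g (a i)) / (b k - a i))) = ?Y - s * ?X" for s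
    unfolding sum_distrib_left sum_subtractf[symmetric]
    by (intro sum.cong refl) (simp add: algebra_simps diff_divide_distrib add_divide_distrib)
  define \<delta> where "\<delta> = Min (insert 1 (a ` {..<n}))"
  \<comment> \<open>The inserted 1 ensures that every \<open>s > K\<close> is positive.\<close>
  define K where "K = Max (insert 1 (b ` {..<n}))"
  have \<delta>: "\<delta> > 0" "\<And>i. i < n \<Longrightarrow> \<delta> \<le> a i" unfolding \<delta>_def using apos by auto
  have K: "K \<ge> 1" "\<And>i. i < n \<Longrightarrow> b i \<le> K" unfolding K_def by auto
  have small: "0 \<le> ?Y - s * ?X" if s: "0 < s" "s < \<delta>" for s
    unfolding split[symmetric] unfolding \<xi>_def \<eta>_def
  proof (rule SOC_mixed_loewner_form[OF inf soc deg bpos s(1) a_inj])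
    fix i assume i: "i < n"
    show "0 < (b i - a i) * (b i - s)" "0 < (s - a i) * (s - b i)"
      using \<delta>(2)[OF i] s \<epsilon>(1) by (auto simp: b_def zero_less_mult_iff)
  qed (use cross in auto)
  \<comment> \<open>For \<open>s\<close> above all nodes, interlacing asks for the larger nodes as
    eigenvalues of the compression, so \<open>a\<close> and \<open>b\<close> exchange roles; the
    difference quotients are symmetric under this exchange.\<close>
  have large: "0 \<le> ?Y - s * ?X" if s: "K < s" for s
  proof -
    have "0 \<le> (\<Sum>k<n. \<Sum>i<n. \<eta> k * \<xi> i * (((a k - s) * g (a k) - (b i - s) * g (b i)) / (a k - b i)))"
      unfolding \<xi>_def \<eta>_def
    proof (rule SOC_mixed_loewner_form[OF inf soc deg apos _ b_inj])
      show "0 < s" using s K(1) by simp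
      fix i assume i: "i < n"
      show "0 < (a i - b i) * (a i - s)" "0 < (s - b i) * (s - a i)"
        using K(2)[OF i] s \<epsilon>(1) by (auto simp: b_def zero_less_mult_iff mult_less_0_iff)
    qed (use cross in auto)
    also have "\<dots> = (\<Sum>i<n. \<Sum>k<n. \<eta> k * \<xi> i * (((a k - s) * g (a k) - (b i - s) * g (b i)) / (a k - b i)))"
      by (rule sum.swap)
    also have "\<dots> = ?Y - s * ?X"
      unfolding split[symmetric]
    proof (intro sum.cong refl)
      fix i k
      have "((a k - s) * g (a k) - (b i - s) * g (b i)) / (a k - b i) = ((b i - s) * g (b i) - (a k - s) * g (a k)) / (b i - a k)"
        by (metis minus_diff_eq minus_divide_divide)
      then show "\<eta> k * \<xi> i * (((a k - s) * g (a k) - (b i - s) * g (b i)) / (a k - b i)) =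
        \<xi> i * \<eta> k * (((b i - s) * g (b i) - (a k - s) * g (a k)) / (b i - a k))" by simp
    qed
    finally show ?thesis .
  qed
  show "0 \<le> ?Y" "?X \<le> 0"
    by (rule linear_nonneg_small_large[OF small \<delta>(1) large]; assumption)+
qed

text \<open>The Loewner forms are only available off the diagonal, between \<open>a\<close> and \<open>a + \<epsilon>\<close>. In the
  combination \<open>V\<close> of the two forms the difference quotients of \<open>g\<close> cancel for \<open>k = i = j\<close>, so the
  limit \<open>\<epsilon> \<rightarrow> 0\<close> needs no differentiability of \<open>g\<close>.\<close>

lemma SOC_imp_Kwong:
  assumes inf: "infinite_dimensional TYPE('h::complex_hilbert)" and soc: "SOC TYPE('h) {0<..} g"
  shows "Kwong g"
proof (rule KwongI)
  show cont: "continuous_on {0<..} g" using soc by (simp add: SOC_def)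
  fix n and a :: "nat \<Rightarrow> real" and \<eta>
  assume a: "inj_on a {..<n}" "\<And>i. i < n \<Longrightarrow> 0 < a i"
  define d where "d k = (\<Prod>l\<in>{..<n}-{k}. a k - a l)" for k
  have d: "d k \<noteq> 0" if "k < n" for k
    unfolding d_def using a(1) that by (auto simp: prod_zero_iff inj_on_def)
  \<comment> \<open>The matrix expressing the coefficients at the shifted nodes by those at
    \<open>a\<close>; it tends to the identity as \<epsilon> tends to 0.\<close>
  define S where "S \<epsilon> k i = (\<Prod>j\<in>{..<n}-{i}. a k + \<epsilon> - a j) / d k" for \<epsilon> k i
  \<comment> \<open>The Cauchy factor keeps the unshifted \<open>a i + a j\<close>, independent of
    \<open>k\<close>, so that the Schur product theorem applies after summing over
    \<open>k\<close>.\<close>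
  define V where "V \<epsilon> k i j = - ((g (a k + \<epsilon>) - g (a j)) / (a k + \<epsilon> - a j)) +
      2 * (((a k + \<epsilon>) * g (a k + \<epsilon>) - a j * g (a j)) / (a k + \<epsilon> - a j)) * (1 / (a i + a j))" for \<epsilon> k i j
  have "\<forall>\<^sub>F \<epsilon> in at_right 0. \<epsilon> < \<bar>a i - a j\<bar>" if "i < n" "j < n" "i \<noteq> j" for i j
  proof -
    have "a i \<noteq> a j" using a(1) that by (auto simp: inj_on_def)
    then show ?thesis unfolding eventually_at_right_field by (intro exI[of _ "\<bar>a i - a j\<bar>"]) auto
  qed
  then have "\<forall>\<^sub>F \<epsilon> in at_right 0. \<forall>i\<in>{..<n}. \<forall>j\<in>{..<n}. i \<noteq> j \<longrightarrow> \<epsilon> < \<bar>a i - a j\<bar>"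
    by (auto simp: eventually_ball_finite_distrib)
  then have "\<forall>\<^sub>F \<epsilon> in at_right 0. 0 \<le> (\<Sum>i<n. \<Sum>j<n. \<eta> i * (\<Sum>k<n. S \<epsilon> k i * V \<epsilon> k i j) * \<eta> j)"
    using eventually_at_right_less[of "0 :: real"]
  proof eventually_elim
    case (elim \<epsilon>)
    let ?L = "\<lambda>k j. (g (a k + \<epsilon>) - g (a j)) / (a k + \<epsilon> - a j)"
    let ?M = "\<lambda>k j. ((a k + \<epsilon>) * g (a k + \<epsilon>) - a j * g (a j)) / (a k + \<epsilon> - a j)"
    have forms: "0 \<le> (\<Sum>i<n. \<Sum>j<n. x i * (\<Sum>k<n. S \<epsilon> k i * ?M k j) * x j) \<and>
        0 \<le> (\<Sum>i<n. \<Sum>j<n. x i * (\<Sum>k<n. S \<epsilon> k i * (- ?L k j)) * x j)" for x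
    proof (cases "n = 0")
      case False
      \<comment> \<open>The polynomial of degree below \<open>n\<close> whose coefficients at the
        nodes \<open>a\<close> are the given \<open>x\<close>, so that every vector is
        reached.\<close>
      define r where "r = (\<Sum>i<n. smult (x i) (\<Prod>j\<in>{..<n}-{i}. [:- a j, 1:]))"
      have r: "poly r u = (\<Sum>i<n. x i * (\<Prod>j\<in>{..<n}-{i}. u - a j))" for u
        unfolding r_def by (simp add: poly_sum poly_prod)
      have "degree r \<le> n - 1"
        unfolding r_def
      proof (intro degree_sum_le)
        fix i assume "i \<in> {..<n}"
        then show "degree (smult (x i) (\<Prod>j\<in>{..<n}-{i}. [:- a j, 1:])) \<le> n - 1"
          using degree_prod_sum_le[of "{..<n}-{i}" "\<lambda>j. [:- a j, 1:]"]
          by (intro order.trans[OF degree_smult_le]) (simp add: o_def)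
      qed simp
      then have deg: "degree r < n" using False by simp
      have ra: "poly r (a i) / d i = x i" if i: "i < n" for i
      proof -
        have "poly r (a i) = (\<Sum>k<n. if k = i then x i * d i else 0)"
          unfolding r
        proof (intro sum.cong refl)
          fix k assume "k \<in> {..<n}"
          have "(\<Prod>j\<in>{..<n}-{k}. a i - a j) = 0" if "k \<noteq> i" using i that by (intro prod_zero) auto
          then show "x k * (\<Prod>j\<in>{..<n}-{k}. a i - a j) = (if k = i then x i * d i else 0)"
            by (auto simp: d_def)
        qed
        then show ?thesis using i d[OF i] by simp
      qed
      have rb: "poly r (a k + \<epsilon>) / (\<Prod>l\<in>{..<n}-{k}. a k + \<epsilon> - (a l + \<epsilon>)) = (\<Sum>i<n. x i * S \<epsilon> k i)" for k
        unfolding r S_def sum_divide_distrib d_def by simp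
      have rearrange: "(\<Sum>k<n. \<Sum>j<n. (\<Sum>i<n. x i * S \<epsilon> k i) * x j * Z k j) =
          (\<Sum>i<n. \<Sum>j<n. x i * (\<Sum>k<n. S \<epsilon> k i * Z k j) * x j)" for Z :: "nat \<Rightarrow> nat \<Rightarrow> real"
      proof -
        have "(\<Sum>k<n. \<Sum>j<n. (\<Sum>i<n. x i * S \<epsilon> k i) * x j * Z k j) =
            (\<Sum>k<n. \<Sum>j<n. \<Sum>i<n. x i * (S \<epsilon> k i * Z k j) * x j)"
          unfolding sum_distrib_right by (intro sum.cong refl) (simp add: mult_ac)
        also have "\<dots> = (\<Sum>j<n. \<Sum>k<n. \<Sum>i<n. x i * (S \<epsilon> k i * Z k j) * x j)" by (rule sum.swap)
        also have "\<dots> = (\<Sum>j<n. \<Sum>i<n. \<Sum>k<n. x i * (S \<epsilon> k i * Z k j) * x j)" by (intro sum.cong refl sum.swap)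
        also have "\<dots> = (\<Sum>i<n. \<Sum>j<n. \<Sum>k<n. x i * (S \<epsilon> k i * Z k j) * x j)" by (rule sum.swap)
        finally show ?thesis unfolding sum_distrib_left sum_distrib_right .
      qed
      have \<epsilon>: "\<epsilon> > 0" "\<And>i j. i < n \<Longrightarrow> j < n \<Longrightarrow> i \<noteq> j \<Longrightarrow> \<epsilon> < \<bar>a i - a j\<bar>" using elim by auto
      have coeffs: "(\<Sum>k<n. \<Sum>i<n. poly r (a k + \<epsilon>) / (\<Prod>l\<in>{..<n}-{k}. a k + \<epsilon> - (a l + \<epsilon>)) *
            (poly r (a i) / (\<Prod>j\<in>{..<n}-{i}. a i - a j)) * Z k i) =
          (\<Sum>k<n. \<Sum>j<n. (\<Sum>i<n. x i * S \<epsilon> k i) * x j * Z k j)" for Z :: "nat \<Rightarrow> nat \<Rightarrow> real"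
        unfolding rb d_def[symmetric] using ra by (intro sum.cong refl) simp
      have "0 \<le> (\<Sum>k<n. \<Sum>j<n. (\<Sum>i<n. x i * S \<epsilon> k i) * x j * ?M k j)"
        unfolding coeffs[symmetric]
        by (rule SOC_loewner_forms(1)[where a = a and \<epsilon> = \<epsilon>, OF inf soc deg a(2) \<epsilon>])
      moreover have "(\<Sum>k<n. \<Sum>j<n. (\<Sum>i<n. x i * S \<epsilon> k i) * x j * ?L k j) \<le> 0"
        unfolding coeffs[symmetric]
        by (rule SOC_loewner_forms(2)[where a = a and \<epsilon> = \<epsilon>, OF inf soc deg a(2) \<epsilon>])
      ultimately show ?thesis
        unfolding rearrange by (simp add: sum_negf)
    qed simp
    have "0 \<le> (\<Sum>i<n. \<Sum>j<n. \<eta> i * ((\<Sum>k<n. S \<epsilon> k i * ?M k j) * (1 / (a i + a j))) * \<eta> j)"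
      using forms by (intro schur_product_form cauchy_pos_semidef a(2)) blast+
    moreover have "0 \<le> (\<Sum>i<n. \<Sum>j<n. \<eta> i * (\<Sum>k<n. S \<epsilon> k i * (- ?L k j)) * \<eta> j)"
      using forms by blast
    ultimately have "0 \<le> (\<Sum>i<n. \<Sum>j<n. \<eta> i * (\<Sum>k<n. S \<epsilon> k i * (- ?L k j)) * \<eta> j) +
        2 * (\<Sum>i<n. \<Sum>j<n. \<eta> i * ((\<Sum>k<n. S \<epsilon> k i * ?M k j) * (1 / (a i + a j))) * \<eta> j)" by simp
    also have "\<dots> = (\<Sum>i<n. \<Sum>j<n. \<eta> i * ((\<Sum>k<n. S \<epsilon> k i * (- ?L k j)) +
        2 * ((\<Sum>k<n. S \<epsilon> k i * ?M k j) * (1 / (a i + a j)))) * \<eta> j)"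
      unfolding sum_distrib_left[of 2] sum.distrib[symmetric]
      by (intro sum.cong refl) (simp only: distrib_left distrib_right mult_ac)
    also have "\<dots> = (\<Sum>i<n. \<Sum>j<n. \<eta> i * (\<Sum>k<n. S \<epsilon> k i * V \<epsilon> k i j) * \<eta> j)"
    proof (intro sum.cong refl arg_cong2[where f = "(*)"])
      fix i j
      have "(\<Sum>k<n. S \<epsilon> k i * V \<epsilon> k i j) = (\<Sum>k<n. S \<epsilon> k i * (- ?L k j) + 2 * (S \<epsilon> k i * ?M k j * (1 / (a i + a j))))"
        unfolding V_def by (intro sum.cong refl) (simp only: distrib_left mult_ac)
      then show "(\<Sum>k<n. S \<epsilon> k i * (- ?L k j)) + 2 * ((\<Sum>k<n. S \<epsilon> k i * ?M k j) * (1 / (a i + a j))) =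
          (\<Sum>k<n. S \<epsilon> k i * V \<epsilon> k i j)"
        by (simp only: sum.distrib sum_distrib_left[symmetric] sum_distrib_right[symmetric])
    qed
    finally show ?case .
  qed
  moreover have "((\<lambda>\<epsilon>. \<Sum>i<n. \<Sum>j<n. \<eta> i * (\<Sum>k<n. S \<epsilon> k i * V \<epsilon> k i j) * \<eta> j) \<longlongrightarrow>
      (\<Sum>i<n. \<Sum>j<n. \<eta> i * ((g (a i) + g (a j)) / (a i + a j)) * \<eta> j)) (at_right 0)"
  proof (intro tendsto_intros)
    fix i j assume "i \<in> {..<n}" "j \<in> {..<n}"
    then have ij: "i < n" "j < n" by auto
    have sum0: "a i + a j > 0" using a(2)[OF ij(1)] a(2)[OF ij(2)] by simp
    have shift: "((\<lambda>\<epsilon>. a k + \<epsilon>) \<longlongrightarrow> a k) (at_right 0)" for k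
      using tendsto_add[OF tendsto_const[of "a k"] tendsto_ident_at[of 0 "{0<..}"]] by simp
    have g: "((\<lambda>\<epsilon>. g (a k + \<epsilon>)) \<longlongrightarrow> g (a k)) (at_right 0)" if "k < n" for k
    proof -
      have "isCont g (a k)" using cont a(2)[OF that] by (simp add: continuous_on_eq_continuous_at)
      then show ?thesis by (rule isCont_tendsto_compose) (rule shift)
    qed
    \<comment> \<open>Over a common denominator; for \<open>i = j = k\<close> the factor of
      \<open>g (a k + \<epsilon>)\<close> is \<open>2 * \<epsilon>\<close>, which cancels the
      pole.\<close>
    have V: "V \<epsilon> k i j = (g (a k + \<epsilon>) * (2 * (a k + \<epsilon>) - a i - a j) + g (a j) * (a i - a j)) /
        ((a k + \<epsilon> - a j) * (a i + a j))" if "a k + \<epsilon> - a j \<noteq> 0" for \<epsilon> k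
    proof -
      define v u where "v = a k + \<epsilon> - a j" and "u = a i + a j"
      have "v \<noteq> 0" "u \<noteq> 0" using that sum0 by (auto simp: v_def u_def)
      then have "- ((g (a k + \<epsilon>) - g (a j)) / v) + 2 * (((a k + \<epsilon>) * g (a k + \<epsilon>) - a j * g (a j)) / v) * (1 / u) =
         (2 * ((a k + \<epsilon>) * g (a k + \<epsilon>) - a j * g (a j)) - u * (g (a k + \<epsilon>) - g (a j))) / (v * u)"
        by (simp add: divide_simps)
      also have "2 * ((a k + \<epsilon>) * g (a k + \<epsilon>) - a j * g (a j)) - u * (g (a k + \<epsilon>) - g (a j)) =
          g (a k + \<epsilon>) * (2 * (a k + \<epsilon>) - a i - a j) + g (a j) * (a i - a j)"
        by (simp add: u_def algebra_simps)
      finally show ?thesis unfolding V_def v_def u_def .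
    qed
    have "((\<lambda>\<epsilon>. \<Sum>k<n. S \<epsilon> k i * V \<epsilon> k i j) \<longlongrightarrow> (\<Sum>k<n. if k = i then (g (a i) + g (a j)) / (a i + a j) else 0)) (at_right 0)"
    proof (intro tendsto_sum)
      fix k assume "k \<in> {..<n}"
      then have k: "k < n" by simp
      show "((\<lambda>\<epsilon>. S \<epsilon> k i * V \<epsilon> k i j) \<longlongrightarrow> (if k = i then (g (a i) + g (a j)) / (a i + a j) else 0)) (at_right 0)"
      proof (cases "k = j")
        case False
        \<comment> \<open>Off \<open>k = j\<close> the denominators stay away from 0 and the limit
          is taken directly.\<close>
        then have kj: "a k - a j \<noteq> 0" using a(1) k ij by (auto simp: inj_on_def)
        have lim: "((\<lambda>\<epsilon>. S \<epsilon> k i * ((g (a k + \<epsilon>) * (2 * (a k + \<epsilon>) - a i - a j) + g (a j) * (a i - a j)) /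
            ((a k + \<epsilon> - a j) * (a i + a j)))) \<longlongrightarrow>
            (\<Prod>j\<in>{..<n}-{i}. a k - a j) / d k * ((g (a k) * (2 * a k - a i - a j) + g (a j) * (a i - a j)) /
            ((a k - a j) * (a i + a j)))) (at_right 0)"
          unfolding S_def using kj sum0 d[OF k] by (intro tendsto_intros shift g k) auto
        have val: "(\<Prod>j\<in>{..<n}-{i}. a k - a j) / d k * ((g (a k) * (2 * a k - a i - a j) + g (a j) * (a i - a j)) /
            ((a k - a j) * (a i + a j))) = (if k = i then (g (a i) + g (a j)) / (a i + a j) else 0)"
        proof (cases "k = i")
          case True
          have "g (a i) * (2 * a i - a i - a j) + g (a j) * (a i - a j) = (a i - a j) * (g (a i) + g (a j))"
            by (simp add: algebra_simps)
          then show ?thesis using True kj d[OF k] by (simp add: d_def)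
        next
          case False
          then have "(\<Prod>j\<in>{..<n}-{i}. a k - a j) = 0" using k by (intro prod_zero) auto
          then show ?thesis using False by simp
        qed
        have "((\<lambda>\<epsilon>. a k + \<epsilon> - a j) \<longlongrightarrow> a k - a j) (at_right 0)" by (intro tendsto_intros shift)
        then have "\<forall>\<^sub>F \<epsilon> in at_right 0. a k + \<epsilon> - a j \<noteq> 0"
          using kj by (rule tendsto_imp_eventually_ne)
        then have "\<forall>\<^sub>F \<epsilon> in at_right 0. S \<epsilon> k i * ((g (a k + \<epsilon>) * (2 * (a k + \<epsilon>) - a i - a j) + g (a j) * (a i - a j)) /
            ((a k + \<epsilon> - a j) * (a i + a j))) = S \<epsilon> k i * V \<epsilon> k i j"
        proof eventually_elim
          case (elim \<epsilon>)
          show ?case unfolding V[OF elim] ..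
        qed
        with lim show ?thesis unfolding val by (rule Lim_transform_eventually)
      next
        case kj: True
        show ?thesis
        proof (cases "k = i")
          case True
          have lim: "((\<lambda>\<epsilon>. S \<epsilon> i i * (g (a i + \<epsilon>) / a i)) \<longlongrightarrow> (\<Prod>j\<in>{..<n}-{i}. a i - a j) / d i * (g (a i) / a i)) (at_right 0)"
            unfolding S_def using d[OF ij(1)] a(2)[OF ij(1)] by (intro tendsto_intros shift g ij) auto
          have "\<forall>\<^sub>F \<epsilon> in at_right 0. S \<epsilon> i i * (g (a i + \<epsilon>) / a i) = S \<epsilon> k i * V \<epsilon> k i j"
            using eventually_at_right_less[of "0 :: real"]
          proof eventually_elim
            case (elim \<epsilon>)
            have "V \<epsilon> k i j = g (a i + \<epsilon>) * (2 * \<epsilon>) / (\<epsilon> * (2 * a i))"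
              using elim kj True V[of k \<epsilon>] by simp
            also have "\<dots> = g (a i + \<epsilon>) / a i" using elim by simp
            finally show ?case using True by simp
          qed
          with lim have "((\<lambda>\<epsilon>. S \<epsilon> k i * V \<epsilon> k i j) \<longlongrightarrow> (\<Prod>j\<in>{..<n}-{i}. a i - a j) / d i * (g (a i) / a i)) (at_right 0)"
            by (rule Lim_transform_eventually)
          then show ?thesis using kj True d[OF ij(1)] a(2)[OF ij(1)] by (simp add: d_def)
        next
          case False
          \<comment> \<open>For \<open>k = j\<close> and \<open>i \<noteq> j\<close> the factor of
            \<open>S\<close> with index \<open>j\<close> is \<epsilon> itself and cancels the pole
            of \<open>V\<close>; the remaining numerator tends to 0 by \<open>z\<close>.\<close>
          define S' where "S' \<epsilon> = (\<Prod>l\<in>{..<n}-{i}-{j}. a j + \<epsilon> - a l) / d j" for \<epsilon>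
          have S: "S \<epsilon> k i = \<epsilon> * S' \<epsilon>" for \<epsilon>
          proof -
            have "(\<Prod>l\<in>{..<n}-{i}. a j + \<epsilon> - a l) = (a j + \<epsilon> - a j) * (\<Prod>l\<in>{..<n}-{i}-{j}. a j + \<epsilon> - a l)"
              using False kj ij by (intro prod.remove) auto
            then show ?thesis unfolding S_def S'_def kj by simp
          qed
          have lim: "((\<lambda>\<epsilon>. S' \<epsilon> * ((g (a j + \<epsilon>) * (2 * (a j + \<epsilon>) - a i - a j) + g (a j) * (a i - a j)) / (a i + a j))) \<longlongrightarrow>
              (\<Prod>l\<in>{..<n}-{i}-{j}. a j - a l) / d j * ((g (a j) * (2 * a j - a i - a j) + g (a j) * (a i - a j)) / (a i + a j))) (at_right 0)"
            unfolding S'_def using sum0 d[OF ij(2)] by (intro tendsto_intros shift g ij) auto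
          have z: "g (a j) * (2 * a j - a i - a j) + g (a j) * (a i - a j) = 0" by (simp add: algebra_simps)
          have "\<forall>\<^sub>F \<epsilon> in at_right 0. S' \<epsilon> * ((g (a j + \<epsilon>) * (2 * (a j + \<epsilon>) - a i - a j) + g (a j) * (a i - a j)) / (a i + a j)) =
              S \<epsilon> k i * V \<epsilon> k i j"
            using eventually_at_right_less[of "0 :: real"]
          proof eventually_elim
            case (elim \<epsilon>)
            have "a j + \<epsilon> - a j = \<epsilon>" by simp
            then show ?case using elim V[of k \<epsilon>] kj unfolding S by simp
          qed
          with lim have "((\<lambda>\<epsilon>. S \<epsilon> k i * V \<epsilon> k i j) \<longlongrightarrow> 0) (at_right 0)"
            unfolding z by (simp only: div_0 mult_zero_right) (rule Lim_transform_eventually)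
          then show ?thesis using False by simp
        qed
      qed
    qed
    then show "((\<lambda>\<epsilon>. \<Sum>k<n. S \<epsilon> k i * V \<epsilon> k i j) \<longlongrightarrow> (g (a i) + g (a j)) / (a i + a j)) (at_right 0)"
      using ij by simp
  qed
  ultimately show "0 \<le> (\<Sum>i<n. \<Sum>j<n. \<eta> i * ((g (a i) + g (a j)) / (a i + a j)) * \<eta> j)"
    by (intro tendsto_lowerbound) auto
qed

theorem proposition2p13:
  fixes g :: "real \<Rightarrow> real"
  assumes "continuous_on {0<..} g"
    and "\<exists>t>0. g t \<noteq> 0"
  shows "(infinite_dimensional TYPE('h::complex_hilbert) \<longrightarrow> SOC TYPE('h) {0<..} g \<longrightarrow>
            (\<forall>p. -1 \<le> p \<and> p \<le> 1 \<longrightarrow> Kwong (\<lambda>t. g (t powr p)))) \<and>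
         (Kwong g \<longrightarrow>
            (\<forall>p. 0 \<le> p \<and> p \<le> 1 / 2 \<longrightarrow>
               SOC TYPE('k::complex_hilbert) {0<..} (\<lambda>t. g (t powr p) / t powr p)))"
proof (intro conjI impI allI)
  fix p :: real
  assume "infinite_dimensional TYPE('h)" "SOC TYPE('h) {0<..} g" "-1 \<le> p \<and> p \<le> 1"
  then show "Kwong (\<lambda>t. g (t powr p))"
    by (intro Kwong_compose_powr[OF SOC_imp_Kwong]) auto
next
  fix p :: real
  assume "Kwong g" "0 \<le> p \<and> p \<le> 1 / 2"
  then show "SOC TYPE('k) {0<..} (\<lambda>t. g (t powr p) / t powr p)"
    by (intro SOC_of_Kwong) auto
qed

end
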